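(* Let $\sigma$ be a connection on $B(\mathcal{H})^+$ which is not a scalar multiple of the right-trivial mean $(A,B)\mapsto B$, and let $g$ be the representing function of the transpose of $\sigma$. Given $A>0$ and $B\ge 0$ in $B(\mathcal{H})$, the operator equation $X\,\sigma\,A=B$ has a positive solution $X\in B(\mathcal{H})^+$ if and only if $\operatorname{Sp}(A^{-1/2}BA^{-1/2})\subseteq \operatorname{Range}(g)$. In fact, such a solution is unique and given by $$X=A^{1/2}g^{-1}(A^{-1/2}BA^{-1/2})A^{1/2}.$$
   Context: $\mathcal{H}$ is a Hilbert space, $B(\mathcal{H})$ the bounded linear operators on it, $B(\mathcal{H})^+$ the positive (semidefinite) operators; $A\le B$ means $B-A\in B(\mathcal{H})^+$; $A>0$ means $A$ is strictly positive (positive and invertible); $\operatorname{Sp}(X)$ is the spectrum of $X$. A connection is a binary operation $\sigma$ on $B(\mathcal{H})^+$ such that for all positive $A,B,C,D$: (M1) $A\le C$, $B\le D$ imply $A\,\sigma\,B\le C\,\sigma\,D$; (M2) $C(A\,\sigma\,B)C\le (CAC)\,\sigma\,(CBC)$; (M3) if $A_n\downarrow A$ and $B_n\downarrow B$ then $A_n\,\sigma\,B_n\downarrow A\,\sigma\,B$, where $A_n\downarrow A$ means $(A_n)$ is a decreasing sequence converging strongly to $A$. The transpose of $\sigma$ is the connection $(A,B)\mapsto B\,\sigma\,A$. A function $f:[0,\infty)\to[0,\infty)$ is operator monotone if (with the continuous functional calculus, $f$ continuous) $A\le B$ implies $f(A)\le f(B)$ for all positive operators $A,B$ on every Hilbert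 space. Representing function (Kubo–Ando theorem, taken as known): for a connection $\tau$ there is a unique operator monotone $f:[0,\infty)\to[0,\infty)$ with $f(x)I=I\,\tau\,(xI)$ for all $x\ge 0$; $\tau\mapsto f$ is a bijection, and $f(A)=I\,\tau\,A$ for all $A\ge0$. If $f$ represents $\sigma$, then the representing function $g$ of the transpose of $\sigma$ satisfies $g(x)=xf(1/x)$ for $x>0$. $g^{-1}$ denotes the inverse function $\operatorname{Range}(g)\to[0,\infty)$ ($g$ is injective under the stated hypothesis), applied by the continuous functional calculus. Scalars in "scalar multiple" are nonnegative reals. *)

theory Defs
  imports "HOL-Analysis.Analysis" "HOL-Computational_Algebra.Polynomial"
begin

section \<open>Complex Hilbert spaces\<close>

text \<open>The inner product is linear in its first argument. The underlying real Hilbert space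
  is that of the library, so norm, limits and completeness are the library's.\<close>

class complex_hilbert_space = real_inner + complete_space +
  fixes scaleC :: "complex \<Rightarrow> 'a \<Rightarrow> 'a" (infixr "*\<^sub>C" 75)
    and cinner :: "'a \<Rightarrow> 'a \<Rightarrow> complex"
  assumes scaleC_add_right: "a *\<^sub>C (x + y) = a *\<^sub>C x + a *\<^sub>C y"
    and scaleC_add_left: "(a + b) *\<^sub>C x = a *\<^sub>C x + b *\<^sub>C x"
    and scaleC_scaleC: "a *\<^sub>C b *\<^sub>C x = (a * b) *\<^sub>C x"
    and scaleR_scaleC: "r *\<^sub>R x = complex_of_real r *\<^sub>C x"
    and cinner_commute: "cinner x y = cnj (cinner y x)"
    and cinner_add_left: "cinner (x + y) z = cinner x z + cinner y z"
    and cinner_scaleC_left: "cinner (a *\<^sub>C x) y = a * cinner x y"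
    and inner_eq_Re_cinner: "inner x y = Re (cinner x y)"

lemma norm_scaleC: "norm (a *\<^sub>C x) = cmod a * norm (x :: 'a :: complex_hilbert_space)"
proof -
  have "cinner (a *\<^sub>C x) (a *\<^sub>C x) = (a * cnj a) * cinner x x"
    by (simp add: cinner_scaleC_left cinner_commute[of x "a *\<^sub>C x"] cinner_commute[of x x, symmetric])
  also have "a * cnj a = complex_of_real ((cmod a)\<^sup>2)"
    by (simp only: complex_norm_square)
  finally have "inner (a *\<^sub>C x) (a *\<^sub>C x) = (cmod a)\<^sup>2 * inner x x"
    by (simp add: inner_eq_Re_cinner)
  then show ?thesis
    by (simp add: norm_eq_sqrt_inner real_sqrt_mult)
qed

lemma bounded_linear_scaleC: "bounded_linear (\<lambda>x :: 'a :: complex_hilbert_space. a *\<^sub>C x)"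
proof (rule bounded_linear_intro[where K = "cmod a"])
  fix r :: real and x :: 'a
  show "a *\<^sub>C (r *\<^sub>R x) = r *\<^sub>R (a *\<^sub>C x)"
    by (simp add: scaleR_scaleC scaleC_scaleC mult.commute)
qed (simp_all add: scaleC_add_right norm_scaleC mult.commute)


section \<open>Bounded operators\<close>

typedef (overloaded) 'a bop =
  "{T :: 'a :: complex_hilbert_space \<Rightarrow>\<^sub>L 'a. \<forall>c x. blinfun_apply T (c *\<^sub>C x) = c *\<^sub>C blinfun_apply T x}"
  morphisms blinfun_of_bop Bop
proof
  show "id_blinfun \<in> {T :: 'a \<Rightarrow>\<^sub>L 'a. \<forall>c x. blinfun_apply T (c *\<^sub>C x) = c *\<^sub>C blinfun_apply T x}"
    by simp
qed

setup_lifting type_definition_bop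

lift_definition bop_apply :: "'a :: complex_hilbert_space bop \<Rightarrow> 'a \<Rightarrow> 'a" is blinfun_apply .

lift_definition scalar_op :: "complex \<Rightarrow> 'a :: complex_hilbert_space bop"
  is "\<lambda>z. Blinfun (\<lambda>x. z *\<^sub>C x)"
  by (simp add: bounded_linear_Blinfun_apply bounded_linear_scaleC scaleC_scaleC mult.commute)

instantiation bop :: (complex_hilbert_space) real_normed_algebra
begin

lift_definition zero_bop :: "'a bop" is 0
  by (metis bounded_linear_scaleC linear_simps(3) zero_blinfun.rep_eq mem_Collect_eq)
lift_definition plus_bop :: "'a bop \<Rightarrow> 'a bop \<Rightarrow> 'a bop" is "(+)"
  by (simp add: plus_blinfun.rep_eq scaleC_add_right)
lift_definition minus_bop :: "'a bop \<Rightarrow> 'a bop \<Rightarrow> 'a bop" is "(-)"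
  by (simp add: minus_blinfun.rep_eq linear_simps(2)[OF bounded_linear_scaleC])
lift_definition uminus_bop :: "'a bop \<Rightarrow> 'a bop" is uminus
  by (simp add: uminus_blinfun.rep_eq linear_simps(4)[OF bounded_linear_scaleC])
lift_definition scaleR_bop :: "real \<Rightarrow> 'a bop \<Rightarrow> 'a bop" is scaleR
  by (simp add: scaleR_blinfun.rep_eq scaleR_scaleC scaleC_scaleC mult.commute)
lift_definition times_bop :: "'a bop \<Rightarrow> 'a bop \<Rightarrow> 'a bop" is "(o\<^sub>L)"
  by simp
lift_definition norm_bop :: "'a bop \<Rightarrow> real" is norm .

definition dist_bop :: "'a bop \<Rightarrow> 'a bop \<Rightarrow> real" where "dist_bop S T = norm (S - T)"
definition sgn_bop :: "'a bop \<Rightarrow> 'a bop" where "sgn_bop T = inverse (norm T) *\<^sub>R T"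
definition uniformity_bop :: "('a bop \<times> 'a bop) filter"
  where "uniformity_bop = (INF e\<in>{0 <..}. principal {(S, T). dist S T < e})"
definition open_bop :: "'a bop set \<Rightarrow> bool"
  where "open_bop U = (\<forall>x\<in>U. eventually (\<lambda>(x', y). x' = x \<longrightarrow> y \<in> U) uniformity)"

instance
proof
  fix R S T :: "'a bop" and a b :: real
  show "R + S + T = R + (S + T)" by transfer (simp add: add.assoc)
  show "R + S = S + R" by transfer (simp add: add.commute)
  show "0 + R = R" by transfer simp
  show "- R + R = 0" by transfer simp
  show "R - S = R + - S" by transfer simp
  show "a *\<^sub>R (R + S) = a *\<^sub>R R + a *\<^sub>R S" by transfer (simp add: scaleR_add_right)
  show "(a + b) *\<^sub>R R = a *\<^sub>R R + b *\<^sub>R R" by transfer (simp add: scaleR_add_left)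
  show "a *\<^sub>R b *\<^sub>R R = (a * b) *\<^sub>R R" by transfer simp
  show "1 *\<^sub>R R = R" by transfer simp
  show "dist R S = norm (R - S)" by (rule dist_bop_def)
  show "sgn R = inverse (norm R) *\<^sub>R R" by (rule sgn_bop_def)
  show "(uniformity :: ('a bop \<times> 'a bop) filter) = (INF e\<in>{0<..}. principal {(x, y). dist x y < e})"
    by (rule uniformity_bop_def)
  show "open U = (\<forall>x\<in>U. \<forall>\<^sub>F (x', y) in uniformity. x' = x \<longrightarrow> y \<in> U)" for U :: "'a bop set"
    by (rule open_bop_def)
  show "norm R = 0 \<longleftrightarrow> R = 0" by transfer simp
  show "norm (R + S) \<le> norm R + norm S" by transfer (rule norm_triangle_ineq)
  show "norm (a *\<^sub>R R) = \<bar>a\<bar> * norm R" by transfer simp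
  show "R * S * T = R * (S * T)" by transfer (auto intro: blinfun_eqI)
  show "(R + S) * T = R * T + S * T" by transfer (auto intro!: blinfun_eqI simp: plus_blinfun.rep_eq)
  show "R * (S + T) = R * S + R * T" by transfer (auto intro!: blinfun_eqI simp: plus_blinfun.rep_eq blinfun.add_right)
  show "a *\<^sub>R R * S = a *\<^sub>R (R * S)" by transfer (auto intro!: blinfun_eqI simp: scaleR_blinfun.rep_eq)
  show "R * a *\<^sub>R S = a *\<^sub>R (R * S)" by transfer (auto intro!: blinfun_eqI simp: scaleR_blinfun.rep_eq blinfun.scaleR_right)
  show "norm (R * S) \<le> norm R * norm S" by transfer (rule norm_blinfun_compose)
qed

end

instantiation bop :: (complex_hilbert_space) monoid_mult
begin

lift_definition one_bop :: "'a bop" is id_blinfun by simp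

instance
proof
  fix T :: "'a bop"
  show "1 * T = T" by transfer (auto intro: blinfun_eqI)
  show "T * 1 = T" by transfer (auto intro: blinfun_eqI)
qed

end

text \<open>Over the complex numbers, a positive operator is automatically self-adjoint.\<close>

definition positive_op :: "'a :: complex_hilbert_space bop \<Rightarrow> bool" where
  "positive_op T \<longleftrightarrow> (\<forall>x. cinner (bop_apply T x) x \<in> \<real>\<^sub>\<ge>\<^sub>0)"

lemma bop_eqI: "(\<And>x. bop_apply S x = bop_apply T x) \<Longrightarrow> S = T"
  by transfer (rule blinfun_eqI)

lemma cinner_add_right: "cinner x (y + z) = cinner x y + cinner x (z :: 'a :: complex_hilbert_space)"
  by (metis cinner_add_left cinner_commute complex_cnj_add)

lemma cinner_scaleC_right: "cinner x (a *\<^sub>C y) = cnj a * cinner x (y :: 'a :: complex_hilbert_space)"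
  by (metis cinner_commute cinner_scaleC_left complex_cnj_mult)

lemma bop_apply_add: "bop_apply T (x + y) = bop_apply T x + bop_apply T y"
  by transfer (simp add: blinfun.add_right)

lemma bop_apply_scaleC: "bop_apply T (c *\<^sub>C x) = c *\<^sub>C bop_apply T x"
  by transfer simp

lemma bop_eq_0I:
  fixes T :: "'a :: complex_hilbert_space bop"
  assumes "\<And>x. cinner (bop_apply T x) x = 0"
  shows "T = 0"
proof (rule bop_eqI)
  fix x
  let ?T = "bop_apply T" and ?y = "bop_apply T x"
  have 1: "cinner (?T x) ?y + cinner (?T ?y) x = 0"
    using assms[of "x + ?y"] assms[of x] assms[of ?y]
    by (simp add: add.commute bop_apply_add cinner_add_left cinner_add_right)
  have 2: "- \<i> * cinner (?T x) ?y + \<i> * cinner (?T ?y) x = 0"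
    using assms[of "x + \<i> *\<^sub>C ?y"] assms[of x] assms[of ?y]
    by (simp add: bop_apply_add bop_apply_scaleC cinner_add_left cinner_add_right
        cinner_scaleC_left cinner_scaleC_right)
  from 2 have "\<i> * (cinner (?T ?y) x - cinner (?T x) ?y) = 0"
    by (simp add: algebra_simps)
  then have "cinner (?T ?y) x = cinner (?T x) ?y" by simp
  with 1 have "cinner ?y ?y = 0" by simp
  then have "inner ?y ?y = 0" by (simp add: inner_eq_Re_cinner)
  then show "?T x = bop_apply 0 x" by (simp add: zero_bop.rep_eq bop_apply.rep_eq)
qed

text \<open>The strict order below is the one induced by \<open>\<le>\<close>; it is not strict positivity.\<close>

instantiation bop :: (complex_hilbert_space) ordered_ab_group_add
begin

definition less_eq_bop :: "'a bop \<Rightarrow> 'a bop \<Rightarrow> bool" where "less_eq_bop S T \<longleftrightarrow> positive_op (T - S)"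
definition less_bop :: "'a bop \<Rightarrow> 'a bop \<Rightarrow> bool" where "less_bop S T \<longleftrightarrow> S \<le> T \<and> \<not> T \<le> S"

instance
proof
  fix R S T :: "'a bop"
  have add: "cinner (bop_apply (A + B) x) x = cinner (bop_apply A x) x + cinner (bop_apply B x) x"
    for A B :: "'a bop" and x
    by (simp add: plus_bop.rep_eq bop_apply.rep_eq plus_blinfun.rep_eq cinner_add_left)
  have zero: "cinner (bop_apply 0 x) x = 0" for x :: 'a
    by (metis add add_cancel_right_left)
  show "S < T \<longleftrightarrow> S \<le> T \<and> \<not> T \<le> S" by (rule less_bop_def)
  show "S \<le> S" by (simp add: less_eq_bop_def positive_op_def zero)
  show "R \<le> S \<Longrightarrow> S \<le> T \<Longrightarrow> R \<le> T"
    using add[of "T - S" "S - R"]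
    by (auto simp: less_eq_bop_def positive_op_def intro: nonneg_Reals_add_I)
  show "S \<le> T \<Longrightarrow> T \<le> S \<Longrightarrow> S = T"
  proof -
    assume a: "S \<le> T" "T \<le> S"
    have "cinner (bop_apply (T - S) x) x = 0" for x
    proof -
      have "cinner (bop_apply (T - S) x) x + cinner (bop_apply (S - T) x) x = 0"
        using add[of "T - S" "S - T" x] by (simp add: zero)
      with a show ?thesis
        by (auto simp: less_eq_bop_def positive_op_def complex_nonneg_Reals_iff complex_eq_iff
            intro: order.antisym dest!: spec[of _ x])
    qed
    then show "S = T" using bop_eq_0I[of "T - S"] by simp
  qed
  show "S \<le> T \<Longrightarrow> R + S \<le> R + T" by (simp add: less_eq_bop_def)
qed

end

definition invertible_op :: "'a :: complex_hilbert_space bop \<Rightarrow> bool" where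
  "invertible_op T \<longleftrightarrow> (\<exists>S. S * T = 1 \<and> T * S = 1)"

definition strictly_positive :: "'a :: complex_hilbert_space bop \<Rightarrow> bool" where
  "strictly_positive T \<longleftrightarrow> 0 \<le> T \<and> invertible_op T"

definition Sp :: "'a :: complex_hilbert_space bop \<Rightarrow> complex set" where
  "Sp T = {z. \<not> invertible_op (T - scalar_op z)}"


section \<open>Continuous functional calculus\<close>

definition poly_op :: "real poly \<Rightarrow> 'a :: complex_hilbert_space bop \<Rightarrow> 'a bop" where
  "poly_op p T = (\<Sum>i\<le>degree p. coeff p i *\<^sub>R T ^ i)"

text \<open>\<open>cfc f T\<close> is \<open>f(T)\<close> for self-adjoint \<open>T\<close> and real-valued \<open>f\<close> continuous on the (real)
  spectrum of \<open>T\<close>: the norm limit of \<open>p\<^sub>n(T)\<close> for any real polynomials \<open>p\<^sub>n\<close> converging to \<open>f\<close>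
  uniformly on the spectrum. Outside that scope its value is meaningless.\<close>

definition cfc :: "(real \<Rightarrow> real) \<Rightarrow> 'a :: complex_hilbert_space bop \<Rightarrow> 'a bop" where
  "cfc f T = (THE Y. \<exists>p. uniform_limit {t. complex_of_real t \<in> Sp T} (\<lambda>n. poly (p n)) f sequentially
                        \<and> (\<lambda>n. poly_op (p n) T) \<longlonglongrightarrow> Y)"

definition powr_op :: "'a :: complex_hilbert_space bop \<Rightarrow> real \<Rightarrow> 'a bop" where
  "powr_op T r = cfc (\<lambda>t. t powr r) T"


section \<open>Connections\<close>

definition decreases_to :: "(nat \<Rightarrow> 'a :: complex_hilbert_space bop) \<Rightarrow> 'a bop \<Rightarrow> bool" where
  "decreases_to An A \<longleftrightarrow> decseq An \<and> (\<forall>x. (\<lambda>n. bop_apply (An n) x) \<longlonglongrightarrow> bop_apply A x)"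

text \<open>A binary operation on the positive operators is given by a total function, of which only
  the values at positive operators matter.\<close>

definition connection ::
  "('a :: complex_hilbert_space bop \<Rightarrow> 'a bop \<Rightarrow> 'a bop) \<Rightarrow> bool" where
  "connection \<sigma> \<longleftrightarrow>
     (\<forall>A B. 0 \<le> A \<longrightarrow> 0 \<le> B \<longrightarrow> 0 \<le> \<sigma> A B) \<and>
     (\<forall>A B C D. 0 \<le> A \<longrightarrow> 0 \<le> B \<longrightarrow> 0 \<le> C \<longrightarrow> 0 \<le> D \<longrightarrow>
        A \<le> C \<longrightarrow> B \<le> D \<longrightarrow> \<sigma> A B \<le> \<sigma> C D) \<and>
     (\<forall>A B C. 0 \<le> A \<longrightarrow> 0 \<le> B \<longrightarrow> 0 \<le> C \<longrightarrow>
        C * \<sigma> A B * C \<le> \<sigma> (C * A * C) (C * B * C)) \<and>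
     (\<forall>An Bn A B. (\<forall>n. 0 \<le> An n) \<longrightarrow> (\<forall>n. 0 \<le> Bn n) \<longrightarrow> 0 \<le> A \<longrightarrow> 0 \<le> B \<longrightarrow>
        decreases_to An A \<longrightarrow> decreases_to Bn B \<longrightarrow>
        decreases_to (\<lambda>n. \<sigma> (An n) (Bn n)) (\<sigma> A B))"

definition transpose_conn ::
  "('a :: complex_hilbert_space bop \<Rightarrow> 'a bop \<Rightarrow> 'a bop) \<Rightarrow> 'a bop \<Rightarrow> 'a bop \<Rightarrow> 'a bop" where
  "transpose_conn \<sigma> A B = \<sigma> B A"

definition scalar_multiple_of_right_trivial ::
  "('a :: complex_hilbert_space bop \<Rightarrow> 'a bop \<Rightarrow> 'a bop) \<Rightarrow> bool" where
  "scalar_multiple_of_right_trivial \<sigma> \<longleftrightarrow>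
     (\<exists>k\<ge>0. \<forall>A B. 0 \<le> A \<longrightarrow> 0 \<le> B \<longrightarrow> \<sigma> A B = k *\<^sub>R B)"


section \<open>The Hilbert space of square-summable sequences\<close>

typedef ell2 = "{f :: nat \<Rightarrow> complex. summable (\<lambda>n. (cmod (f n))\<^sup>2)}"
  morphisms ell2_nth Ell2
  by (rule exI[of _ "\<lambda>_. 0"]) simp

setup_lifting type_definition_ell2

lemma summable_ell2_add:
  assumes "summable (\<lambda>n. (cmod (f n))\<^sup>2)" "summable (\<lambda>n. (cmod (g n))\<^sup>2)"
  shows "summable (\<lambda>n. (cmod (f n + g n))\<^sup>2)"
proof (rule summable_comparison_test')
  show "summable (\<lambda>n. 2 * (cmod (f n))\<^sup>2 + 2 * (cmod (g n))\<^sup>2)"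
    using assms by (intro summable_add summable_mult)
  fix n :: nat
  have "(cmod (f n + g n))\<^sup>2 \<le> (cmod (f n) + cmod (g n))\<^sup>2"
    by (intro power_mono norm_triangle_ineq) simp
  also have "\<dots> \<le> 2 * (cmod (f n))\<^sup>2 + 2 * (cmod (g n))\<^sup>2"
    using sum_squares_bound[of "cmod (f n)" "cmod (g n)"] by (simp add: power2_sum)
  finally show "norm ((cmod (f n + g n))\<^sup>2) \<le> 2 * (cmod (f n))\<^sup>2 + 2 * (cmod (g n))\<^sup>2"
    by simp
qed

lemma summable_ell2_scale:
  "summable (\<lambda>n. (cmod (f n))\<^sup>2) \<Longrightarrow> summable (\<lambda>n. (cmod (a * f n))\<^sup>2)"
  by (simp add: norm_mult power_mult_distrib summable_mult)

lemma summable_ell2_cinner: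
  assumes "summable (\<lambda>n. (cmod (f n))\<^sup>2)" "summable (\<lambda>n. (cmod (g n))\<^sup>2)"
  shows "summable (\<lambda>n. f n * cnj (g n))"
proof (rule summable_comparison_test')
  show "summable (\<lambda>n. (cmod (f n))\<^sup>2 + (cmod (g n))\<^sup>2)"
    using assms by (rule summable_add)
  fix n :: nat
  have "2 * (cmod (f n) * cmod (g n)) \<le> (cmod (f n))\<^sup>2 + (cmod (g n))\<^sup>2"
    using sum_squares_bound[of "cmod (f n)" "cmod (g n)"] by simp
  moreover have "0 \<le> cmod (f n) * cmod (g n)" by simp
  ultimately show "norm (f n * cnj (g n)) \<le> (cmod (f n))\<^sup>2 + (cmod (g n))\<^sup>2"
    unfolding norm_mult complex_mod_cnj by linarith
qed

instantiation ell2 :: real_inner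
begin

lift_definition zero_ell2 :: ell2 is "\<lambda>_. 0" by simp
lift_definition plus_ell2 :: "ell2 \<Rightarrow> ell2 \<Rightarrow> ell2" is "\<lambda>f g n. f n + g n"
  by (rule summable_ell2_add)
lift_definition uminus_ell2 :: "ell2 \<Rightarrow> ell2" is "\<lambda>f n. - f n" by simp
lift_definition minus_ell2 :: "ell2 \<Rightarrow> ell2 \<Rightarrow> ell2" is "\<lambda>f g n. f n - g n"
  using summable_ell2_add[of _ "\<lambda>n. - _ n"] by simp
lift_definition scaleR_ell2 :: "real \<Rightarrow> ell2 \<Rightarrow> ell2" is "\<lambda>r f n. complex_of_real r * f n"
  by (rule summable_ell2_scale)
lift_definition inner_ell2 :: "ell2 \<Rightarrow> ell2 \<Rightarrow> real" is "\<lambda>f g. Re (\<Sum>n. f n * cnj (g n))" .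

definition norm_ell2 :: "ell2 \<Rightarrow> real" where "norm_ell2 x = sqrt (inner x x)"
definition dist_ell2 :: "ell2 \<Rightarrow> ell2 \<Rightarrow> real" where "dist_ell2 x y = norm (x - y)"
definition sgn_ell2 :: "ell2 \<Rightarrow> ell2" where "sgn_ell2 x = inverse (norm x) *\<^sub>R x"
definition uniformity_ell2 :: "(ell2 \<times> ell2) filter"
  where "uniformity_ell2 = (INF e\<in>{0 <..}. principal {(x, y). dist x y < e})"
definition open_ell2 :: "ell2 set \<Rightarrow> bool"
  where "open_ell2 U = (\<forall>x\<in>U. eventually (\<lambda>(x', y). x' = x \<longrightarrow> y \<in> U) uniformity)"

lemma inner_ell2_self: "inner x x = (\<Sum>n. (cmod (ell2_nth x n))\<^sup>2)"
proof -
  have "summable (\<lambda>n. (cmod (ell2_nth x n))\<^sup>2)" using ell2_nth[of x] by simp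
  then have "(\<Sum>n. complex_of_real ((cmod (ell2_nth x n))\<^sup>2))
      = complex_of_real (\<Sum>n. (cmod (ell2_nth x n))\<^sup>2)"
    by (rule suminf_of_real[symmetric])
  then show ?thesis
    by (simp add: inner_ell2.rep_eq complex_norm_square[symmetric])
qed

instance
proof
  fix x y z :: ell2 and a b :: real
  show "x + y + z = x + (y + z)" by transfer (simp add: add.assoc)
  show "x + y = y + x" by transfer (simp add: add.commute)
  show "0 + x = x" by transfer simp
  show "- x + x = 0" by transfer simp
  show "x - y = x + - y" by transfer simp
  show "a *\<^sub>R (x + y) = a *\<^sub>R x + a *\<^sub>R y" by transfer (simp add: algebra_simps)
  show "(a + b) *\<^sub>R x = a *\<^sub>R x + b *\<^sub>R x" by transfer (simp add: algebra_simps)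
  show "a *\<^sub>R b *\<^sub>R x = (a * b) *\<^sub>R x" by transfer (simp add: algebra_simps)
  show "1 *\<^sub>R x = x" by transfer simp
  show "dist x y = norm (x - y)" by (rule dist_ell2_def)
  show "sgn x = inverse (norm x) *\<^sub>R x" by (rule sgn_ell2_def)
  show "(uniformity :: (ell2 \<times> ell2) filter) = (INF e\<in>{0<..}. principal {(x, y). dist x y < e})"
    by (rule uniformity_ell2_def)
  show "open U = (\<forall>x\<in>U. \<forall>\<^sub>F (x', y) in uniformity. x' = x \<longrightarrow> y \<in> U)" for U :: "ell2 set"
    by (rule open_ell2_def)
  show "norm x = sqrt (inner x x)" by (rule norm_ell2_def)
  show "inner x y = inner y x"
  proof transfer
    fix x y :: "nat \<Rightarrow> complex"
    assume "summable (\<lambda>n. (cmod (x n))\<^sup>2)" "summable (\<lambda>n. (cmod (y n))\<^sup>2)"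
    then have "Re (\<Sum>n. x n * cnj (y n)) = (\<Sum>n. Re (x n * cnj (y n)))"
      "Re (\<Sum>n. y n * cnj (x n)) = (\<Sum>n. Re (y n * cnj (x n)))"
      by (simp_all add: Re_suminf summable_ell2_cinner)
    then show "Re (\<Sum>n. x n * cnj (y n)) = Re (\<Sum>n. y n * cnj (x n))"
      by (simp add: mult.commute)
  qed
  show "inner (x + y) z = inner x z + inner y z"
    by transfer (simp add: distrib_right suminf_add[symmetric] summable_ell2_cinner)
  show "inner (a *\<^sub>R x) y = a * inner x y"
    by transfer (simp add: mult.assoc suminf_mult summable_ell2_cinner)
  have s: "summable (\<lambda>n. (cmod (ell2_nth x n))\<^sup>2)" using ell2_nth[of x] by simp
  show "0 \<le> inner x x"
    unfolding inner_ell2_self by (rule suminf_nonneg[OF s]) simp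
  show "inner x x = 0 \<longleftrightarrow> x = 0"
    unfolding inner_ell2_self suminf_eq_zero_iff[OF s zero_le_power2]
    by transfer (auto simp: fun_eq_iff)
qed

end

lemma sum_le_norm_ell2: "(\<Sum>n<N. (cmod (ell2_nth x n))\<^sup>2) \<le> (norm x)\<^sup>2"
proof -
  have s: "summable (\<lambda>n. (cmod (ell2_nth x n))\<^sup>2)" using ell2_nth[of x] by simp
  have "(norm x)\<^sup>2 = (\<Sum>n. (cmod (ell2_nth x n))\<^sup>2)"
    by (simp add: power2_norm_eq_inner inner_ell2_self)
  with sum_le_suminf[OF s, of "{..<N}"] show ?thesis by simp
qed

instance ell2 :: complete_space
proof
  fix X :: "nat \<Rightarrow> ell2"
  assume "Cauchy X"
  have coord: "cmod (ell2_nth x k) \<le> norm x" for x k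
  proof -
    have "(cmod (ell2_nth x k))\<^sup>2 \<le> (\<Sum>n<Suc k. (cmod (ell2_nth x n))\<^sup>2)"
      by (rule member_le_sum) auto
    then show ?thesis
      using sum_le_norm_ell2[of x "Suc k"] by (meson norm_ge_zero order_trans power2_le_imp_le)
  qed
  have "Cauchy (\<lambda>m. ell2_nth (X m) k)" for k
  proof (rule metric_CauchyI)
    fix e :: real assume "0 < e"
    then obtain M where M: "\<And>m n. m \<ge> M \<Longrightarrow> n \<ge> M \<Longrightarrow> dist (X m) (X n) < e"
      using \<open>Cauchy X\<close> by (meson metric_CauchyD)
    have "dist (ell2_nth (X m) k) (ell2_nth (X n) k) < e" if "m \<ge> M" "n \<ge> M" for m n
      using coord[of "X m - X n" k] M[OF that] by (simp add: dist_norm minus_ell2.rep_eq)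
    then show "\<exists>M. \<forall>m\<ge>M. \<forall>n\<ge>M. dist (ell2_nth (X m) k) (ell2_nth (X n) k) < e"
      by blast
  qed
  then have "\<forall>k. \<exists>l. (\<lambda>m. ell2_nth (X m) k) \<longlonglongrightarrow> l"
    by (simp add: Cauchy_convergent_iff convergent_def)
  then obtain y where y: "\<And>k. (\<lambda>m. ell2_nth (X m) k) \<longlonglongrightarrow> y k"
    by metis
  have tail: "\<exists>M. \<forall>m\<ge>M. \<forall>N. (\<Sum>k<N. (cmod (ell2_nth (X m) k - y k))\<^sup>2) \<le> e\<^sup>2" if "0 < e" for e
  proof -
    obtain M where M: "\<And>m n. m \<ge> M \<Longrightarrow> n \<ge> M \<Longrightarrow> dist (X m) (X n) < e"
      using \<open>Cauchy X\<close> \<open>0 < e\<close> by (meson metric_CauchyD)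
    have "(\<Sum>k<N. (cmod (ell2_nth (X m) k - y k))\<^sup>2) \<le> e\<^sup>2" if "m \<ge> M" for m N
    proof (rule LIMSEQ_le_const2)
      show "(\<lambda>n. \<Sum>k<N. (cmod (ell2_nth (X m) k - ell2_nth (X n) k))\<^sup>2)
          \<longlonglongrightarrow> (\<Sum>k<N. (cmod (ell2_nth (X m) k - y k))\<^sup>2)"
        by (intro tendsto_intros y)
      have "(\<Sum>k<N. (cmod (ell2_nth (X m) k - ell2_nth (X n) k))\<^sup>2) \<le> e\<^sup>2" if "n \<ge> M" for n
      proof -
        have "(\<Sum>k<N. (cmod (ell2_nth (X m) k - ell2_nth (X n) k))\<^sup>2) \<le> (norm (X m - X n))\<^sup>2"
          using sum_le_norm_ell2[of "X m - X n" N] by (simp add: minus_ell2.rep_eq)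
        also have "\<dots> \<le> e\<^sup>2"
          using M[OF \<open>m \<ge> M\<close> that] by (intro power_mono) (simp_all add: dist_norm)
        finally show ?thesis .
      qed
      then show "\<exists>n0. \<forall>n\<ge>n0. (\<Sum>k<N. (cmod (ell2_nth (X m) k - ell2_nth (X n) k))\<^sup>2) \<le> e\<^sup>2"
        by blast
    qed
    then show ?thesis by blast
  qed
  have diff: "summable (\<lambda>k. (cmod (ell2_nth (X m) k - y k))\<^sup>2)"
    if "\<forall>N. (\<Sum>k<N. (cmod (ell2_nth (X m) k - y k))\<^sup>2) \<le> c" for m c
    using that by (intro summableI_nonneg_bounded[where x = c]) auto
  obtain M where M: "\<forall>N. (\<Sum>k<N. (cmod (ell2_nth (X M) k - y k))\<^sup>2) \<le> 1\<^sup>2"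
    using tail[of 1] by auto
  have "summable (\<lambda>k. (cmod (ell2_nth (X M) k))\<^sup>2)" using ell2_nth[of "X M"] by simp
  from summable_ell2_add[OF this, of "\<lambda>k. - (ell2_nth (X M) k - y k)"] diff[OF M]
  have "summable (\<lambda>k. (cmod (y k))\<^sup>2)" by (simp add: norm_minus_commute)
  then have nth: "ell2_nth (Ell2 y) = y" by (simp add: Ell2_inverse)
  have "X \<longlonglongrightarrow> Ell2 y"
  proof (rule metric_LIMSEQ_I)
    fix e :: real assume "0 < e"
    then obtain M where M: "\<forall>m\<ge>M. \<forall>N. (\<Sum>k<N. (cmod (ell2_nth (X m) k - y k))\<^sup>2) \<le> (e/2)\<^sup>2"
      using tail[of "e/2"] by auto
    have "dist (X m) (Ell2 y) < e" if "m \<ge> M" for m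
    proof -
      have b: "\<forall>N. (\<Sum>k<N. (cmod (ell2_nth (X m) k - y k))\<^sup>2) \<le> (e/2)\<^sup>2"
        using M that by blast
      have "(norm (X m - Ell2 y))\<^sup>2 = (\<Sum>k. (cmod (ell2_nth (X m) k - y k))\<^sup>2)"
        by (simp add: power2_norm_eq_inner inner_ell2_self minus_ell2.rep_eq nth)
      also have "\<dots> \<le> (e/2)\<^sup>2"
        by (rule suminf_le_const[OF diff[OF b]]) (use b in blast)
      finally have "norm (X m - Ell2 y) \<le> e/2"
        using \<open>0 < e\<close> by (meson half_gt_zero less_imp_le power2_le_imp_le)
      then show ?thesis using \<open>0 < e\<close> by (simp add: dist_norm)
    qed
    then show "\<exists>M. \<forall>m\<ge>M. dist (X m) (Ell2 y) < e" by blast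
  qed
  then show "convergent X" by (auto simp: convergent_def)
qed

instantiation ell2 :: complex_hilbert_space
begin

lift_definition scaleC_ell2 :: "complex \<Rightarrow> ell2 \<Rightarrow> ell2" is "\<lambda>c f n. c * f n"
  by (rule summable_ell2_scale)
lift_definition cinner_ell2 :: "ell2 \<Rightarrow> ell2 \<Rightarrow> complex" is "\<lambda>f g. \<Sum>n. f n * cnj (g n)" .

instance
proof
  fix x y z :: ell2 and a b :: complex and r :: real
  show "a *\<^sub>C (x + y) = a *\<^sub>C x + a *\<^sub>C y" by transfer (simp add: algebra_simps)
  show "(a + b) *\<^sub>C x = a *\<^sub>C x + b *\<^sub>C x" by transfer (simp add: algebra_simps)
  show "a *\<^sub>C b *\<^sub>C x = (a * b) *\<^sub>C x" by transfer (simp add: algebra_simps)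
  show "r *\<^sub>R x = complex_of_real r *\<^sub>C x" by transfer simp
  show "cinner x y = cnj (cinner y x)"
  proof transfer
    fix x y :: "nat \<Rightarrow> complex"
    assume "summable (\<lambda>n. (cmod (x n))\<^sup>2)" "summable (\<lambda>n. (cmod (y n))\<^sup>2)"
    then have "(\<lambda>n. y n * cnj (x n)) sums (\<Sum>n. y n * cnj (x n))"
      by (intro summable_sums summable_ell2_cinner)
    then have "(\<lambda>n. cnj (y n * cnj (x n))) sums cnj (\<Sum>n. y n * cnj (x n))"
      by (simp only: sums_cnj)
    then show "(\<Sum>n. x n * cnj (y n)) = cnj (\<Sum>n. y n * cnj (x n))"
      by (simp add: sums_iff mult.commute)
  qed
  show "cinner (x + y) z = cinner x z + cinner y z"
    by transfer (simp add: distrib_right suminf_add[symmetric] summable_ell2_cinner)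
  show "cinner (a *\<^sub>C x) y = a * cinner x y"
    by transfer (simp add: mult.assoc suminf_mult summable_ell2_cinner)
  show "inner x y = Re (cinner x y)" by transfer simp
qed

end


section \<open>Representing functions\<close>

text \<open>Operator monotonicity refers to all Hilbert spaces at once, a quantification over types that
  HOL does not have. Monotonicity is demanded on \<open>\<ell>\<^sup>2(\<nat>)\<close> only; since every finite-dimensional
  Hilbert space embeds there, this is known to imply it on every Hilbert space. No condition is
  put on \<open>f\<close> outside \<open>[0,\<infinity>)\<close>.\<close>

definition operator_monotone :: "(real \<Rightarrow> real) \<Rightarrow> bool" where
  "operator_monotone f \<longleftrightarrow>
     continuous_on {0..} f \<and> (\<forall>x\<ge>0. 0 \<le> f x) \<and>
     (\<forall>A B :: ell2 bop. 0 \<le> A \<longrightarrow> A \<le> B \<longrightarrow> cfc f A \<le> cfc f B)"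

definition representing_function ::
  "('a :: complex_hilbert_space bop \<Rightarrow> 'a bop \<Rightarrow> 'a bop) \<Rightarrow> (real \<Rightarrow> real) \<Rightarrow> bool" where
  "representing_function \<tau> f \<longleftrightarrow>
     operator_monotone f \<and> (\<forall>x\<ge>0. f x *\<^sub>R 1 = \<tau> 1 (x *\<^sub>R 1))"

end

theory Submission
  imports Defs "HOL-Computational_Algebra.Fundamental_Theorem_Algebra"
begin

text \<open>
  Write \<open>\<tau>\<close> for the transpose of \<open>\<sigma>\<close>. Conjugation by the invertible positive operator
  \<open>A^(1/2)\<close> turns \<open>\<tau> A X = B\<close> into \<open>\<tau> 1 Y = D\<close> with \<open>Y = A^(-1/2) X A^(-1/2)\<close>, and \<open>\<tau> 1 Y = g(Y)\<close>, so that
  everything follows from spectral mapping once \<open>g\<close> is known to be injective.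

  That \<open>\<tau> 1 Y = g(Y)\<close> is usually shown with spectral projections. Continuous cut-offs suffice:
  if \<open>K\<close> and \<open>H\<close> are functions of \<open>Y\<close> with disjoint supports then \<open>K (\<tau> 1 Y) H = 0\<close>, and on a cut-off
  to a short interval the axioms squeeze \<open>\<tau> 1 Y\<close> between nearby values of \<open>g\<close>. A partition of
  unity glues these local estimates together.

  Injectivity of a non-constant \<open>g\<close> is a fact about operator monotonicity for \<open>2\<times>2\<close> matrices,
  realised on \<open>\<ell>\<^sup>2\<close>.
\<close>


section \<open>Self-adjoint operators\<close>

text \<open>A compression by a function \<open>C\<close> of \<open>Y\<close> is not a projection and
  (M2) is only an inequality, so the two halves of the squeeze differ. From above,
  \<open>C * \<tau> 1 Y * C\<close> lies below \<open>\<tau>\<close> of two multiples of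
  \<open>C * C\<close>. From below, a wider cut-off \<open>F\<close>, equal to 1 on the support of
  \<open>C\<close>, gives \<open>\<tau> (F * F) (z *\<^sub>R (F * F)) \<le> \<tau> 1 Y\<close>, and
  compressing by \<open>C\<close> removes \<open>F\<close>. Neighbouring functions of the partition
  overlap, so the form of \<open>\<tau> 1 Y - g(Y)\<close> becomes a double sum: distant pairs
  contribute nothing, neighbouring pairs little. A piece has at most three neighbours for every
  mesh, so the error does not grow with the number of pieces. Operator monotonicity of
  \<open>g\<close> speaks of \<open>\<ell>\<^sup>2\<close> alone, hence injectivity is settled
  there, whatever the dimension of the given space. The functional calculus rests on one fact: a
  nonzero self-adjoint \<open>T\<close> has \<open>norm T\<close> or \<open>- norm T\<close> in its
  spectrum.\<close>

instance complex_hilbert_space \<subseteq> banach ..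

section \<open>Pointwise description and completeness of the bounded operators\<close>

lemma bop_apply_simps [simp]:
  "bop_apply (S + T) x = bop_apply S x + bop_apply T x"
  "bop_apply (S - T) x = bop_apply S x - bop_apply T x"
  "bop_apply (- T) x = - bop_apply T x"
  "bop_apply (S * T) x = bop_apply S (bop_apply T x)"
  "bop_apply (r *\<^sub>R T) x = r *\<^sub>R bop_apply T x"
  "bop_apply 0 x = 0"
  "bop_apply 1 x = x"
  by (simp_all add: bop_apply.rep_eq plus_bop.rep_eq minus_bop.rep_eq uminus_bop.rep_eq
      times_bop.rep_eq scaleR_bop.rep_eq zero_bop.rep_eq one_bop.rep_eq
      plus_blinfun.rep_eq minus_blinfun.rep_eq uminus_blinfun.rep_eq scaleR_blinfun.rep_eq)

lemma bop_apply_scalar_op [simp]: "bop_apply (scalar_op z) x = z *\<^sub>C x"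
  by (simp add: bop_apply.rep_eq scalar_op.rep_eq bounded_linear_Blinfun_apply
      bounded_linear_scaleC)

lemma bounded_linear_bop_apply: "bounded_linear (bop_apply T)"
  by (simp add: bop_apply.rep_eq blinfun.bounded_linear_right)

lemmas bop_linear_simps = linear_simps[OF bounded_linear_bop_apply]

lemma norm_bop_apply: "norm (bop_apply T x) \<le> norm T * norm x"
  by (simp add: bop_apply.rep_eq norm_bop.rep_eq norm_blinfun)

lemma norm_bop_le:
  assumes "0 \<le> b" "\<And>x. norm (bop_apply T x) \<le> b * norm x"
  shows "norm T \<le> b"
  using assms by (simp add: bop_apply.rep_eq norm_bop.rep_eq norm_blinfun_bound)

lemma bop_exists:
  assumes "\<And>x y. f (x + y) = f x + f y" "\<And>c x. f (c *\<^sub>C x) = c *\<^sub>C f x"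
    and "\<And>x. norm (f x) \<le> K * norm x"
  shows "\<exists>T :: 'a :: complex_hilbert_space bop. \<forall>x. bop_apply T x = f x"
proof -
  have "bounded_linear f"
    using assms by (intro bounded_linear_intro[where K = K])
      (simp_all add: scaleR_scaleC mult.commute)
  then have "bop_apply (Bop (Blinfun f)) x = f x" for x
    using assms(2) by (simp add: bop_apply.rep_eq bounded_linear_Blinfun_apply Bop_inverse)
  then show ?thesis by blast
qed

lemma scalar_op_of_real [simp]: "scalar_op (complex_of_real t) = t *\<^sub>R 1"
  by (rule bop_eqI) (simp add: scaleR_scaleC)

instance bop :: (complex_hilbert_space) banach
proof
  fix X :: "nat \<Rightarrow> 'a bop"
  assume "Cauchy X"
  then have "Cauchy (\<lambda>n. blinfun_of_bop (X n))"
    by (simp add: Cauchy_def dist_norm norm_bop.rep_eq minus_bop.rep_eq)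
  then obtain L where L: "(\<lambda>n. blinfun_of_bop (X n)) \<longlonglongrightarrow> L"
    by (auto simp: Cauchy_convergent_iff convergent_def)
  have pt: "(\<lambda>n. blinfun_apply (blinfun_of_bop (X n)) x) \<longlonglongrightarrow> blinfun_apply L x" for x
    by (intro tendsto_intros L)
  have "blinfun_apply L (c *\<^sub>C x) = c *\<^sub>C blinfun_apply L x" for c x
  proof (rule LIMSEQ_unique[OF pt])
    have "(\<lambda>n. c *\<^sub>C blinfun_apply (blinfun_of_bop (X n)) x) \<longlonglongrightarrow> c *\<^sub>C blinfun_apply L x"
      by (rule bounded_linear.tendsto[OF bounded_linear_scaleC pt])
    then show "(\<lambda>n. blinfun_apply (blinfun_of_bop (X n)) (c *\<^sub>C x)) \<longlonglongrightarrow> c *\<^sub>C blinfun_apply L x"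
      by (simp add: bop_apply.rep_eq[symmetric] bop_apply_scaleC)
  qed
  then have L': "blinfun_of_bop (Bop L) = L" by (simp add: Bop_inverse)
  have "X \<longlonglongrightarrow> Bop L"
    using L by (simp add: lim_sequentially dist_norm norm_bop.rep_eq minus_bop.rep_eq L')
  then show "convergent X" by (auto simp: convergent_def)
qed

text \<open>The real inner product suffices: since \<open>T\<close> is complex linear, replacing
  \<open>y\<close> by \<open>\<i> *\<^sub>C y\<close> recovers the imaginary part of the symmetry of
  \<open>cinner\<close>.\<close>

definition selfadj :: "'a :: complex_hilbert_space bop \<Rightarrow> bool" where
  "selfadj T \<longleftrightarrow> (\<forall>x y. inner (bop_apply T x) y = inner x (bop_apply T y))"

lemma selfadjD: "selfadj T \<Longrightarrow> inner (bop_apply T x) y = inner x (bop_apply T y)"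
  by (simp add: selfadj_def)

lemma selfadj_intros [intro, simp]:
  "selfadj 0" "selfadj 1"
  "selfadj S \<Longrightarrow> selfadj T \<Longrightarrow> selfadj (S + T)"
  "selfadj S \<Longrightarrow> selfadj T \<Longrightarrow> selfadj (S - T)"
  "selfadj T \<Longrightarrow> selfadj (- T)"
  "selfadj T \<Longrightarrow> selfadj (r *\<^sub>R T)"
  by (simp_all add: selfadj_def inner_simps)

lemma selfadj_conj [intro]: "selfadj S \<Longrightarrow> selfadj T \<Longrightarrow> selfadj (S * T * S)"
  by (simp add: selfadj_def)

lemma selfadj_mult: "selfadj S \<Longrightarrow> selfadj T \<Longrightarrow> S * T = T * S \<Longrightarrow> selfadj (S * T)"
  by (metis bop_apply_simps(4) selfadj_def)

lemma inner_scaleC_i: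
  "inner x (\<i> *\<^sub>C y) = Im (cinner x y)" "inner (\<i> *\<^sub>C x) y = - Im (cinner x y)"
  by (simp_all add: inner_eq_Re_cinner cinner_scaleC_right cinner_scaleC_left)

text \<open>Polarization: that the form is real at \<open>x + \<i> *\<^sub>C y\<close> yields
  symmetry. Conversely, symmetry at \<open>x\<close> and \<open>\<i> *\<^sub>C x\<close> makes the
  imaginary part of the form equal to its own negative.\<close>

lemma positive_op_iff: "0 \<le> T \<longleftrightarrow> selfadj T \<and> (\<forall>x. 0 \<le> inner (bop_apply T x) x)"
proof
  assume "0 \<le> T"
  then have T: "cinner (bop_apply T x) x \<in> \<real>\<^sub>\<ge>\<^sub>0" for x
    by (simp add: less_eq_bop_def positive_op_def)
  then have im: "Im (cinner (bop_apply T x) x) = 0" for x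
    using complex_nonneg_Reals_iff by blast
  have "inner (bop_apply T x) y = inner x (bop_apply T y)" for x y
  proof -
    have "Im (cinner (bop_apply T (x + \<i> *\<^sub>C y)) (x + \<i> *\<^sub>C y)) = 0" by (rule im)
    then have "Re (cinner (bop_apply T y) x) = Re (cinner (bop_apply T x) y)"
      by (simp add: bop_apply_add bop_apply_scaleC cinner_add_left cinner_add_right
          cinner_scaleC_left cinner_scaleC_right im)
    then show ?thesis
      by (metis inner_commute inner_eq_Re_cinner)
  qed
  moreover have "0 \<le> inner (bop_apply T x) x" for x
    using T[of x] by (simp add: inner_eq_Re_cinner complex_nonneg_Reals_iff)
  ultimately show "selfadj T \<and> (\<forall>x. 0 \<le> inner (bop_apply T x) x)"
    by (simp add: selfadj_def)
next
  assume T: "selfadj T \<and> (\<forall>x. 0 \<le> inner (bop_apply T x) x)"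
  have "Im (cinner (bop_apply T x) x) = 0" for x
  proof -
    have "Im (cinner (bop_apply T x) x) = inner (bop_apply T x) (\<i> *\<^sub>C x)"
      by (simp add: inner_scaleC_i)
    also have "\<dots> = inner x (\<i> *\<^sub>C bop_apply T x)"
      using T by (simp add: selfadjD bop_apply_scaleC)
    also have "\<dots> = - Im (cinner (bop_apply T x) x)"
      by (subst inner_commute) (simp add: inner_scaleC_i)
    finally show ?thesis by simp
  qed
  then show "0 \<le> T"
    using T by (simp add: less_eq_bop_def positive_op_def complex_nonneg_Reals_iff
        inner_eq_Re_cinner)
qed

lemma positive_selfadj: "0 \<le> T \<Longrightarrow> selfadj T"
  by (simp add: positive_op_iff)

lemma bop_leD: "S \<le> T \<Longrightarrow> inner (bop_apply S x) x \<le> inner (bop_apply T x) x"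
  using positive_op_iff[of "T - S"] by (simp add: inner_simps)

lemma one_bop_nonneg [simp]: "0 \<le> (1 :: 'a :: complex_hilbert_space bop)"
  by (simp add: positive_op_iff)

lemma conj_nonneg: "selfadj S \<Longrightarrow> 0 \<le> T \<Longrightarrow> 0 \<le> S * T * S"
  by (auto simp: positive_op_iff selfadjD[of S])

lemma conj_mono: "selfadj S \<Longrightarrow> T \<le> T' \<Longrightarrow> S * T * S \<le> S * T' * S"
  using conj_nonneg[of S "T' - T"] by (simp add: algebra_simps)

lemma scaleR_bop_nonneg: "0 \<le> r \<Longrightarrow> 0 \<le> T \<Longrightarrow> 0 \<le> r *\<^sub>R (T :: 'a :: complex_hilbert_space bop)"
  by (auto simp: positive_op_iff)

lemma scaleR_bop_mono:
  "0 \<le> r \<Longrightarrow> S \<le> T \<Longrightarrow> r *\<^sub>R S \<le> r *\<^sub>R (T :: 'a :: complex_hilbert_space bop)"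
  using scaleR_bop_nonneg[of r "T - S"] by (simp add: algebra_simps)

text \<open>Moving from \<open>x\<close> in the direction \<open>- T x\<close> changes the form to
  \<open>t\<^sup>2 a - 2 t b\<close> with \<open>b = \<parallel>T x\<parallel>\<^sup>2\<close>; this
  stays nonnegative for all \<open>t\<close> only if \<open>b = 0\<close>. The minimum is at
  \<open>t = b / a\<close>.\<close>

lemma positive_op_kernel:
  assumes "0 \<le> T" "inner (bop_apply T x) x = 0"
  shows "bop_apply T x = 0"
proof -
  define y where "y = bop_apply T x"
  define a where "a = inner (bop_apply T y) y"
  define b where "b = inner y y"
  have "a \<ge> 0" "b \<ge> 0"
    using assms(1) by (simp_all add: a_def b_def positive_op_iff)
  have "0 \<le> inner (bop_apply T (x - t *\<^sub>R y)) (x - t *\<^sub>R y)" for t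
    using assms(1) by (simp add: positive_op_iff)
  moreover have "inner (bop_apply T (x - t *\<^sub>R y)) (x - t *\<^sub>R y) = t * (t * a) - 2 * t * b" for t
  proof -
    have "inner (bop_apply T y) x = b"
      using assms(1) by (metis b_def y_def positive_selfadj selfadjD)
    then show ?thesis
      using assms(2)
      by (simp add: bop_linear_simps inner_simps a_def y_def[symmetric] b_def algebra_simps)
  qed
  ultimately have *: "0 \<le> t * (t * a) - 2 * t * b" for t by metis
  have "b = 0"
  proof (cases "a = 0")
    case True
    then show ?thesis using *[of 1] \<open>b \<ge> 0\<close> by simp
  next
    case False
    then show ?thesis using *[of "b / a"] \<open>a \<ge> 0\<close>
      by (simp add: field_simps) (smt (verit) zero_le_square mult_eq_0_iff)
  qed
  then show ?thesis by (simp add: b_def y_def)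
qed

text \<open>Polarization writes the bilinear form as a difference of two quadratic ones, and the
  parallelogram law adds up their bounds for unit vectors; scaling does the rest.\<close>

lemma selfadj_form_bound:
  assumes "selfadj T" "- (e *\<^sub>R 1) \<le> T" "T \<le> e *\<^sub>R 1" "0 \<le> e"
  shows "\<bar>inner (bop_apply T x) y\<bar> \<le> e * (norm x * norm y)"
proof -
  have q: "\<bar>inner (bop_apply T z) z\<bar> \<le> e * (norm z)\<^sup>2" for z
    using bop_leD[OF assms(2), of z] bop_leD[OF assms(3), of z]
    by (simp add: power2_norm_eq_inner)
  have unit: "\<bar>inner (bop_apply T x) y\<bar> \<le> e" if "norm x = 1" "norm y = 1" for x y
  proof -
    have "4 * inner (bop_apply T x) y
        = inner (bop_apply T (x + y)) (x + y) - inner (bop_apply T (x - y)) (x - y)"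
      using selfadjD[OF assms(1), of y x]
      by (simp add: bop_linear_simps inner_simps inner_commute)
    then have "4 * \<bar>inner (bop_apply T x) y\<bar> \<le> e * ((norm (x + y))\<^sup>2 + (norm (x - y))\<^sup>2)"
      using q[of "x + y"] q[of "x - y"] by (simp add: algebra_simps)
    also have "(norm (x + y))\<^sup>2 + (norm (x - y))\<^sup>2 = 2 * (norm x)\<^sup>2 + 2 * (norm y)\<^sup>2"
      by (simp add: power2_norm_eq_inner inner_simps inner_commute)
    finally show ?thesis using that by simp
  qed
  show ?thesis
  proof (cases "x = 0 \<or> y = 0")
    case True
    then show ?thesis by (auto simp: bop_linear_simps)
  next
    case False
    then have "\<bar>inner (bop_apply T (x /\<^sub>R norm x)) (y /\<^sub>R norm y)\<bar> \<le> e"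
      by (intro unit) auto
    then show ?thesis using False
      by (simp add: bop_linear_simps abs_mult field_simps)
  qed
qed


section \<open>The spectrum of a self-adjoint operator\<close>

text \<open>The Lax-Milgram argument: \<open>T x = y\<close> is the fixed point equation of
  \<open>x \<mapsto> x - \<mu> (T x - y)\<close>, a contraction for suitable \<mu>, and coercivity
  bounds the solution map.\<close>

lemma coercive_invertible:
  fixes T :: "'a :: complex_hilbert_space bop"
  assumes "0 < c" "\<And>x. c * (norm x)\<^sup>2 \<le> inner (bop_apply T x) x"
  shows "invertible_op T"
proof -
  \<comment> \<open>Adding \<open>c\<close> makes \<open>K\<close> positive and at least
    \<open>c\<close>, so that \<open>c\<^sup>2 / K\<^sup>2\<close> lies in (0,1].\<close>
  define K where "K = norm T + c"
  have "0 < K" using assms(1) by (simp add: K_def add_nonneg_pos)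
  have "c \<le> K" by (simp add: K_def)
  have Tx: "(norm (bop_apply T x))\<^sup>2 \<le> K\<^sup>2 * (norm x)\<^sup>2" for x
  proof -
    have "norm (bop_apply T x) \<le> K * norm x"
      using norm_bop_apply[of T x] \<open>0 < c\<close>
      by (smt (verit) K_def mult_right_mono norm_ge_zero)
    then show ?thesis by (metis norm_ge_zero power_mono power_mult_distrib)
  qed
  \<comment> \<open>The minimiser of \<open>1 - 2 \<mu> c + \<mu>\<^sup>2 K\<^sup>2\<close>, which
    bounds the squared contraction factor; the minimum is
    \<open>1 - c\<^sup>2 / K\<^sup>2\<close>.\<close>
  define \<mu> where "\<mu> = c / K\<^sup>2"
  have "0 < \<mu>" using \<open>0 < c\<close> \<open>0 < K\<close> by (simp add: \<mu>_def)
  define q where "q = sqrt (1 - c\<^sup>2 / K\<^sup>2)"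
  have c2: "c\<^sup>2 / K\<^sup>2 \<le> 1" "0 < c\<^sup>2 / K\<^sup>2"
    using \<open>0 < c\<close> \<open>c \<le> K\<close> by (auto simp: power_mono)
  have q: "0 \<le> q" "q < 1" "q\<^sup>2 = 1 - c\<^sup>2 / K\<^sup>2"
    using c2 by (auto simp: q_def)
  have contr: "norm (x - \<mu> *\<^sub>R bop_apply T x) \<le> q * norm x" for x
  proof (rule power2_le_imp_le)
    have "(norm (x - \<mu> *\<^sub>R bop_apply T x))\<^sup>2
        = (norm x)\<^sup>2 - 2 * \<mu> * inner (bop_apply T x) x + \<mu>\<^sup>2 * (norm (bop_apply T x))\<^sup>2"
      by (simp add: power2_norm_eq_inner inner_simps inner_commute)
        (simp add: power2_eq_square)
    also have "\<dots> \<le> (norm x)\<^sup>2 - 2 * \<mu> * (c * (norm x)\<^sup>2) + \<mu>\<^sup>2 * (K\<^sup>2 * (norm x)\<^sup>2)"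
      using \<open>0 < \<mu>\<close> Tx[of x] assms(2)[of x]
      by (intro add_mono diff_mono mult_left_mono) auto
    also have "\<dots> = (q * norm x)\<^sup>2"
    proof -
      have "\<mu> * K\<^sup>2 = c" using \<open>0 < K\<close> by (simp add: \<mu>_def)
      then have "\<mu>\<^sup>2 * (K\<^sup>2 * (norm x)\<^sup>2) = \<mu> * c * (norm x)\<^sup>2"
        by (simp add: power2_eq_square)
      moreover have "q\<^sup>2 = 1 - \<mu> * c"
        using q(3) by (simp add: \<mu>_def power2_eq_square)
      ultimately show ?thesis by (simp only: power_mult_distrib) (simp add: algebra_simps)
    qed
    finally show "(norm (x - \<mu> *\<^sub>R bop_apply T x))\<^sup>2 \<le> (q * norm x)\<^sup>2" .
    show "0 \<le> q * norm x" using q by simp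
  qed
  have solve: "\<exists>!x. bop_apply T x = y" for y
  proof -
    have "\<exists>!x. x - \<mu> *\<^sub>R (bop_apply T x - y) = x"
    proof (rule banach_fix_type[OF q(1,2)], intro allI)
      fix u v
      have eq: "u - \<mu> *\<^sub>R (bop_apply T u - y) - (v - \<mu> *\<^sub>R (bop_apply T v - y))
          = (u - v) - \<mu> *\<^sub>R bop_apply T (u - v)"
        by (simp add: bop_linear_simps algebra_simps)
      show "dist (u - \<mu> *\<^sub>R (bop_apply T u - y)) (v - \<mu> *\<^sub>R (bop_apply T v - y)) \<le> q * dist u v"
        unfolding dist_norm eq by (rule contr)
    qed
    then show ?thesis using \<open>0 < \<mu>\<close> by simp
  qed
  define f where "f y = (THE x. bop_apply T x = y)" for y
  have Tf: "bop_apply T (f y) = y" for y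
    unfolding f_def by (rule theI'[OF solve])
  have fT: "f (bop_apply T x) = x" for x
    unfolding f_def using solve by blast
  have "\<exists>S :: 'a bop. \<forall>x. bop_apply S x = f x"
  proof (rule bop_exists)
    show "f (x + y) = f x + f y" for x y
      by (metis Tf fT bop_apply_add)
    show "f (a *\<^sub>C x) = a *\<^sub>C f x" for a x
      by (metis Tf fT bop_apply_scaleC)
    show "norm (f x) \<le> (1 / c) * norm x" for x
    proof -
      have "c * (norm (f x))\<^sup>2 \<le> norm x * norm (f x)"
        using assms(2)[of "f x"] norm_cauchy_schwarz[of x "f x"] by (simp add: Tf)
      then have "norm (f x) * (c * norm (f x)) \<le> norm (f x) * norm x"
        by (simp add: power2_eq_square algebra_simps)
      then have "c * norm (f x) \<le> norm x"
        by (metis mult_le_cancel_left_pos mult_zero_right norm_ge_zero order_le_less)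
      then show ?thesis using \<open>0 < c\<close> by (simp add: field_simps)
    qed
  qed
  then obtain S where S: "\<And>x. bop_apply S x = f x" by blast
  have "S * T = 1" "T * S = 1"
    by (rule bop_eqI, simp add: S Tf fT)+
  then show ?thesis unfolding invertible_op_def by blast
qed

lemma invertible_op_mult: "invertible_op S \<Longrightarrow> invertible_op T \<Longrightarrow> invertible_op (S * T)"
  unfolding invertible_op_def by (metis mult.assoc mult_1_left)

text \<open>\<open>R * T\<close> is a left and \<open>T * R\<close> a right inverse of
  \<open>S\<close>, so they agree. This transfers invertibility from coercive products, such as
  squares, to their factors.\<close>

lemma invertible_op_commuting_factor:
  assumes "S * T = T * S" "invertible_op (S * T)"
  shows "invertible_op S"
proof -
  obtain R where R: "R * (S * T) = 1" "S * T * R = 1"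
    using assms(2) by (auto simp: invertible_op_def)
  have "(R * T) * S = 1"
    using R(1) by (simp add: mult.assoc assms(1))
  have "S * (T * R) = 1"
    using R(2) by (simp only: mult.assoc)
  have "R * T = T * R"
    by (metis \<open>(R * T) * S = 1\<close> \<open>S * (T * R) = 1\<close> mult.assoc mult_1_left mult_1_right)
  with \<open>(R * T) * S = 1\<close> \<open>S * (T * R) = 1\<close> show ?thesis
    unfolding invertible_op_def by metis
qed

lemma invertible_op_bounded_below:
  assumes "invertible_op T"
  shows "\<exists>c>0. \<forall>x. c * norm x \<le> norm (bop_apply T x)"
proof -
  obtain S where S: "S * T = 1" using assms by (auto simp: invertible_op_def)
  have "1 / (norm S + 1) * norm x \<le> norm (bop_apply T x)" for x
  proof -
    have "norm x = norm (bop_apply S (bop_apply T x))"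
      using S by (metis bop_apply_simps(4,7))
    also have "\<dots> \<le> (norm S + 1) * norm (bop_apply T x)"
      using norm_bop_apply[of S "bop_apply T x"]
      by (smt (verit) mult_right_mono norm_ge_zero)
    finally show ?thesis
      by (simp add: pos_divide_le_eq add_nonneg_pos mult.commute)
  qed
  moreover have "0 < 1 / (norm S + 1)"
    by (simp add: add_nonneg_pos)
  ultimately show ?thesis by blast
qed

text \<open>Symmetry turns the lower bound into coercivity of \<open>T * T\<close>. Together with
  \<open>invertible_op_bounded_below\<close> it describes the spectrum of a self-adjoint operator by
  approximate eigenvectors.\<close>

lemma invertible_op_if_bounded_below:
  assumes "selfadj T" "0 < c" "\<And>x. c * norm x \<le> norm (bop_apply T x)"
  shows "invertible_op T"
proof -
  have "c\<^sup>2 * (norm x)\<^sup>2 \<le> inner (bop_apply (T * T) x) x" for x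
    using power_mono[OF assms(3)[of x], of 2] assms(1,2)
    by (simp add: power_mult_distrib selfadjD power2_norm_eq_inner)
  then have "invertible_op (T * T)"
    using assms(2) by (intro coercive_invertible[of "c\<^sup>2"]) auto
  then show ?thesis by (rule invertible_op_commuting_factor[rotated]) simp
qed

lemma scalar_op_commute: "T * scalar_op z = scalar_op z * T"
  by (rule bop_eqI) (simp add: bop_apply_scaleC)

text \<open>With \<open>R = T - Re z\<close>, the product of \<open>T - z\<close> and
  \<open>T - cnj z\<close> is \<open>R\<^sup>2 + (Im z)\<^sup>2\<close>, which is coercive off the
  real axis.\<close>

lemma Sp_selfadj_real:
  assumes "selfadj T" "z \<in> Sp T"
  shows "Im z = 0"
proof (rule ccontr)
  assume "Im z \<noteq> 0"
  let ?S = "T - scalar_op z" and ?S' = "T - scalar_op (cnj z)"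
  define R where "R = T - Re z *\<^sub>R 1"
  have R: "selfadj R" using assms(1) by (simp add: R_def)
  have z: "z *\<^sub>C y = Re z *\<^sub>R y + Im z *\<^sub>R (\<i> *\<^sub>C y)"
    "cnj z *\<^sub>C y = Re z *\<^sub>R y - Im z *\<^sub>R (\<i> *\<^sub>C y)" for y :: 'a
  proof -
    have "(Re z + \<i> * Im z) *\<^sub>C y = Re z *\<^sub>R y + Im z *\<^sub>R (\<i> *\<^sub>C y)"
      by (simp add: scaleC_add_left scaleR_scaleC scaleC_scaleC mult.commute)
    then show "z *\<^sub>C y = Re z *\<^sub>R y + Im z *\<^sub>R (\<i> *\<^sub>C y)"
      by (metis complex_eq)
    have "(Re z + \<i> * (- Im z)) *\<^sub>C y = Re z *\<^sub>R y + (- Im z) *\<^sub>R (\<i> *\<^sub>C y)"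
      by (simp only: scaleC_add_left scaleR_scaleC scaleC_scaleC mult.commute of_real_minus)
    moreover have "cnj z = Re z + \<i> * (- Im z)"
      by (simp add: complex_eq_iff)
    ultimately show "cnj z *\<^sub>C y = Re z *\<^sub>R y - Im z *\<^sub>R (\<i> *\<^sub>C y)"
      by simp
  qed
  have i: "\<i> *\<^sub>C (\<i> *\<^sub>C y) = - y" for y :: 'a
    using scaleR_scaleC[of "-1" y] by (simp add: scaleC_scaleC)
  note expand = z i bop_linear_simps bop_apply_scaleC linear_simps[OF bounded_linear_scaleC]
    scaleR_scaleC[symmetric] algebra_simps power2_eq_square scaleR_2[symmetric]
  have SS: "?S * ?S' = R * R + (Im z)\<^sup>2 *\<^sub>R 1"
    by (rule bop_eqI) (simp add: R_def expand)
  have comm: "?S * ?S' = ?S' * ?S"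
    by (rule bop_eqI) (simp add: expand)
  have "inner (bop_apply R (bop_apply R x)) x = (norm (bop_apply R x))\<^sup>2" for x
    using R by (simp add: selfadjD power2_norm_eq_inner)
  then have "(Im z)\<^sup>2 * (norm x)\<^sup>2 \<le> inner (bop_apply (R * R + (Im z)\<^sup>2 *\<^sub>R 1) x) x" for x
    by (simp add: inner_left_distrib power2_norm_eq_inner[symmetric])
  then have "invertible_op (R * R + (Im z)\<^sup>2 *\<^sub>R 1)"
    using \<open>Im z \<noteq> 0\<close> by (intro coercive_invertible[of "(Im z)\<^sup>2"]) auto
  then have "invertible_op ?S"
    using invertible_op_commuting_factor[OF comm] SS by simp
  with assms(2) show False by (simp add: Sp_def)
qed

text \<open>The set on which \<open>cfc\<close> asks for uniform convergence.\<close>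

definition rspec :: "'a :: complex_hilbert_space bop \<Rightarrow> real set" where
  "rspec T = {t. complex_of_real t \<in> Sp T}"

lemma rspec_iff: "t \<in> rspec T \<longleftrightarrow> \<not> invertible_op (T - t *\<^sub>R 1)"
  by (simp add: rspec_def Sp_def)

lemma Sp_eq_rspec: "selfadj T \<Longrightarrow> Sp T = complex_of_real ` rspec T"
proof -
  assume T: "selfadj T"
  have "z \<in> complex_of_real ` rspec T" if "z \<in> Sp T" for z
  proof -
    have "z = complex_of_real (Re z)"
      using Sp_selfadj_real[OF T that] by (simp add: complex_eq_iff)
    then show ?thesis using that by (metis (mono_tags) image_eqI mem_Collect_eq rspec_def)
  qed
  then show ?thesis by (auto simp: rspec_def)
qed

lemma rspec_bounded:
  assumes "selfadj T" "t \<in> rspec T"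
  shows "\<bar>t\<bar> \<le> norm T"
proof (rule ccontr)
  assume *: "\<not> \<bar>t\<bar> \<le> norm T"
  have "(\<bar>t\<bar> - norm T) * norm x \<le> norm (bop_apply (T - t *\<^sub>R 1) x)" for x
  proof -
    have "\<bar>t\<bar> * norm x - norm T * norm x \<le> norm (t *\<^sub>R x) - norm (bop_apply T x)"
      using norm_bop_apply[of T x] by simp
    also have "\<dots> \<le> norm (bop_apply (T - t *\<^sub>R 1) x)"
      using norm_triangle_ineq2[of "t *\<^sub>R x" "bop_apply T x"] by (simp add: norm_minus_commute)
    finally show ?thesis by (simp add: algebra_simps)
  qed
  then have "invertible_op (T - t *\<^sub>R 1)"
    using * assms(1) by (intro invertible_op_if_bounded_below[of _ "\<bar>t\<bar> - norm T"]) auto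
  with assms(2) show False by (simp add: rspec_iff)
qed

lemma closed_rspec:
  assumes "selfadj T"
  shows "closed (rspec T)"
  unfolding closed_def open_dist
proof (intro ballI)
  fix t assume "t \<in> - rspec T"
  then obtain c where c: "c > 0" "\<And>x. c * norm x \<le> norm (bop_apply (T - t *\<^sub>R 1) x)"
    using invertible_op_bounded_below[of "T - t *\<^sub>R 1"] by (auto simp: rspec_iff)
  have "s \<in> - rspec T" if "dist s t < c / 2" for s
  proof -
    have "c / 2 * norm x \<le> norm (bop_apply (T - s *\<^sub>R 1) x)" for x
    proof -
      have "norm (bop_apply (T - t *\<^sub>R 1) x) \<le> norm (bop_apply (T - s *\<^sub>R 1) x) + norm ((s - t) *\<^sub>R x)"
        by (rule order_trans[OF _ norm_triangle_ineq]) (simp add: algebra_simps)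
      moreover have "norm ((s - t) *\<^sub>R x) \<le> c / 2 * norm x"
        using that mult_right_mono[of "\<bar>s - t\<bar>" "c / 2" "norm x"] by (simp add: dist_real_def)
      ultimately show ?thesis using c(2)[of x] by simp
    qed
    then have "invertible_op (T - s *\<^sub>R 1)"
      using c(1) assms by (intro invertible_op_if_bounded_below[of _ "c / 2"]) auto
    then show ?thesis by (simp add: rspec_iff)
  qed
  then show "\<exists>e>0. \<forall>y. dist y t < e \<longrightarrow> y \<in> - rspec T"
    using c(1) by (intro exI[of _ "c / 2"]) auto
qed

lemma compact_rspec: "selfadj T \<Longrightarrow> compact (rspec T)"
  unfolding compact_eq_bounded_closed bounded_iff
  using closed_rspec rspec_bounded by fastforce

lemma rspec_nonneg:
  assumes "0 \<le> T" "t \<in> rspec T"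
  shows "0 \<le> t"
proof (rule ccontr)
  assume "\<not> 0 \<le> t"
  then have "invertible_op (T - t *\<^sub>R 1)"
    using assms(1)
    by (intro coercive_invertible[of "- t"])
      (auto simp: positive_op_iff inner_simps power2_norm_eq_inner)
  with assms(2) show False by (simp add: rspec_iff)
qed

text \<open>If both values are missing, \<open>T\<^sup>2 - M\<^sup>2\<close> with
  \<open>M = norm T\<close> is bounded below by some \<open>c > 0\<close>. Expanding the square of
  its norm at \<open>x\<close> shows that \<open>T\<close> stretches no vector by as much as
  \<open>M\<close>, against the definition of the norm.\<close>

lemma norm_in_rspec:
  assumes "selfadj T" "T \<noteq> 0"
  shows "norm T \<in> rspec T \<or> - norm T \<in> rspec T"
proof (rule ccontr)
  assume "\<not> ?thesis"
  then have "invertible_op ((T - norm T *\<^sub>R 1) * (T + norm T *\<^sub>R 1))"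
    by (auto simp: rspec_iff intro: invertible_op_mult)
  then obtain c where c: "c > 0"
    "\<And>x. c * norm x \<le> norm (bop_apply ((T - norm T *\<^sub>R 1) * (T + norm T *\<^sub>R 1)) x)"
    using invertible_op_bounded_below by blast
  define M where "M = norm T"
  have "M > 0" using assms(2) by (simp add: M_def)
  have gap: "(norm (bop_apply T x))\<^sup>2 \<le> (M\<^sup>2 - c\<^sup>2 / M\<^sup>2) * (norm x)\<^sup>2" for x
  proof -
    let ?y = "bop_apply T x"
    have "(c * norm x)\<^sup>2 \<le> (norm (bop_apply T ?y - (M * M) *\<^sub>R x))\<^sup>2"
      using c(2)[of x] \<open>c > 0\<close>
      by (intro power_mono) (simp_all add: M_def bop_linear_simps algebra_simps)
    also have "\<dots> = (norm (bop_apply T ?y))\<^sup>2 - 2 * M\<^sup>2 * (norm ?y)\<^sup>2 + M ^ 4 * (norm x)\<^sup>2"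
    proof -
      have "inner (bop_apply T ?y) x = (norm ?y)\<^sup>2"
        using selfadjD[OF assms(1), of ?y x] by (simp add: power2_norm_eq_inner)
      moreover have "(norm (bop_apply T ?y - (M * M) *\<^sub>R x))\<^sup>2
          = (norm (bop_apply T ?y))\<^sup>2 - 2 * (M * M) * inner (bop_apply T ?y) x + (M * M)\<^sup>2 * (norm x)\<^sup>2"
        by (simp add: power2_norm_eq_inner inner_simps inner_commute)
          (simp add: power2_eq_square)
      ultimately show ?thesis
        by (simp add: power2_eq_square power4_eq_xxxx)
    qed
    also have "\<dots> \<le> (M * norm ?y)\<^sup>2 - 2 * M\<^sup>2 * (norm ?y)\<^sup>2 + M ^ 4 * (norm x)\<^sup>2"
      using power_mono[OF norm_bop_apply[of T ?y], of 2] by (simp add: M_def)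
    also have "\<dots> = M\<^sup>2 * (M\<^sup>2 * (norm x)\<^sup>2 - (norm ?y)\<^sup>2)"
      by (simp add: power_mult_distrib algebra_simps power2_eq_square power4_eq_xxxx)
    finally show ?thesis
      using \<open>M > 0\<close> by (simp add: field_simps power_mult_distrib)
  qed
  \<comment> \<open>The maximum with 0 spares a proof that the difference is nonnegative and still
    leaves \<open>k < M\<close>.\<close>
  define k where "k = sqrt (max 0 (M\<^sup>2 - c\<^sup>2 / M\<^sup>2))"
  have "norm (bop_apply T x) \<le> k * norm x" for x
  proof (rule power2_le_imp_le)
    have "(norm (bop_apply T x))\<^sup>2 \<le> max 0 (M\<^sup>2 - c\<^sup>2 / M\<^sup>2) * (norm x)\<^sup>2"
      by (rule order_trans[OF gap]) (simp add: mult_right_mono)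
    then show "(norm (bop_apply T x))\<^sup>2 \<le> (k * norm x)\<^sup>2"
      by (simp add: k_def power_mult_distrib)
  qed (simp add: k_def)
  then have "M \<le> k" unfolding M_def by (rule norm_bop_le[rotated]) (simp add: k_def)
  have "k\<^sup>2 < M\<^sup>2" using \<open>c > 0\<close> \<open>M > 0\<close> by (simp add: k_def)
  with \<open>M \<le> k\<close> \<open>M > 0\<close> show False
    by (smt (verit) power_mono)
qed

lemma bounded_linear_bop_apply_left: "bounded_linear (\<lambda>T. bop_apply T x)"
  by (rule bounded_linear_intro[where K = "norm x"])
    (simp_all add: norm_bop_apply mult.commute[of "norm x"])


section \<open>Polynomials of an operator\<close>

lemma poly_op_0 [simp]: "poly_op 0 T = 0"
  by (simp add: poly_op_def)

lemma poly_op_pCons [simp]: "poly_op (pCons a p) T = a *\<^sub>R 1 + T * poly_op p T"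
proof (cases "p = 0")
  case True
  then show ?thesis by (simp add: poly_op_def)
next
  case False
  then show ?thesis
    by (simp add: poly_op_def sum.atMost_Suc_shift sum_distrib_left del: sum.atMost_Suc)
qed

lemma poly_op_add: "poly_op (p + q) T = poly_op p T + poly_op q T"
  by (induction p q rule: poly_induct2) (simp_all add: algebra_simps)

lemma poly_op_smult: "poly_op (smult a p) T = a *\<^sub>R poly_op p T"
  by (induction p) (simp_all add: algebra_simps)

lemma poly_op_diff: "poly_op (p - q) T = poly_op p T - poly_op q T"
  using poly_op_add[of p "- q" T] poly_op_smult[of "- 1" q T] by simp

lemma poly_op_mult: "poly_op (p * q) T = poly_op p T * poly_op q T"
  by (induction p) (simp_all add: poly_op_add poly_op_smult mult_pCons_left algebra_simps)

lemma poly_op_commute: "poly_op p T * poly_op q T = poly_op q T * poly_op p T"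
  by (metis poly_op_mult mult.commute)

lemma poly_op_self_commute: "T * poly_op p T = poly_op p T * T"
  using poly_op_commute[of "[:0, 1:]" T p] by simp

lemma selfadj_poly_op: "selfadj T \<Longrightarrow> selfadj (poly_op p T)"
  by (induction p) (auto intro: selfadj_mult poly_op_self_commute)

text \<open>A real polynomial need not split over the reals, so spectral mapping passes through
  complex coefficients. These act as scalar operators, and the Horner form makes recursion along
  \<open>pCons\<close> immediate.\<close>

definition cpoly_op :: "complex poly \<Rightarrow> 'a :: complex_hilbert_space bop \<Rightarrow> 'a bop" where
  "cpoly_op p T = fold_coeffs (\<lambda>a S. scalar_op a + T * S) p 0"

lemma scalar_op_0 [simp]: "scalar_op 0 = 0"
  using scalar_op_of_real[of 0] by simp

lemma scalar_op_add: "scalar_op (a + b) = scalar_op a + scalar_op b"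
  by (rule bop_eqI) (simp add: scaleC_add_left)

lemma scalar_op_mult: "scalar_op (a * b) = scalar_op a * scalar_op b"
  by (rule bop_eqI) (simp add: scaleC_scaleC)

lemma cpoly_op_0 [simp]: "cpoly_op 0 T = 0"
  by (simp add: cpoly_op_def)

lemma cpoly_op_pCons [simp]: "cpoly_op (pCons a p) T = scalar_op a + T * cpoly_op p T"
  by (cases "p = 0 \<and> a = 0") (auto simp: cpoly_op_def)

lemma cpoly_op_add: "cpoly_op (p + q) T = cpoly_op p T + cpoly_op q T"
  by (induction p q rule: poly_induct2) (simp_all add: algebra_simps scalar_op_add)

lemma cpoly_op_smult: "cpoly_op (smult a p) T = scalar_op a * cpoly_op p T"
proof (induction p)
  case (pCons b p)
  have "T * (scalar_op a * cpoly_op p T) = scalar_op a * (T * cpoly_op p T)"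
    by (metis mult.assoc scalar_op_commute)
  then show ?case by (simp add: pCons.IH scalar_op_mult distrib_left)
qed simp

lemma cpoly_op_of_real: "cpoly_op (map_poly complex_of_real p) T = poly_op p T"
  by (induction p) (simp_all add: map_poly_pCons)

lemma poly_map_poly_of_real:
  "poly (map_poly complex_of_real p) (complex_of_real t) = complex_of_real (poly p t)"
  by (induction p) (simp_all add: map_poly_pCons)

text \<open>The fundamental theorem of algebra splits off one linear factor at a time, and each
  factor is invertible because its root avoids the spectrum.\<close>

lemma invertible_cpoly_op:
  assumes "p \<noteq> 0" "\<And>z. poly p z = 0 \<Longrightarrow> z \<notin> Sp T"
  shows "invertible_op (cpoly_op p T)"
  using assms
proof (induction "degree p" arbitrary: p)
  case 0
  then obtain c where c: "p = [:c:]" "c \<noteq> 0"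
    by (metis degree_eq_zeroE pCons_0_0)
  have "scalar_op (inverse c) * scalar_op c = (1 :: 'a bop)"
    "scalar_op c * scalar_op (inverse c) = (1 :: 'a bop)"
    using c(2) scalar_op_of_real[of 1] by (simp_all add: scalar_op_mult[symmetric])
  then show ?case using c(1) by (auto simp: invertible_op_def)
next
  case (Suc n)
  then have "\<not> constant (poly p)" by (simp add: constant_degree)
  then obtain z where z: "poly p z = 0"
    using fundamental_theorem_of_algebra by blast
  then obtain q where q: "p = [:- z, 1:] * q"
    by (auto simp: poly_eq_0_iff_dvd elim: dvdE)
  have "q \<noteq> 0" using Suc.prems(1) q by auto
  then have "degree p = Suc (degree q)"
    unfolding q by (subst degree_mult_eq) auto
  then have "invertible_op (cpoly_op q T)"
    using Suc \<open>q \<noteq> 0\<close> by (auto simp: q)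
  moreover have "invertible_op (T - scalar_op z)"
    using Suc.prems(2)[OF z] by (simp add: Sp_def)
  moreover have "cpoly_op p T = (T - scalar_op z) * cpoly_op q T"
  proof -
    have "scalar_op (- z) = - (scalar_op z :: 'a bop)"
      using scalar_op_add[of z "- z"] by (simp add: eq_neg_iff_add_eq_0 add.commute)
    moreover have "p = smult (- z) q + pCons 0 q"
      unfolding q by (simp add: mult_pCons_left)
    ultimately show ?thesis
      by (simp only: cpoly_op_add cpoly_op_smult cpoly_op_pCons) (simp add: algebra_simps)
  qed
  ultimately show ?case by (simp add: invertible_op_mult)
qed

text \<open>The second assumption excludes the zero space, where every operator is invertible and
  all spectra are empty.\<close>

lemma rspec_nonempty:
  fixes T :: "'a :: complex_hilbert_space bop"
  assumes "selfadj T" "(1 :: 'a bop) \<noteq> 0"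
  shows "rspec T \<noteq> {}"
proof (cases "T = 0")
  case True
  have "\<not> invertible_op (0 :: 'a bop)"
    using assms(2) by (auto simp: invertible_op_def)
  then have "0 \<in> rspec T" by (simp add: rspec_iff True)
  then show ?thesis by blast
next
  case False
  then show ?thesis using norm_in_rspec[OF assms(1)] by blast
qed

text \<open>This is the inclusion of spectral mapping that bounds norms: if \<open>p - s\<close> has
  no zero in the spectrum of \<open>T\<close>, then \<open>p(T) - s\<close> is invertible.\<close>

lemma rspec_poly_op:
  fixes T :: "'a :: complex_hilbert_space bop"
  assumes "selfadj T" "s \<in> rspec (poly_op p T)"
  shows "s \<in> poly p ` rspec T"
proof (rule ccontr)
  assume no: "s \<notin> poly p ` rspec T"
  define q where "q = map_poly complex_of_real (p - [:s:])"
  have inv: "invertible_op (cpoly_op q T)" if "p - [:s:] \<noteq> 0"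
  proof (rule invertible_cpoly_op)
    show "q \<noteq> 0" using that by (simp add: q_def map_poly_eq_0_iff)
    fix z assume z: "poly q z = 0"
    show "z \<notin> Sp T"
    proof
      assume "z \<in> Sp T"
      then obtain t where t: "t \<in> rspec T" "z = complex_of_real t"
        using Sp_eq_rspec[OF assms(1)] by auto
      have "poly q z = complex_of_real (poly (p - [:s:]) t)"
        unfolding q_def t(2) by (rule poly_map_poly_of_real)
      with z no t(1) show False by auto
    qed
  qed
  have "\<not> invertible_op (cpoly_op q T)"
    using assms(2) by (simp add: q_def cpoly_op_of_real rspec_iff poly_op_diff)
  with inv have "p = [:s:]" by auto
  \<comment> \<open>When \<open>p\<close> is the constant \<open>s\<close>, the claim amounts to a
    nonempty spectrum. The zero space is ruled out because \<open>s\<close> itself is a spectral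
    value of some operator.\<close>
  moreover have "(1 :: 'a bop) \<noteq> 0"
  proof
    assume *: "(1 :: 'a bop) = 0"
    have "S = 0" for S :: "'a bop" using * by (metis mult_1_right mult_zero_right)
    then have "invertible_op (S :: 'a bop)" for S
      unfolding invertible_op_def by metis
    with assms(2) show False by (simp add: rspec_iff)
  qed
  ultimately show False
    using rspec_nonempty[OF assms(1)] no by auto
qed

text \<open>The norm of \<open>p(T)\<close> is, up to sign, a spectral value of \<open>p(T)\<close>,
  hence a value of \<open>p\<close> on the spectrum of \<open>T\<close>. All convergence in the
  functional calculus comes from this estimate.\<close>

lemma norm_poly_op_le:
  assumes "selfadj T" "0 \<le> e" "\<And>t. t \<in> rspec T \<Longrightarrow> \<bar>poly p t\<bar> \<le> e"
  shows "norm (poly_op p T) \<le> e"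
proof (cases "poly_op p T = 0")
  case False
  from norm_in_rspec[OF selfadj_poly_op[OF assms(1)] False]
  obtain t where "t \<in> rspec T" "poly p t = norm (poly_op p T) \<or> poly p t = - norm (poly_op p T)"
    using rspec_poly_op[OF assms(1)] by (metis imageE)
  then show ?thesis using assms(3)[of t] by auto
qed (use assms in simp)


section \<open>The continuous functional calculus\<close>

text \<open>Discharges the definite description: polynomials from two approximating sequences differ
  by little on the spectrum, hence by little in norm as operators.\<close>

lemma cfc_eqI:
  assumes T: "selfadj T" and p: "uniform_limit (rspec T) (\<lambda>n. poly (p n)) f sequentially"
    and Y: "(\<lambda>n. poly_op (p n) T) \<longlonglongrightarrow> Y"
  shows "cfc f T = Y"
  unfolding cfc_def rspec_def[symmetric]
proof (rule the_equality)
  fix Z assume "\<exists>p. uniform_limit (rspec T) (\<lambda>n. poly (p n)) f sequentially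
      \<and> (\<lambda>n. poly_op (p n) T) \<longlonglongrightarrow> Z"
  then obtain q where q: "uniform_limit (rspec T) (\<lambda>n. poly (q n)) f sequentially"
    "(\<lambda>n. poly_op (q n) T) \<longlonglongrightarrow> Z" by blast
  have "uniform_limit (rspec T) (\<lambda>n t. poly (p n) t - poly (q n) t) (\<lambda>t. f t - f t) sequentially"
    by (intro uniform_limit_minus p q)
  then have u: "uniform_limit (rspec T) (\<lambda>n t. poly (p n - q n) t) (\<lambda>t. 0) sequentially"
    by simp
  have "(\<lambda>n. poly_op (p n - q n) T) \<longlonglongrightarrow> 0"
  proof (rule tendstoI)
    fix e :: real assume "0 < e"
    then have "\<forall>\<^sub>F n in sequentially. \<forall>t\<in>rspec T. dist (poly (p n - q n) t) 0 < e / 2"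
      by (intro uniform_limitD[OF u]) simp
    then show "\<forall>\<^sub>F n in sequentially. dist (poly_op (p n - q n) T) 0 < e"
    proof eventually_elim
      case (elim n)
      then have "norm (poly_op (p n - q n) T) \<le> e / 2"
        using \<open>0 < e\<close> by (intro norm_poly_op_le[OF T]) (auto simp: less_imp_le)
      then show ?case using \<open>0 < e\<close> by simp
    qed
  qed
  moreover have "(\<lambda>n. poly_op (p n - q n) T) \<longlonglongrightarrow> Y - Z"
    unfolding poly_op_diff by (intro tendsto_diff Y q)
  ultimately show "Z = Y"
    using LIMSEQ_unique by fastforce
qed (use p Y in blast)

lemma poly_op_tendsto_cfc:
  assumes T: "selfadj T" and p: "uniform_limit (rspec T) (\<lambda>n. poly (p n)) f sequentially"
  shows "(\<lambda>n. poly_op (p n) T) \<longlonglongrightarrow> cfc f T"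
proof -
  have "Cauchy (\<lambda>n. poly_op (p n) T)"
  proof (rule metric_CauchyI)
    fix e :: real assume "0 < e"
    have "uniformly_Cauchy_on (rspec T) (\<lambda>n. poly (p n))"
      using p by (meson uniformly_convergent_on_def uniformly_convergent_Cauchy)
    then obtain M where M: "\<And>t m n. t \<in> rspec T \<Longrightarrow> m \<ge> M \<Longrightarrow> n \<ge> M \<Longrightarrow>
        dist (poly (p m) t) (poly (p n) t) < e / 2"
      using \<open>0 < e\<close> unfolding uniformly_Cauchy_on_def by (meson half_gt_zero)
    have "dist (poly_op (p m) T) (poly_op (p n) T) < e" if "m \<ge> M" "n \<ge> M" for m n
    proof -
      have "norm (poly_op (p m - p n) T) \<le> e / 2"
        using \<open>0 < e\<close> M that
        by (intro norm_poly_op_le[OF T]) (auto simp: dist_real_def less_imp_le)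
      then show ?thesis using \<open>0 < e\<close> by (simp add: dist_norm poly_op_diff)
    qed
    then show "\<exists>M. \<forall>m\<ge>M. \<forall>n\<ge>M. dist (poly_op (p m) T) (poly_op (p n) T) < e" by blast
  qed
  then obtain L where "(\<lambda>n. poly_op (p n) T) \<longlonglongrightarrow> L"
    by (auto simp: Cauchy_convergent_iff convergent_def)
  with cfc_eqI[OF T p] show ?thesis by blast
qed

lemma poly_approximation:
  fixes f :: "real \<Rightarrow> real"
  assumes "compact K" "continuous_on K f"
  shows "\<exists>p. uniform_limit K (\<lambda>n. poly (p n)) f sequentially"
proof -
  have "\<exists>q. \<forall>t\<in>K. \<bar>f t - poly q t\<bar> < 1 / real (Suc n)" for n
  proof -
    obtain h where h: "real_polynomial_function h" "\<And>t. t \<in> K \<Longrightarrow> \<bar>f t - h t\<bar> < 1 / real (Suc n)"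
      using Stone_Weierstrass_real_polynomial_function[OF assms, of "1 / real (Suc n)"] by auto
    then obtain a m where "h = (\<lambda>x. \<Sum>i\<le>m. a i * x ^ i)"
      by (auto simp: real_polynomial_function_iff_sum)
    then have "h t = poly (\<Sum>i\<le>m. monom (a i) i) t" for t
      by (simp add: poly_sum poly_monom)
    with h(2) show ?thesis by metis
  qed
  then obtain p where p: "\<And>n t. t \<in> K \<Longrightarrow> \<bar>f t - poly (p n) t\<bar> < 1 / real (Suc n)"
    by metis
  have "uniform_limit K (\<lambda>n. poly (p n)) f sequentially"
  proof (rule uniform_limitI)
    fix e :: real assume "0 < e"
    then have "\<forall>\<^sub>F n in sequentially. 1 / real (Suc n) < e"
      using order_tendstoD(2)[OF LIMSEQ_inverse_real_of_nat] by (simp add: inverse_eq_divide)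
    then show "\<forall>\<^sub>F n in sequentially. \<forall>t\<in>K. dist (poly (p n) t) (f t) < e"
    proof eventually_elim
      case (elim n)
      then show ?case
        using p[of _ n] by (auto simp: dist_real_def abs_minus_commute intro: less_trans)
    qed
  qed
  then show ?thesis by blast
qed

lemma cfc_poly: "selfadj T \<Longrightarrow> cfc (poly p) T = poly_op p T"
  by (rule cfc_eqI[where p = "\<lambda>_. p"]) (auto simp: uniform_limit_iff)

lemma cfc_const [simp]: "selfadj T \<Longrightarrow> cfc (\<lambda>_. c) T = c *\<^sub>R 1"
proof -
  have "poly [:c:] = (\<lambda>_. c)" by (simp add: fun_eq_iff)
  then show "selfadj T \<Longrightarrow> cfc (\<lambda>_. c) T = c *\<^sub>R 1"
    using cfc_poly[of T "[:c:]"] by simp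
qed

lemma cfc_id [simp]: "selfadj T \<Longrightarrow> cfc (\<lambda>t. t) T = T"
proof -
  have "poly [:0, 1:] = (\<lambda>t :: real. t)" by (simp add: fun_eq_iff)
  then show "selfadj T \<Longrightarrow> cfc (\<lambda>t. t) T = T"
    using cfc_poly[of T "[:0, 1:]"] by simp
qed

lemma cfc_cong:
  assumes "\<And>t. t \<in> rspec T \<Longrightarrow> f t = h t"
  shows "cfc f T = cfc h T"
proof -
  have "uniform_limit (rspec T) q f sequentially = uniform_limit (rspec T) q h sequentially" for q
    using assms by (auto simp: uniform_limit_iff)
  then show ?thesis unfolding cfc_def rspec_def[symmetric] by simp
qed

section \<open>Algebra, order, spectrum and composition for a fixed self-adjoint operator\<close>

context
  fixes T :: "'a :: complex_hilbert_space bop"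
  assumes T: "selfadj T"
begin

lemma cfc_approximation:
  assumes "continuous_on (rspec T) f"
  obtains p where "uniform_limit (rspec T) (\<lambda>n. poly (p n)) f sequentially"
    "(\<lambda>n. poly_op (p n) T) \<longlonglongrightarrow> cfc f T"
  using poly_approximation[OF compact_rspec[OF T] assms] poly_op_tendsto_cfc[OF T] by blast

lemma cfc_add:
  assumes "continuous_on (rspec T) f" "continuous_on (rspec T) h"
  shows "cfc (\<lambda>t. f t + h t) T = cfc f T + cfc h T"
proof -
  obtain p where p: "uniform_limit (rspec T) (\<lambda>n. poly (p n)) f sequentially"
    "(\<lambda>n. poly_op (p n) T) \<longlonglongrightarrow> cfc f T" by (rule cfc_approximation[OF assms(1)])
  obtain q where q: "uniform_limit (rspec T) (\<lambda>n. poly (q n)) h sequentially"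
    "(\<lambda>n. poly_op (q n) T) \<longlonglongrightarrow> cfc h T" by (rule cfc_approximation[OF assms(2)])
  show ?thesis
  proof (rule cfc_eqI[OF T, where p = "\<lambda>n. p n + q n"])
    have "(\<lambda>n. poly (p n + q n)) = (\<lambda>n t. poly (p n) t + poly (q n) t)"
      by (simp add: fun_eq_iff)
    then show "uniform_limit (rspec T) (\<lambda>n. poly (p n + q n)) (\<lambda>t. f t + h t) sequentially"
      using uniform_limit_add[OF p(1) q(1)] by simp
    show "(\<lambda>n. poly_op (p n + q n) T) \<longlonglongrightarrow> cfc f T + cfc h T"
      unfolding poly_op_add by (intro tendsto_add p q)
  qed
qed

lemma cfc_mult:
  assumes "continuous_on (rspec T) f" "continuous_on (rspec T) h"
  shows "cfc (\<lambda>t. f t * h t) T = cfc f T * cfc h T"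
proof -
  obtain p where p: "uniform_limit (rspec T) (\<lambda>n. poly (p n)) f sequentially"
    "(\<lambda>n. poly_op (p n) T) \<longlonglongrightarrow> cfc f T" by (rule cfc_approximation[OF assms(1)])
  obtain q where q: "uniform_limit (rspec T) (\<lambda>n. poly (q n)) h sequentially"
    "(\<lambda>n. poly_op (q n) T) \<longlonglongrightarrow> cfc h T" by (rule cfc_approximation[OF assms(2)])
  show ?thesis
  proof (rule cfc_eqI[OF T, where p = "\<lambda>n. p n * q n"])
    have "bounded (f ` rspec T)" "bounded (h ` rspec T)"
      using assms compact_rspec[OF T] by (simp_all add: compact_continuous_image compact_imp_bounded)
    moreover have "(\<lambda>n. poly (p n * q n)) = (\<lambda>n t. poly (p n) t * poly (q n) t)"
      by (simp add: fun_eq_iff)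
    ultimately show "uniform_limit (rspec T) (\<lambda>n. poly (p n * q n)) (\<lambda>t. f t * h t) sequentially"
      using uniform_lim_mult[OF p(1) q(1)] by simp
    show "(\<lambda>n. poly_op (p n * q n) T) \<longlonglongrightarrow> cfc f T * cfc h T"
      unfolding poly_op_mult by (intro tendsto_mult p q)
  qed
qed

lemma cfc_scaleR:
  "continuous_on (rspec T) f \<Longrightarrow> cfc (\<lambda>t. c * f t) T = c *\<^sub>R cfc f T"
  using cfc_mult[of "\<lambda>_. c" f] by (simp add: T)

lemma cfc_diff:
  "continuous_on (rspec T) f \<Longrightarrow> continuous_on (rspec T) h \<Longrightarrow>
    cfc (\<lambda>t. f t - h t) T = cfc f T - cfc h T"
  using cfc_add[of f "\<lambda>t. (- 1) * h t"] cfc_scaleR[of h "- 1"]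
  by (simp add: continuous_on_minus)

lemma cfc_sum:
  "(\<And>i. i \<in> I \<Longrightarrow> continuous_on (rspec T) (f i)) \<Longrightarrow>
    cfc (\<lambda>t. \<Sum>i\<in>I. f i t) T = (\<Sum>i\<in>I. cfc (f i) T)"
  by (induction I rule: infinite_finite_induct)
    (simp_all add: T cfc_add continuous_on_sum)

lemma cfc_commute:
  assumes "continuous_on (rspec T) f" "continuous_on (rspec T) h"
  shows "cfc f T * cfc h T = cfc h T * cfc f T"
  using cfc_mult[OF assms] cfc_mult[OF assms(2,1)] by (simp add: mult.commute)

lemma selfadj_cfc:
  assumes "continuous_on (rspec T) f"
  shows "selfadj (cfc f T)"
proof -
  obtain p where p: "(\<lambda>n. poly_op (p n) T) \<longlonglongrightarrow> cfc f T"
    by (rule cfc_approximation[OF assms])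
  have pt: "(\<lambda>n. bop_apply (poly_op (p n) T) x) \<longlonglongrightarrow> bop_apply (cfc f T) x" for x
    by (rule bounded_linear.tendsto[OF bounded_linear_bop_apply_left p])
  show ?thesis unfolding selfadj_def
  proof (intro allI)
    fix x y
    have "(\<lambda>n. inner (bop_apply (poly_op (p n) T) x) y) \<longlonglongrightarrow> inner (bop_apply (cfc f T) x) y"
      "(\<lambda>n. inner x (bop_apply (poly_op (p n) T) y)) \<longlonglongrightarrow> inner x (bop_apply (cfc f T) y)"
      by (intro tendsto_intros pt)+
    then show "inner (bop_apply (cfc f T) x) y = inner x (bop_apply (cfc f T) y)"
      using selfadjD[OF selfadj_poly_op[OF T]] LIMSEQ_unique by auto
  qed
qed

text \<open>\<open>f(T)\<close> is the square of the self-adjoint operator given by the square root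
  of \<open>f\<close>.\<close>

lemma cfc_nonneg:
  assumes "continuous_on (rspec T) f" "\<And>t. t \<in> rspec T \<Longrightarrow> 0 \<le> f t"
  shows "0 \<le> cfc f T"
proof -
  define r where "r = (\<lambda>t. sqrt (f t))"
  have r: "continuous_on (rspec T) r"
    unfolding r_def by (intro continuous_intros assms)
  have "cfc f T = cfc r T * 1 * cfc r T"
    using assms(2) by (subst mult_1_right, subst cfc_mult[OF r r, symmetric], intro cfc_cong)
      (simp add: r_def)
  also have "0 \<le> \<dots>" by (intro conj_nonneg selfadj_cfc r one_bop_nonneg)
  finally show ?thesis .
qed

lemma cfc_mono:
  assumes "continuous_on (rspec T) f" "continuous_on (rspec T) h"
    and "\<And>t. t \<in> rspec T \<Longrightarrow> f t \<le> h t"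
  shows "cfc f T \<le> cfc h T"
  using cfc_nonneg[of "\<lambda>t. h t - f t"] assms by (simp add: cfc_diff continuous_on_diff)

text \<open>The order bounds between \<open>- e\<close> and \<open>e\<close> become a norm bound on
  testing the form at \<open>x\<close> and \<open>f(T) x\<close>.\<close>

lemma norm_cfc_le:
  assumes "continuous_on (rspec T) f" "0 \<le> e" "\<And>t. t \<in> rspec T \<Longrightarrow> \<bar>f t\<bar> \<le> e"
  shows "norm (cfc f T) \<le> e"
proof (rule norm_bop_le[OF assms(2)])
  fix x
  let ?y = "bop_apply (cfc f T) x"
  have "cfc f T \<le> cfc (\<lambda>_. e) T" "cfc (\<lambda>_. - e) T \<le> cfc f T"
    using assms(3) by (intro cfc_mono assms(1) continuous_on_const; force)+
  then have "\<bar>inner ?y ?y\<bar> \<le> e * (norm x * norm ?y)"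
    using assms(1,2) by (intro selfadj_form_bound selfadj_cfc) (simp_all add: T)
  then have "norm ?y * norm ?y \<le> norm ?y * (e * norm x)"
    by (simp add: power2_norm_eq_inner[symmetric] power2_eq_square mult.commute mult.left_commute)
  then show "norm ?y \<le> e * norm x"
    using assms(2) by (cases "norm ?y = 0") (auto simp: mult_le_cancel_left)
qed

text \<open>Off the range of \<open>f\<close>, the function \<open>1 / (f - s)\<close> is continuous
  on the spectrum and yields the inverse of \<open>f(T) - s\<close>.\<close>

lemma rspec_cfc:
  assumes "continuous_on (rspec T) f" "s \<in> rspec (cfc f T)"
  shows "s \<in> f ` rspec T"
proof (rule ccontr)
  assume no: "s \<notin> f ` rspec T"
  define h where "h = (\<lambda>t. inverse (f t - s))"
  have ne: "f t - s \<noteq> 0" if "t \<in> rspec T" for t using no that by auto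
  have fs: "continuous_on (rspec T) (\<lambda>t. f t - s)"
    by (intro continuous_intros assms)
  have h: "continuous_on (rspec T) h"
    unfolding h_def using ne by (intro continuous_on_inverse fs) auto
  have "cfc (\<lambda>t. f t - s) T * cfc h T = cfc (\<lambda>_. 1) T"
    unfolding cfc_mult[OF fs h, symmetric] using ne by (intro cfc_cong) (simp add: h_def)
  moreover have "cfc (\<lambda>t. f t - s) T = cfc f T - s *\<^sub>R 1"
    using assms(1) by (simp add: cfc_diff T)
  ultimately have "(cfc f T - s *\<^sub>R 1) * cfc h T = 1" "cfc h T * (cfc f T - s *\<^sub>R 1) = 1"
    using cfc_commute[OF fs h] by (simp_all add: T)
  with assms(2) show False
    unfolding rspec_iff invertible_op_def by blast
qed

lemma cfc_compose:
  assumes h: "continuous_on (rspec T) h" and f: "continuous_on (h ` rspec T) f"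
  shows "cfc f (cfc h T) = cfc (\<lambda>t. f (h t)) T"
proof -
  have fh: "continuous_on (rspec T) (\<lambda>t. f (h t))"
    by (rule continuous_on_compose2[OF f h]) auto
  have "compact (h ` rspec T)"
    by (intro compact_continuous_image h compact_rspec T)
  from poly_approximation[OF this f] obtain p
    where p: "uniform_limit (h ` rspec T) (\<lambda>n. poly (p n)) f sequentially" by blast
  have ph: "continuous_on (rspec T) (\<lambda>t. poly q (h t))" for q
    by (intro continuous_intros h)
  have poly: "poly_op q (cfc h T) = cfc (\<lambda>t. poly q (h t)) T" for q
  proof (induction q)
    case (pCons a q)
    have "cfc (\<lambda>t. a + h t * poly q (h t)) T = a *\<^sub>R 1 + cfc h T * cfc (\<lambda>t. poly q (h t)) T"
      using h ph by (simp add: cfc_add cfc_mult continuous_on_mult T)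
    then show ?case by (simp add: pCons.IH)
  qed (simp add: T)
  show ?thesis
  proof (rule cfc_eqI[OF selfadj_cfc[OF h]])
    show "uniform_limit (rspec (cfc h T)) (\<lambda>n. poly (p n)) f sequentially"
      by (rule uniform_limit_on_subset[OF p]) (use rspec_cfc[OF h] in blast)
    show "(\<lambda>n. poly_op (p n) (cfc h T)) \<longlonglongrightarrow> cfc (\<lambda>t. f (h t)) T"
    proof (rule tendstoI)
      fix e :: real assume "0 < e"
      then have "\<forall>\<^sub>F n in sequentially. \<forall>t\<in>h ` rspec T. dist (poly (p n) t) (f t) < e / 2"
        by (intro uniform_limitD[OF p]) simp
      then show "\<forall>\<^sub>F n in sequentially. dist (poly_op (p n) (cfc h T)) (cfc (\<lambda>t. f (h t)) T) < e"
      proof eventually_elim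
        case (elim n)
        have "norm (cfc (\<lambda>t. poly (p n) (h t) - f (h t)) T) \<le> e / 2"
          using elim \<open>0 < e\<close> by (intro norm_cfc_le continuous_on_diff ph fh)
            (auto simp: dist_real_def less_imp_le)
        then show ?case
          using \<open>0 < e\<close> by (simp add: dist_norm poly cfc_diff[OF ph fh])
      qed
    qed
  qed
qed

end


section \<open>Positive operators and connections\<close>

lemma cfc_conj:
  assumes "selfadj T" "continuous_on (rspec T) f" "continuous_on (rspec T) h"
  shows "cfc f T * cfc h T * cfc f T = cfc (\<lambda>t. f t * h t * f t) T"
  using assms by (simp add: cfc_mult continuous_on_mult)

lemma rspec_positive_subset: "0 \<le> T \<Longrightarrow> rspec T \<subseteq> {0..}"
  using rspec_nonneg by auto

lemma continuous_on_rspec_positive: "0 \<le> T \<Longrightarrow> continuous_on {0..} f \<Longrightarrow> continuous_on (rspec T) f"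
  using rspec_positive_subset continuous_on_subset by blast

lemma invertible_add_scaleR_one:
  assumes "0 \<le> T" "0 < r"
  shows "invertible_op (T + r *\<^sub>R 1)"
  using assms by (intro coercive_invertible[of r])
    (auto simp: positive_op_iff inner_left_distrib power2_norm_eq_inner)

lemma positive_op_inverse:
  fixes C D :: "'a :: complex_hilbert_space bop"
  assumes "0 \<le> C" "C * D = 1"
  shows "0 \<le> D"
proof -
  have CD: "bop_apply C (bop_apply D x) = x" for x
    using assms(2) by (metis bop_apply_simps(4,7))
  have "inner (bop_apply D x) y = inner x (bop_apply D y)" for x y
    using selfadjD[OF positive_selfadj[OF assms(1)], of "bop_apply D x" "bop_apply D y"]
    by (simp add: CD)
  moreover have "0 \<le> inner (bop_apply D x) x" for x
    using assms(1) CD[of x] unfolding positive_op_iff by (metis inner_commute)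
  ultimately show ?thesis by (simp add: positive_op_iff selfadj_def)
qed

lemma decreases_to_const: "decreases_to (\<lambda>_. A) A"
  by (simp add: decreases_to_def decseq_def)

lemma decreases_to_add_scaleR:
  assumes "0 \<le> R"
  shows "decreases_to (\<lambda>n. S + (1 / real (Suc n)) *\<^sub>R R) S"
  unfolding decreases_to_def
proof (intro conjI allI)
  show "decseq (\<lambda>n. S + (1 / real (Suc n)) *\<^sub>R R)"
  proof (rule decseq_SucI)
    fix n
    have "0 \<le> (1 / real (Suc n) - 1 / real (Suc (Suc n))) *\<^sub>R R"
      by (intro scaleR_bop_nonneg assms) (simp add: field_simps)
    then show "S + (1 / real (Suc (Suc n))) *\<^sub>R R \<le> S + (1 / real (Suc n)) *\<^sub>R R"
      by (simp add: scaleR_diff_left)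
  qed
  fix x
  have "(\<lambda>n. 1 / real (Suc n)) \<longlonglongrightarrow> 0"
    using LIMSEQ_inverse_real_of_nat by (simp add: inverse_eq_divide)
  then have "(\<lambda>n. bop_apply S x + (1 / real (Suc n)) *\<^sub>R bop_apply R x)
      \<longlonglongrightarrow> bop_apply S x + 0 *\<^sub>R bop_apply R x"
    by (intro tendsto_intros)
  then show "(\<lambda>n. bop_apply (S + (1 / real (Suc n)) *\<^sub>R R) x) \<longlonglongrightarrow> bop_apply S x"
    by simp
qed

lemma decreases_to_unique:
  assumes "decreases_to X S" "decreases_to X T"
  shows "S = T"
  using assms LIMSEQ_unique unfolding decreases_to_def by (intro bop_eqI) blast

section \<open>Consequences of the connection axioms\<close>

context
  fixes \<tau> :: "'a :: complex_hilbert_space bop \<Rightarrow> 'a bop \<Rightarrow> 'a bop"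
  assumes conn: "connection \<tau>"
begin

lemma connection_nonneg: "0 \<le> A \<Longrightarrow> 0 \<le> B \<Longrightarrow> 0 \<le> \<tau> A B"
  using conn by (simp add: connection_def)

lemma connection_mono: "0 \<le> A \<Longrightarrow> 0 \<le> B \<Longrightarrow> A \<le> C \<Longrightarrow> B \<le> D \<Longrightarrow> \<tau> A B \<le> \<tau> C D"
  using conn unfolding connection_def by (meson order_trans)

lemma connection_conj_le:
  "0 \<le> A \<Longrightarrow> 0 \<le> B \<Longrightarrow> 0 \<le> C \<Longrightarrow> C * \<tau> A B * C \<le> \<tau> (C * A * C) (C * B * C)"
  using conn by (simp add: connection_def)

lemma connection_decreasing:
  assumes "\<And>n. 0 \<le> An n" "\<And>n. 0 \<le> Bn n" "0 \<le> A" "0 \<le> B"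
    and "decreases_to An A" "decreases_to Bn B"
  shows "decreases_to (\<lambda>n. \<tau> (An n) (Bn n)) (\<tau> A B)"
  using conn assms by (simp add: connection_def)

text \<open>The reverse inequality is (M2) for the inverse of \<open>C\<close>, conjugated back by
  \<open>C\<close>.\<close>

lemma connection_conj:
  assumes "0 \<le> A" "0 \<le> B" "0 \<le> C" "invertible_op C"
  shows "C * \<tau> A B * C = \<tau> (C * A * C) (C * B * C)"
proof (rule antisym)
  show "C * \<tau> A B * C \<le> \<tau> (C * A * C) (C * B * C)"
    by (rule connection_conj_le) fact+
  obtain D where D: "D * C = 1" "C * D = 1"
    using assms(4) by (auto simp: invertible_op_def)
  then have D0: "0 \<le> D" using positive_op_inverse[OF assms(3)] by blast
  have cancel: "D * (C * Z * C) * D = Z" "C * (D * Z * D) * C = Z" for Z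
    by (metis D mult.assoc mult_1_left mult_1_right)+
  have "D * \<tau> (C * A * C) (C * B * C) * D \<le> \<tau> A B"
    using connection_conj_le[of "C * A * C" "C * B * C" D] assms D0
    by (simp add: cancel conj_nonneg positive_selfadj)
  from conj_mono[OF positive_selfadj[OF assms(3)] this]
  show "\<tau> (C * A * C) (C * B * C) \<le> C * \<tau> A B * C"
    by (simp only: cancel)
qed

text \<open>For invertible \<open>E\<close>, conjugation by its square root carries the scalar
  identity over. A general \<open>E\<close> is a decreasing limit of invertible operators, where
  (M3) applies.\<close>

lemma connection_scaleR:
  assumes E: "0 \<le> E" and y: "0 \<le> y" and r: "\<tau> 1 (y *\<^sub>R 1) = r *\<^sub>R 1" and "0 \<le> r"
  shows "\<tau> E (y *\<^sub>R E) = r *\<^sub>R E"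
proof -
  have inv: "\<tau> E (y *\<^sub>R E) = r *\<^sub>R E" if "0 \<le> E" "invertible_op E" for E
  proof -
    define C where "C = cfc sqrt E"
    have sa: "selfadj E" using that(1) by (rule positive_selfadj)
    have sqrt: "continuous_on (rspec E) sqrt"
      by (intro continuous_intros)
    have C: "0 \<le> C"
      unfolding C_def using rspec_nonneg[OF that(1)] by (intro cfc_nonneg sa sqrt) simp
    have "C * C = cfc (\<lambda>t. t) E"
      unfolding C_def cfc_mult[OF sa sqrt sqrt, symmetric]
      using rspec_nonneg[OF that(1)] by (intro cfc_cong) simp
    then have CC: "C * C = E" using sa by simp
    then have "invertible_op C"
      using that(2) invertible_op_commuting_factor[of C C] by simp
    from connection_conj[OF _ _ C this, of 1 "y *\<^sub>R 1"] show ?thesis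
      using y by (simp add: r CC scaleR_bop_nonneg)
  qed
  let ?E = "\<lambda>n. E + (1 / real (Suc n)) *\<^sub>R 1"
  have E0: "0 \<le> ?E n" for n
    using E by (simp add: scaleR_bop_nonneg)
  \<comment> \<open>Both arguments move: the second is \<open>y *\<^sub>R ?E n\<close>, written in
    the shape of \<open>decreases_to_add_scaleR\<close>.\<close>
  have "decreases_to (\<lambda>n. \<tau> (?E n) (y *\<^sub>R E + (1 / real (Suc n)) *\<^sub>R (y *\<^sub>R 1))) (\<tau> E (y *\<^sub>R E))"
    using E y E0 by (intro connection_decreasing decreases_to_add_scaleR)
      (simp_all add: scaleR_bop_nonneg)
  moreover have "\<tau> (?E n) (y *\<^sub>R E + (1 / real (Suc n)) *\<^sub>R (y *\<^sub>R 1))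
      = r *\<^sub>R E + (1 / real (Suc n)) *\<^sub>R (r *\<^sub>R 1)" for n
    using inv[OF E0 invertible_add_scaleR_one[OF E]]
    by (simp add: scaleR_add_right mult.commute)
  ultimately have "decreases_to (\<lambda>n. r *\<^sub>R E + (1 / real (Suc n)) *\<^sub>R (r *\<^sub>R 1)) (\<tau> E (y *\<^sub>R E))"
    by simp
  moreover have "decreases_to (\<lambda>n. r *\<^sub>R E + (1 / real (Suc n)) *\<^sub>R (r *\<^sub>R 1)) (r *\<^sub>R E)"
    using \<open>0 \<le> r\<close> by (intro decreases_to_add_scaleR scaleR_bop_nonneg) simp_all
  ultimately show ?thesis by (rule decreases_to_unique)
qed

end

lemma connection_transpose_conn:
  assumes "connection \<sigma>"
  shows "connection (transpose_conn \<sigma>)"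
  unfolding connection_def transpose_conn_def
proof (intro conjI allI impI)
  show "0 \<le> \<sigma> B A" if "0 \<le> A" "0 \<le> B" for A B
    using connection_nonneg[OF assms] that by blast
  show "\<sigma> B A \<le> \<sigma> D C" if "0 \<le> A" "0 \<le> B" "A \<le> C" "B \<le> D" for A B C D
    using connection_mono[OF assms] that by blast
  show "C * \<sigma> B A * C \<le> \<sigma> (C * B * C) (C * A * C)" if "0 \<le> A" "0 \<le> B" "0 \<le> C" for A B C
    using connection_conj_le[OF assms] that by blast
  show "decreases_to (\<lambda>n. \<sigma> (Bn n) (An n)) (\<sigma> B A)"
    if "\<forall>n. 0 \<le> An n" "\<forall>n. 0 \<le> Bn n" "0 \<le> A" "0 \<le> B"
      "decreases_to An A" "decreases_to Bn B" for An Bn A B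
    using connection_decreasing[OF assms, of Bn An B A] that by blast
qed


section \<open>The representing function on operators\<close>

text \<open>A trapezoid around \<open>a\<close>: height 1 up to distance \<open>r\<close>, linear
  descent, zero from distance \<open>2 * r\<close> on.\<close>

definition bump :: "real \<Rightarrow> real \<Rightarrow> real \<Rightarrow> real" where
  "bump a r t = max 0 (min 1 (2 - \<bar>t - a\<bar> / r))"

lemma bump_bounds: "0 \<le> bump a r t" "bump a r t \<le> 1"
  by (simp_all add: bump_def)

lemma bump_eq_1: "0 < r \<Longrightarrow> \<bar>t - a\<bar> \<le> r \<Longrightarrow> bump a r t = 1"
  by (simp add: bump_def)

lemma bump_eq_0: "0 < r \<Longrightarrow> 2 * r \<le> \<bar>t - a\<bar> \<Longrightarrow> bump a r t = 0"
  by (simp add: bump_def field_simps)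

lemma continuous_on_bump [continuous_intros]: "r \<noteq> 0 \<Longrightarrow> continuous_on S (bump a r)"
  unfolding bump_def by (intro continuous_intros) auto

text \<open>A piecewise linear partition of unity on \<open>[0, N\<delta>]\<close>, subordinate to the intervals
  \<open>[(i-1)\<delta>, (i+1)\<delta>]\<close>; the telescoping form makes the sum immediate.\<close>

definition hat :: "real \<Rightarrow> nat \<Rightarrow> real \<Rightarrow> real" where
  "hat \<delta> i t = max 0 (min 1 (t / \<delta> - real i + 1)) - max 0 (min 1 (t / \<delta> - real (Suc i) + 1))"

lemma hat_bounds: "0 \<le> hat \<delta> i t" "hat \<delta> i t \<le> 1"
  by (simp_all add: hat_def max_def min_def)

lemma hat_eq_0:
  assumes "0 < \<delta>" "\<delta> \<le> \<bar>t - real i * \<delta>\<bar>"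
  shows "hat \<delta> i t = 0"
proof -
  have "t = t / \<delta> * \<delta>" using assms(1) by simp
  then have "\<bar>t - real i * \<delta>\<bar> = \<bar>t / \<delta> - real i\<bar> * \<delta>"
    using assms(1) by (metis abs_mult abs_of_pos left_diff_distrib)
  with assms have "1 \<le> \<bar>t / \<delta> - real i\<bar>" by simp
  then show ?thesis by (auto simp: hat_def max_def min_def)
qed

lemma sum_hat:
  assumes "0 < \<delta>" "0 \<le> t" "t \<le> real N * \<delta>"
  shows "(\<Sum>i\<le>N. hat \<delta> i t) = 1"
proof -
  have "0 \<le> t / \<delta>" "t / \<delta> \<le> real N" using assms by (simp_all add: field_simps)
  \<comment> \<open>The two remaining ends are \<open>t / \<delta> + 1\<close> and
    \<open>t / \<delta> - N\<close>, clipped to 1 and to 0.\<close>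
  then show ?thesis unfolding hat_def by (subst sum_telescope) auto
qed

lemma continuous_on_hat [continuous_intros]: "\<delta> \<noteq> 0 \<Longrightarrow> continuous_on S (hat \<delta> i)"
  unfolding hat_def by (intro continuous_intros) auto

lemma sum_near_diagonal_le:
  fixes a :: "nat \<Rightarrow> real"
  assumes "\<And>j. 0 \<le> a j"
  shows "(\<Sum>j\<le>N. \<Sum>i\<le>N. if i \<le> Suc j \<and> j \<le> Suc i then a j else 0) \<le> 3 * (\<Sum>j\<le>N. a j)"
  unfolding sum_distrib_left
proof (rule sum_mono)
  fix j
  have "(\<Sum>i\<le>N. if i \<le> Suc j \<and> j \<le> Suc i then a j else 0)
      = (\<Sum>i\<in>{i\<in>{..N}. i \<le> Suc j \<and> j \<le> Suc i}. a j)"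
    by (subst sum.inter_filter) simp_all
  \<comment> \<open>At \<open>j = 0\<close> the truncated \<open>j - 1\<close> merely repeats
    \<open>j\<close>.\<close>
  also have "\<dots> \<le> (\<Sum>i\<in>{j - 1, j, Suc j}. a j)"
    using assms by (intro sum_mono2) auto
  also have "\<dots> \<le> 3 * a j"
  proof -
    have "real (card {j - 1, j, Suc j}) \<le> 3"
      by (simp add: card_insert_if)
    then show ?thesis using assms[of j] by (simp add: mult_right_mono)
  qed
  finally show "(\<Sum>i\<le>N. if i \<le> Suc j \<and> j \<le> Suc i then a j else 0) \<le> 3 * a j" .
qed

lemma representing_nonneg: "representing_function \<tau> g \<Longrightarrow> 0 \<le> y \<Longrightarrow> 0 \<le> g y"
  by (simp add: representing_function_def operator_monotone_def)

lemma representing_continuous: "representing_function \<tau> g \<Longrightarrow> continuous_on {0..} g"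
  by (simp add: representing_function_def operator_monotone_def)

lemma connection_commuting_scaleR:
  assumes "connection \<tau>" "representing_function \<tau> g" "0 \<le> E" "0 \<le> y"
  shows "\<tau> E (y *\<^sub>R E) = g y *\<^sub>R E"
proof (rule connection_scaleR[OF assms(1,3,4)])
  show "\<tau> 1 (y *\<^sub>R 1) = g y *\<^sub>R 1"
    using assms(2,4) by (simp add: representing_function_def)
  show "0 \<le> g y" using assms(2,4) by (rule representing_nonneg)
qed

section \<open>Compressions by functions of a fixed positive operator\<close>

context
  fixes Y :: "'a :: complex_hilbert_space bop"
  assumes Y: "0 \<le> Y"
begin

lemma cfc_conj_self:
  assumes "continuous_on (rspec Y) c"
  shows "cfc c Y * Y * cfc c Y = cfc (\<lambda>t. c t * t * c t) Y"
  using cfc_conj[OF positive_selfadj[OF Y] assms, of "\<lambda>t. t"] positive_selfadj[OF Y] by (simp add: continuous_on_id)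

lemma cfc_conj_one:
  assumes "continuous_on (rspec Y) c"
  shows "cfc c Y * 1 * cfc c Y = cfc (\<lambda>t. c t * c t) Y"
  using cfc_mult[OF positive_selfadj[OF Y] assms assms] by simp

lemma cfc_le_self:
  assumes "continuous_on (rspec Y) c" "\<And>t. t \<in> rspec Y \<Longrightarrow> c t \<le> t"
  shows "cfc c Y \<le> Y"
  using cfc_mono[OF positive_selfadj[OF Y] assms(1), of "\<lambda>t. t"] assms(2) positive_selfadj[OF Y]
  by (simp add: continuous_on_id)

lemma cfc_le_one:
  assumes "continuous_on (rspec Y) c" "\<And>t. t \<in> rspec Y \<Longrightarrow> c t \<le> 1"
  shows "cfc c Y \<le> 1"
  using cfc_mono[OF positive_selfadj[OF Y] assms(1), of "\<lambda>t. 1"] assms(2) positive_selfadj[OF Y]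
  by simp

end

context
  fixes \<tau> :: "'a :: complex_hilbert_space bop \<Rightarrow> 'a bop \<Rightarrow> 'a bop" and g :: "real \<Rightarrow> real"
    and Y :: "'a bop"
  assumes conn: "connection \<tau>" and rep: "representing_function \<tau> g" and Y: "0 \<le> Y"
begin

text \<open>After (M2), monotonicity applies: \<open>c(Y)\<close> commutes with \<open>Y\<close>, so
  compression lowers both arguments, as \<open>c\<^sup>2 \<le> 1\<close> and
  \<open>t c\<^sup>2 \<le> t\<close> on the spectrum.\<close>

lemma connection_conj_cfc_le:
  assumes c: "continuous_on (rspec Y) c" and c01: "\<And>t. t \<in> rspec Y \<Longrightarrow> 0 \<le> c t \<and> c t \<le> 1"
  shows "cfc c Y * \<tau> 1 Y * cfc c Y \<le> \<tau> 1 Y"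
proof -
  have t0: "0 \<le> t" if "t \<in> rspec Y" for t using rspec_nonneg[OF Y that] .
  have C: "0 \<le> cfc c Y" using c01 by (intro cfc_nonneg positive_selfadj[OF Y] c) auto
  have cc: "c t * c t \<le> 1" if "t \<in> rspec Y" for t
    using c01[OF that] by (simp add: mult_le_one)
  have "cfc c Y * \<tau> 1 Y * cfc c Y \<le> \<tau> (cfc c Y * 1 * cfc c Y) (cfc c Y * Y * cfc c Y)"
    by (rule connection_conj_le[OF conn one_bop_nonneg Y C])
  also have "\<dots> \<le> \<tau> 1 Y"
  proof (rule connection_mono[OF conn])
    show "0 \<le> cfc c Y * 1 * cfc c Y" "0 \<le> cfc c Y * Y * cfc c Y"
      by (rule conj_nonneg[OF positive_selfadj[OF C]], rule one_bop_nonneg Y)+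
    show "cfc c Y * 1 * cfc c Y \<le> 1"
      unfolding cfc_conj_one[OF Y c] using cc by (intro cfc_le_one[OF Y] continuous_intros c)
    show "cfc c Y * Y * cfc c Y \<le> Y"
      unfolding cfc_conj_self[OF Y c]
    proof (intro cfc_le_self[OF Y] continuous_intros c)
      fix t assume t: "t \<in> rspec Y"
      have "(c t * c t) * t \<le> 1 * t" by (intro mult_right_mono cc t t0)
      then show "c t * t * c t \<le> t" by (simp add: mult_ac)
    qed
  qed
  finally show ?thesis .
qed

text \<open>(M2) leads to the arguments \<open>c(Y)\<^sup>2\<close> and
  \<open>Y c(Y)\<^sup>2\<close>. The latter is at most \<open>y c(Y)\<^sup>2\<close>, and on
  proportional arguments the connection is known.\<close>

lemma connection_upper_local:
  assumes c: "continuous_on (rspec Y) c" and c0: "\<And>t. t \<in> rspec Y \<Longrightarrow> 0 \<le> c t"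
    and y: "0 \<le> y" "\<And>t. t \<in> rspec Y \<Longrightarrow> c t \<noteq> 0 \<Longrightarrow> t \<le> y"
  shows "cfc c Y * \<tau> 1 Y * cfc c Y \<le> g y *\<^sub>R cfc (\<lambda>t. c t * c t) Y"
proof -
  have C: "0 \<le> cfc c Y" using c0 by (intro cfc_nonneg positive_selfadj[OF Y] c) auto
  have cc: "continuous_on (rspec Y) (\<lambda>t. c t * c t)" by (intro continuous_intros c)
  have CC: "0 \<le> cfc (\<lambda>t. c t * c t) Y" by (intro cfc_nonneg positive_selfadj[OF Y] cc) simp
  have "cfc c Y * \<tau> 1 Y * cfc c Y \<le> \<tau> (cfc c Y * 1 * cfc c Y) (cfc c Y * Y * cfc c Y)"
    by (rule connection_conj_le[OF conn one_bop_nonneg Y C])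
  also have "\<dots> \<le> \<tau> (cfc (\<lambda>t. c t * c t) Y) (y *\<^sub>R cfc (\<lambda>t. c t * c t) Y)"
  proof (rule connection_mono[OF conn])
    show "0 \<le> cfc c Y * 1 * cfc c Y" "0 \<le> cfc c Y * Y * cfc c Y"
      by (rule conj_nonneg[OF positive_selfadj[OF C]], rule one_bop_nonneg Y)+
    show "cfc c Y * 1 * cfc c Y \<le> cfc (\<lambda>t. c t * c t) Y"
      unfolding cfc_conj_one[OF Y c] by simp
    show "cfc c Y * Y * cfc c Y \<le> y *\<^sub>R cfc (\<lambda>t. c t * c t) Y"
      unfolding cfc_conj_self[OF Y c] cfc_scaleR[OF positive_selfadj[OF Y] cc, symmetric]
    proof (intro cfc_mono positive_selfadj[OF Y] continuous_intros c)
      fix t assume t: "t \<in> rspec Y"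
      show "c t * t * c t \<le> y * (c t * c t)"
      proof (cases "c t = 0")
        case False
        then have "t * (c t * c t) \<le> y * (c t * c t)"
          using y(2)[OF t] by (intro mult_right_mono) auto
        then show ?thesis by (simp add: mult_ac)
      qed simp
    qed
  qed
  also have "\<dots> = g y *\<^sub>R cfc (\<lambda>t. c t * c t) Y"
    by (rule connection_commuting_scaleR[OF conn rep CC y(1)])
  finally show ?thesis .
qed

text \<open>(M2) bounds a compression from above only. For the lower bound, the known value at the
  pair \<open>f(Y)\<^sup>2\<close>, \<open>z f(Y)\<^sup>2\<close>, which lies below the pair
  \<open>1\<close>, \<open>Y\<close>, is compressed by \<open>c(Y)\<close>; there \<open>f\<close>
  equals 1 and drops out.\<close>

lemma connection_lower_local:
  fixes c f :: "real \<Rightarrow> real"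
  assumes c: "continuous_on (rspec Y) c" and f: "continuous_on (rspec Y) f"
    and f01: "\<And>t. t \<in> rspec Y \<Longrightarrow> 0 \<le> f t \<and> f t \<le> 1"
    and f1: "\<And>t. t \<in> rspec Y \<Longrightarrow> c t \<noteq> 0 \<Longrightarrow> f t = 1"
    and z: "0 \<le> z" "\<And>t. t \<in> rspec Y \<Longrightarrow> f t \<noteq> 0 \<Longrightarrow> z \<le> t"
  shows "g z *\<^sub>R cfc (\<lambda>t. c t * c t) Y \<le> cfc c Y * \<tau> 1 Y * cfc c Y"
proof -
  have ff: "continuous_on (rspec Y) (\<lambda>t. f t * f t)" by (intro continuous_intros f)
  have FF: "0 \<le> cfc (\<lambda>t. f t * f t) Y" by (intro cfc_nonneg positive_selfadj[OF Y] ff) simp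
  have "g z *\<^sub>R cfc (\<lambda>t. f t * f t) Y = \<tau> (cfc (\<lambda>t. f t * f t) Y) (z *\<^sub>R cfc (\<lambda>t. f t * f t) Y)"
    by (rule connection_commuting_scaleR[OF conn rep FF z(1), symmetric])
  also have "\<dots> \<le> \<tau> 1 Y"
  proof (rule connection_mono[OF conn FF])
    show "0 \<le> z *\<^sub>R cfc (\<lambda>t. f t * f t) Y" by (intro scaleR_bop_nonneg FF z)
    show "cfc (\<lambda>t. f t * f t) Y \<le> 1"
      using f01 by (intro cfc_le_one[OF Y] ff) (simp add: mult_le_one)
    show "z *\<^sub>R cfc (\<lambda>t. f t * f t) Y \<le> Y"
      unfolding cfc_scaleR[OF positive_selfadj[OF Y] ff, symmetric]
    proof (intro cfc_le_self[OF Y] continuous_intros f)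
      fix t assume t: "t \<in> rspec Y"
      show "z * (f t * f t) \<le> t"
      proof (cases "f t = 0")
        case False
        have "z * (f t * f t) \<le> z * 1"
          using f01[OF t] z(1) by (intro mult_left_mono) (auto simp: mult_le_one)
        then show ?thesis using z(2)[OF t False] by simp
      qed (use rspec_nonneg[OF Y t] in simp)
    qed
  qed
  finally have "g z *\<^sub>R cfc (\<lambda>t. f t * f t) Y \<le> \<tau> 1 Y" .
  from conj_mono[OF selfadj_cfc[OF positive_selfadj[OF Y] c] this]
  have "g z *\<^sub>R (cfc c Y * cfc (\<lambda>t. f t * f t) Y * cfc c Y) \<le> cfc c Y * \<tau> 1 Y * cfc c Y"
    by simp
  moreover have "cfc c Y * cfc (\<lambda>t. f t * f t) Y * cfc c Y = cfc (\<lambda>t. c t * c t) Y"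
    unfolding cfc_conj[OF positive_selfadj[OF Y] c ff] using f1 by (intro cfc_cong) fastforce
  ultimately show ?thesis by simp
qed

text \<open>With \<open>T = \<tau> 1 Y\<close>, compressing by \<open>1 - sK\<close> gives \<open>s(KT + TK) \<ge> s\<^sup>2KTK \<ge> 0\<close>; the quadratic form
  of \<open>KT + TK\<close> vanishes on the range of \<open>H\<close>, so \<open>KT + TK\<close> does too.\<close>

lemma connection_disjoint_supports:
  assumes k: "continuous_on (rspec Y) k" and h: "continuous_on (rspec Y) h"
    and k0: "\<And>t. t \<in> rspec Y \<Longrightarrow> 0 \<le> k t"
    and kh: "\<And>t. t \<in> rspec Y \<Longrightarrow> k t * h t = 0"
  shows "cfc k Y * \<tau> 1 Y * cfc h Y = 0"
proof -
  let ?K = "cfc k Y" and ?T = "\<tau> 1 Y"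
  have "bounded (k ` rspec Y)"
    by (intro compact_imp_bounded compact_continuous_image k compact_rspec positive_selfadj[OF Y])
  then obtain M where M: "0 < M" "\<And>t. t \<in> rspec Y \<Longrightarrow> \<bar>k t\<bar> \<le> M"
    unfolding bounded_pos by auto
  \<comment> \<open>Scaled so that \<open>1 - s k\<close> takes values in [0,1], as
    \<open>connection_conj_cfc_le\<close> requires.\<close>
  define s where "s = 1 / M"
  have s: "0 < s" "\<And>t. t \<in> rspec Y \<Longrightarrow> s * k t \<le> 1"
    using M by (auto simp: s_def field_simps dest: M(2))
  have sk: "continuous_on (rspec Y) (\<lambda>t. s * k t)" by (intro continuous_intros k)
  have "cfc (\<lambda>t. 1 - s * k t) Y * ?T * cfc (\<lambda>t. 1 - s * k t) Y \<le> ?T"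
    using s k0 by (intro connection_conj_cfc_le continuous_intros k) auto
  then have "(1 - s *\<^sub>R ?K) * ?T * (1 - s *\<^sub>R ?K) \<le> ?T"
    by (simp add: cfc_diff[OF positive_selfadj[OF Y] _ sk] cfc_scaleR[OF positive_selfadj[OF Y] k] positive_selfadj[OF Y])
  moreover have "?T - (1 - s *\<^sub>R ?K) * ?T * (1 - s *\<^sub>R ?K)
      = s *\<^sub>R (?K * ?T + ?T * ?K) - (s * s) *\<^sub>R (?K * ?T * ?K)"
    by (simp add: algebra_simps)
  ultimately have "(s * s) *\<^sub>R (?K * ?T * ?K) \<le> s *\<^sub>R (?K * ?T + ?T * ?K)"
    by (metis diff_ge_0_iff_ge)
  moreover have "0 \<le> (s * s) *\<^sub>R (?K * ?T * ?K)"
    using s(1) Y by (intro scaleR_bop_nonneg conj_nonneg selfadj_cfc positive_selfadj[OF Y] k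
        connection_nonneg[OF conn]) auto
  ultimately have "0 \<le> s *\<^sub>R (?K * ?T + ?T * ?K)" by (rule order_trans[rotated])
  from scaleR_bop_nonneg[OF _ this, of "1 / s"]
  have pos: "0 \<le> ?K * ?T + ?T * ?K" using s(1) by simp
  have KH: "?K * cfc h Y = 0"
  proof -
    have "?K * cfc h Y = cfc (\<lambda>t. 0) Y"
      unfolding cfc_mult[OF positive_selfadj[OF Y] k h, symmetric] by (rule cfc_cong) (rule kh)
    then show ?thesis using positive_selfadj[OF Y] by simp
  qed
  show ?thesis
  proof (rule bop_eqI)
    fix x
    let ?v = "bop_apply (cfc h Y) x"
    have Kv: "bop_apply ?K ?v = 0" using KH by (metis bop_apply_simps(4,6))
    have "inner (bop_apply (?K * ?T + ?T * ?K) ?v) ?v = 0"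
      using selfadjD[OF selfadj_cfc[OF positive_selfadj[OF Y] k]]
      by (simp add: Kv bop_linear_simps)
    from positive_op_kernel[OF pos this]
    show "bop_apply (?K * ?T * cfc h Y) x = bop_apply 0 x"
      by (simp add: Kv bop_linear_simps)
  qed
qed

end

text \<open>The bilinear form of the self-adjoint difference \<open>S\<close> is shown to be
  arbitrarily small: \<open>disjoint\<close> removes pairs of distant pieces, and uniform continuity
  of \<open>g\<close> controls neighbouring ones.\<close>

lemma connection_one_eq_cfc:
  fixes Y :: "'a :: complex_hilbert_space bop"
  assumes conn: "connection \<tau>" and rep: "representing_function \<tau> g" and Y: "0 \<le> Y"
  shows "\<tau> 1 Y = cfc g Y"
proof -
  define S where "S = \<tau> 1 Y - cfc g Y"
  have sY: "selfadj Y" by (rule positive_selfadj[OF Y])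
  have cg: "continuous_on (rspec Y) g"
    by (rule continuous_on_rspec_positive[OF Y representing_continuous[OF rep]])
  have S: "selfadj S"
    unfolding S_def using Y
    by (intro selfadj_intros selfadj_cfc sY cg positive_selfadj[OF connection_nonneg[OF conn]]) auto
  have disjoint: "cfc k Y * S * cfc h Y = 0"
    if k: "continuous_on (rspec Y) k" and h: "continuous_on (rspec Y) h"
      and "\<And>t. 0 \<le> k t" "\<And>t. k t * h t = 0" for k h
  proof -
    have "cfc k Y * cfc g Y * cfc h Y = cfc (\<lambda>t. k t * g t * h t) Y"
      using k h cg by (simp add: cfc_mult sY continuous_on_mult)
    also have "(\<lambda>t. k t * g t * h t) = (\<lambda>t. 0)"
      using that(4) by (force simp: fun_eq_iff)
    finally show ?thesis
      unfolding S_def using connection_disjoint_supports[OF conn rep Y k h that(3,4)]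
      by (simp add: algebra_simps sY)
  qed
  have small: "\<bar>inner (bop_apply S u) v\<bar> \<le> \<epsilon> * ((norm u)\<^sup>2 + (norm v)\<^sup>2)" if "0 < \<epsilon>" for \<epsilon> u v
  proof -
    \<comment> \<open>The points at which \<open>g\<close> is compared stay below
      \<open>norm Y + 5\<close>, since centres are at most \<open>norm Y + 1\<close> and the mesh is
      at most 1; 9 leaves room.\<close>
    define L where "L = norm Y + 9"
    have "uniformly_continuous_on {0..L} g"
      by (intro compact_uniformly_continuous continuous_on_subset[OF representing_continuous[OF rep]])
        auto
    \<comment> \<open>Three neighbours and a factor 1/2 from the arithmetic-geometric mean produce
      \<open>3 / 2 * e\<close> in the end, which is below \<epsilon>.\<close>
    moreover define e where "e = \<epsilon> / 2"
    have "0 < e" using that by (simp add: e_def)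
    ultimately obtain d where d: "0 < d"
      "\<And>s t. s \<in> {0..L} \<Longrightarrow> t \<in> {0..L} \<Longrightarrow> dist s t < d \<Longrightarrow> dist (g s) (g t) < e"
      unfolding uniformly_continuous_on_def by meson
    \<comment> \<open>Compared points are less than 12 mesh widths apart, so 20 is ample.\<close>
    define \<delta> where "\<delta> = min 1 (d / 20)"
    have \<delta>: "0 < \<delta>" "\<delta> \<le> 1" "20 * \<delta> \<le> d" using d(1) by (auto simp: \<delta>_def)
    define N where "N = nat \<lceil>norm Y / \<delta>\<rceil>"
    have N: "norm Y \<le> real N * \<delta>" "real N * \<delta> \<le> norm Y + 1"
    proof -
      have "norm Y / \<delta> \<le> real N" "real N \<le> norm Y / \<delta> + 1"
        using \<delta>(1) by (simp_all add: N_def of_nat_ceiling)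
      then show "norm Y \<le> real N * \<delta>" "real N * \<delta> \<le> norm Y + 1"
        using \<delta> by (simp_all add: field_simps)
    qed
    have spec: "0 \<le> t" "t \<le> norm Y" if "t \<in> rspec Y" for t
      using rspec_nonneg[OF Y that] rspec_bounded[OF sY that] by auto
    have osc: "\<bar>g s - g t\<bar> \<le> e" if "0 \<le> s" "s \<le> L" "0 \<le> t" "t \<le> L" "\<bar>s - t\<bar> < 20 * \<delta>" for s t
      using d(2)[of s t] that \<delta>(3) by (simp add: dist_real_def)
    define C where "C i = cfc (hat \<delta> i) Y" for i
    have ch: "continuous_on (rspec Y) (hat \<delta> i)" for i
      using \<delta>(1) by (intro continuous_intros) simp
    have local: "\<bar>inner (bop_apply S (bop_apply (C j) u)) (bop_apply (C i) v)\<bar>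
        \<le> e * (norm (bop_apply (C j) u) * norm (bop_apply (C i) v))"
      if ij: "i \<le> Suc j" "j \<le> Suc i" "j \<le> N" for i j u v
    proof -
      define a where "a = real j * \<delta>"
      have a: "0 \<le> a" "a \<le> norm Y + 1"
      proof -
        have "real j * \<delta> \<le> real N * \<delta>"
          using \<delta>(1) ij(3) by (intro mult_right_mono) auto
        then show "a \<le> norm Y + 1" unfolding a_def using N(2) by (rule order_trans)
        show "0 \<le> a" using \<delta>(1) by (simp add: a_def)
      qed
      \<comment> \<open>The hats at \<open>j\<close> and its neighbours live within
        \<open>2 * \<delta>\<close> of \<open>a\<close>, where \<open>c\<close> is 1. The next bump
        has twice the width, so that it is 1 on the support of \<open>c\<close>.\<close>
      define c where "c = bump a (2 * \<delta>)"
      define f where "f = bump a (4 * \<delta>)"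
      have cc: "continuous_on (rspec Y) c" and cf: "continuous_on (rspec Y) f"
        using \<delta>(1) by (auto simp: c_def f_def intro!: continuous_intros)
      have c_supp: "\<bar>t - a\<bar> < 4 * \<delta>" if "c t \<noteq> 0" for t
        using that bump_eq_0[of "2 * \<delta>" t a] \<delta>(1) by (force simp: c_def)
      have f_supp: "\<bar>t - a\<bar> < 8 * \<delta>" if "f t \<noteq> 0" for t
        using that bump_eq_0[of "4 * \<delta>" t a] \<delta>(1) by (force simp: f_def)
      have f1: "f t = 1" if "c t \<noteq> 0" for t
        using c_supp[OF that] \<delta>(1) by (simp add: f_def bump_eq_1)
      have c1: "c t * hat \<delta> k t = hat \<delta> k t" if "k \<le> Suc j" "j \<le> Suc k" for k t
      proof (cases "hat \<delta> k t = 0")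
        case False
        then have "\<bar>t - real k * \<delta>\<bar> < \<delta>" using hat_eq_0[OF \<delta>(1)] by force
        moreover have "\<bar>real k * \<delta> - a\<bar> \<le> \<delta>"
        proof -
          have "\<bar>real k - real j\<bar> * \<delta> \<le> 1 * \<delta>"
            using that \<delta>(1) by (intro mult_right_mono) auto
          then show ?thesis
            using \<delta>(1) by (simp add: a_def abs_mult left_diff_distrib[symmetric])
        qed
        ultimately have "c t = 1" using \<delta>(1) by (simp add: c_def bump_eq_1)
        then show ?thesis by simp
      qed simp
      have C: "bop_apply (cfc c Y) (bop_apply (C k) x) = bop_apply (C k) x"
        if "k \<le> Suc j" "j \<le> Suc k" for k x
      proof -
        have "cfc c Y * C k = C k"
          unfolding C_def cfc_mult[OF sY cc ch, symmetric] by (rule cfc_cong) (rule c1[OF that])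
        then show ?thesis by (metis bop_apply_simps(4))
      qed
      \<comment> \<open>\<open>cfc c Y\<close> fixes the ranges of \<open>C i\<close> and
        \<open>C j\<close>, so \<open>W\<close> has the same form as \<open>S\<close> there, yet
        sees only a short piece of the spectrum.\<close>
      define W where "W = cfc c Y * S * cfc c Y"
      define E where "E = cfc (\<lambda>t. c t * c t) Y"
      have ccc: "continuous_on (rspec Y) (\<lambda>t. c t * c t)" by (intro continuous_intros cc)
      have gE: "cfc c Y * cfc g Y * cfc c Y = cfc (\<lambda>t. c t * g t * c t) Y"
        by (rule cfc_conj[OF sY cc cg])
      have cgc: "continuous_on (rspec Y) (\<lambda>t. c t * g t * c t)"
        by (intro continuous_intros cc cg)
      have W: "W = cfc c Y * \<tau> 1 Y * cfc c Y - cfc (\<lambda>t. c t * g t * c t) Y"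
        by (simp only: W_def S_def right_diff_distrib left_diff_distrib gE)
      have E1: "e *\<^sub>R E \<le> e *\<^sub>R 1"
        unfolding E_def using \<open>0 < e\<close> bump_bounds
        by (intro scaleR_bop_mono cfc_le_one[OF Y] ccc) (auto simp: c_def mult_le_one)
      have c0: "0 \<le> c t" for t using bump_bounds by (simp add: c_def)
      have f01: "0 \<le> f t \<and> f t \<le> 1" for t using bump_bounds by (simp add: f_def)
      have weight: "\<bar>x - y\<bar> \<le> e \<Longrightarrow> x * (c t * c t) \<le> (y + e) * (c t * c t)" for x y t
        by (intro mult_right_mono) auto
      have "W \<le> e *\<^sub>R 1"
      proof -
        \<comment> \<open>The right end of the support of \<open>c\<close>.\<close>
        define y where "y = a + 4 * \<delta>"
        have y: "0 \<le> y" "y \<le> L" using a \<delta> by (auto simp: y_def L_def)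
        have "cfc c Y * \<tau> 1 Y * cfc c Y \<le> g y *\<^sub>R E"
          unfolding E_def by (rule connection_upper_local[OF conn rep Y cc c0 y(1)])
            (use c_supp in \<open>force simp: y_def\<close>)
        also have "\<dots> \<le> cfc (\<lambda>t. c t * g t * c t + e * (c t * c t)) Y"
          unfolding E_def cfc_scaleR[OF sY ccc, symmetric]
        proof (intro cfc_mono sY continuous_intros cc cg)
          fix t assume t: "t \<in> rspec Y"
          show "g y * (c t * c t) \<le> c t * g t * c t + e * (c t * c t)"
          proof (cases "c t = 0")
            case False
            have "\<bar>g y - g t\<bar> \<le> e"
              using c_supp[OF False] spec[OF t] y \<delta>(1) by (intro osc) (auto simp: y_def L_def)
            from weight[OF this, of t] show ?thesis by (simp add: algebra_simps)
          qed simp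
        qed
        also have "\<dots> = cfc (\<lambda>t. c t * g t * c t) Y + e *\<^sub>R E"
          using cfc_add[OF sY cgc continuous_on_mult[OF continuous_on_const ccc]]
          by (simp add: E_def cfc_scaleR[OF sY ccc])
        finally have "W \<le> e *\<^sub>R E" unfolding W by (simp add: algebra_simps)
        with E1 show ?thesis by (rule order_trans[rotated])
      qed
      moreover have "- (e *\<^sub>R 1) \<le> W"
      proof -
        \<comment> \<open>The left end of the support of \<open>f\<close>, cut off at 0 where
          \<open>g\<close> is no longer controlled.\<close>
        define z where "z = max 0 (a - 8 * \<delta>)"
        have z: "0 \<le> z" "z \<le> L" using a \<delta> by (auto simp: z_def L_def)
        have "cfc (\<lambda>t. c t * g t * c t) Y \<le> cfc (\<lambda>t. (g z + e) * (c t * c t)) Y"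
        proof (intro cfc_mono sY continuous_intros cc cg)
          fix t assume t: "t \<in> rspec Y"
          show "c t * g t * c t \<le> (g z + e) * (c t * c t)"
          proof (cases "c t = 0")
            case False
            have "\<bar>g t - g z\<bar> \<le> e"
              using c_supp[OF False] spec[OF t] z \<delta>(1) a(1)
              by (intro osc) (auto simp: z_def L_def)
            from weight[OF this, of t] show ?thesis by (simp add: mult_ac)
          qed simp
        qed
        also have "\<dots> = g z *\<^sub>R E + e *\<^sub>R E"
          by (simp add: E_def cfc_scaleR[OF sY ccc] scaleR_add_left)
        also have "g z *\<^sub>R E \<le> cfc c Y * \<tau> 1 Y * cfc c Y"
          unfolding E_def
        proof (rule connection_lower_local[OF conn rep Y cc cf f01 f1 z(1)])
          show "z \<le> t" if "t \<in> rspec Y" "f t \<noteq> 0" for t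
            using f_supp[OF that(2)] spec(1)[OF that(1)] by (auto simp: z_def)
        qed
        finally have "- (e *\<^sub>R E) \<le> W" unfolding W by (simp add: algebra_simps)
        moreover have "- (e *\<^sub>R 1) \<le> - (e *\<^sub>R E)" using E1 by simp
        ultimately show ?thesis by (rule order_trans[rotated])
      qed
      moreover have "selfadj W" unfolding W_def by (intro selfadj_conj selfadj_cfc sY cc S)
      ultimately have "\<bar>inner (bop_apply W (bop_apply (C j) u)) (bop_apply (C i) v)\<bar>
          \<le> e * (norm (bop_apply (C j) u) * norm (bop_apply (C i) v))"
        using \<open>0 < e\<close> by (intro selfadj_form_bound) auto
      moreover have "inner (bop_apply W (bop_apply (C j) u)) (bop_apply (C i) v)
          = inner (bop_apply S (bop_apply (C j) u)) (bop_apply (C i) v)"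
        using ij selfadjD[OF selfadj_cfc[OF sY cc]] by (simp add: W_def C)
      ultimately show ?thesis by simp
    qed
    have far: "inner (bop_apply S (bop_apply (C j) u)) (bop_apply (C i) v) = 0"
      if "\<not> (i \<le> Suc j \<and> j \<le> Suc i)" for i j u v
    proof -
      have "hat \<delta> i t * hat \<delta> j t = 0" for t
      proof (rule ccontr)
        assume "hat \<delta> i t * hat \<delta> j t \<noteq> 0"
        then have "\<bar>t - real i * \<delta>\<bar> < \<delta>" "\<bar>t - real j * \<delta>\<bar> < \<delta>"
          using hat_eq_0[OF \<delta>(1)] by force+
        then have "\<bar>real i * \<delta> - real j * \<delta>\<bar> < 2 * \<delta>" by linarith
        moreover have "\<bar>real i * \<delta> - real j * \<delta>\<bar> = \<bar>real i - real j\<bar> * \<delta>"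
          using \<delta>(1) by (simp add: left_diff_distrib[symmetric] abs_mult)
        ultimately have "\<bar>real i - real j\<bar> < 2" using \<delta>(1) by simp
        with that show False by linarith
      qed
      then have "C i * S * C j = 0"
        unfolding C_def using hat_bounds by (intro disjoint ch) auto
      then have "bop_apply (C i) (bop_apply S (bop_apply (C j) u)) = 0"
        by (metis bop_apply_simps(4,6))
      then show ?thesis
        using selfadjD[OF selfadj_cfc[OF sY ch], of i "bop_apply S (bop_apply (C j) u)" v]
        by (simp add: C_def)
    qed
    have decomp: "x = (\<Sum>i\<le>N. bop_apply (C i) x)" for x
    proof -
      have "(\<Sum>i\<le>N. C i) = cfc (\<lambda>t. \<Sum>i\<le>N. hat \<delta> i t) Y"
        unfolding C_def by (rule cfc_sum[OF sY ch, symmetric])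
      also have "\<dots> = cfc (\<lambda>t. 1) Y"
      proof (rule cfc_cong)
        fix t assume "t \<in> rspec Y"
        with spec N(1) show "(\<Sum>i\<le>N. hat \<delta> i t) = 1"
          by (intro sum_hat[OF \<delta>(1)]) (auto intro: order_trans)
      qed
      finally have "(\<Sum>i\<le>N. C i) = 1" using sY by simp
      then have "bop_apply (\<Sum>i\<le>N. C i) x = x" by simp
      then show ?thesis
        using linear_sum[OF bounded_linear.linear[OF bounded_linear_bop_apply_left[of x]], of C "{..N}"]
        by simp
    qed
    \<comment> \<open>A substitute for orthogonality of the pieces: hats between 0 and 1 give
      \<open>C i * C i \<le> C i\<close>, and the \<open>C i\<close> add up to 1.\<close>
    have square_sum: "(\<Sum>i\<le>N. (norm (bop_apply (C i) x))\<^sup>2) \<le> (norm x)\<^sup>2" for x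
    proof -
      have "(norm (bop_apply (C i) x))\<^sup>2 \<le> inner (bop_apply (C i) x) x" for i
      proof -
        have "C i * C i \<le> C i"
          unfolding C_def cfc_mult[OF sY ch ch, symmetric]
          using hat_bounds by (intro cfc_mono sY continuous_intros ch)
            (auto intro: mult_left_le)
        from bop_leD[OF this, of x] show ?thesis
          using selfadjD[OF selfadj_cfc[OF sY ch], of i "bop_apply (C i) x" x]
          by (simp add: C_def power2_norm_eq_inner)
      qed
      then have "(\<Sum>i\<le>N. (norm (bop_apply (C i) x))\<^sup>2) \<le> (\<Sum>i\<le>N. inner (bop_apply (C i) x) x)"
        by (intro sum_mono) simp
      also have "\<dots> = inner (\<Sum>i\<le>N. bop_apply (C i) x) x"
        by (simp add: inner_sum_left)
      also have "\<dots> = (norm x)\<^sup>2"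
        using decomp[of x] by (simp add: power2_norm_eq_inner)
      finally show ?thesis .
    qed
    \<comment> \<open>Splitting each product by the arithmetic-geometric mean separates the double
      sum into one depending on \<open>j\<close> and one depending on \<open>i\<close>, each fit for
      \<open>sum_near_diagonal_le\<close>.\<close>
    define p where "p j = e / 2 * (norm (bop_apply (C j) u))\<^sup>2" for j
    define q where "q i = e / 2 * (norm (bop_apply (C i) v))\<^sup>2" for i
    have pq: "0 \<le> p j" "0 \<le> q j" for j using \<open>0 < e\<close> by (auto simp: p_def q_def)
    have summand: "\<bar>inner (bop_apply S (bop_apply (C j) u)) (bop_apply (C i) v)\<bar>
        \<le> (if i \<le> Suc j \<and> j \<le> Suc i then p j else 0) + (if j \<le> Suc i \<and> i \<le> Suc j then q i else 0)"
      if "j \<le> N" for i j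
    proof (cases "i \<le> Suc j \<and> j \<le> Suc i")
      case True
      have "norm (bop_apply (C j) u) * norm (bop_apply (C i) v)
          \<le> ((norm (bop_apply (C j) u))\<^sup>2 + (norm (bop_apply (C i) v))\<^sup>2) / 2"
        using sum_squares_bound[of "norm (bop_apply (C j) u)" "norm (bop_apply (C i) v)"] by simp
      then have "e * (norm (bop_apply (C j) u) * norm (bop_apply (C i) v)) \<le> p j + q i"
        using mult_left_mono[of _ _ e] \<open>0 < e\<close> by (fastforce simp: p_def q_def algebra_simps)
      with local[of i j u v] True that show ?thesis by simp
    next
      case False
      then show ?thesis using far[of i j u v] by auto
    qed
    have "inner (bop_apply S u) v = (\<Sum>j\<le>N. \<Sum>i\<le>N. inner (bop_apply S (bop_apply (C j) u)) (bop_apply (C i) v))"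
    proof -
      have "inner (bop_apply S u) v
          = inner (bop_apply S (\<Sum>j\<le>N. bop_apply (C j) u)) (\<Sum>i\<le>N. bop_apply (C i) v)"
        using decomp by metis
      then show ?thesis
        by (simp add: linear_sum[OF bounded_linear.linear[OF bounded_linear_bop_apply]]
            inner_sum_left inner_sum_right)
          (rule sum.swap)
    qed
    then have "\<bar>inner (bop_apply S u) v\<bar>
        \<le> (\<Sum>j\<le>N. \<Sum>i\<le>N. \<bar>inner (bop_apply S (bop_apply (C j) u)) (bop_apply (C i) v)\<bar>)"
      by (auto intro!: order_trans[OF sum_abs] sum_mono)
    also have "\<dots> \<le> (\<Sum>j\<le>N. \<Sum>i\<le>N. (if i \<le> Suc j \<and> j \<le> Suc i then p j else 0)
        + (if j \<le> Suc i \<and> i \<le> Suc j then q i else 0))"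
      using summand by (intro sum_mono) auto
    also have "\<dots> = (\<Sum>j\<le>N. \<Sum>i\<le>N. if i \<le> Suc j \<and> j \<le> Suc i then p j else 0)
        + (\<Sum>i\<le>N. \<Sum>j\<le>N. if j \<le> Suc i \<and> i \<le> Suc j then q i else 0)"
      unfolding sum.distrib by (subst (2) sum.swap) simp
    also have "\<dots> \<le> 3 * (\<Sum>j\<le>N. p j) + 3 * (\<Sum>i\<le>N. q i)"
      by (intro add_mono sum_near_diagonal_le pq)
    also have "\<dots> \<le> 3 * (e / 2 * (norm u)\<^sup>2) + 3 * (e / 2 * (norm v)\<^sup>2)"
      unfolding p_def q_def sum_distrib_left[symmetric] using \<open>0 < e\<close>
      by (intro add_mono mult_left_mono square_sum) auto
    also have "\<dots> = 3 / 2 * e * ((norm u)\<^sup>2 + (norm v)\<^sup>2)"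
      by (simp add: algebra_simps)
    also have "\<dots> \<le> \<epsilon> * ((norm u)\<^sup>2 + (norm v)\<^sup>2)"
      using that by (intro mult_right_mono) (auto simp: e_def)
    finally show ?thesis .
  qed
  have "S = 0"
  proof (rule bop_eqI)
    fix u
    let ?v = "bop_apply S u"
    define r where "r = (norm u)\<^sup>2 + (norm ?v)\<^sup>2"
    have "inner ?v ?v \<le> 0"
    proof (rule field_le_epsilon)
      fix \<epsilon> :: real assume "0 < \<epsilon>"
      have "0 \<le> r" by (simp add: r_def)
      \<comment> \<open>Dividing by \<open>r + 1\<close> instead of \<open>r\<close> avoids the case
        \<open>r = 0\<close>.\<close>
      have "inner ?v ?v \<le> \<epsilon> / (r + 1) * r"
        using small[of "\<epsilon> / (r + 1)" u ?v] \<open>0 < \<epsilon>\<close> \<open>0 \<le> r\<close>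
        by (simp add: r_def[symmetric] add_nonneg_pos)
      also have "\<dots> \<le> \<epsilon> / (r + 1) * (r + 1)"
        using \<open>0 < \<epsilon>\<close> \<open>0 \<le> r\<close> by (intro mult_left_mono) auto
      also have "\<dots> = 0 + \<epsilon>" using \<open>0 \<le> r\<close> by simp
      finally show "inner ?v ?v \<le> 0 + \<epsilon>" .
    qed
    then have "?v = 0" by (metis inner_eq_zero_iff inner_ge_zero order_antisym)
    then show "?v = bop_apply 0 u" by simp
  qed
  then show ?thesis by (simp add: S_def)
qed


section \<open>Injectivity of operator monotone functions\<close>

lemma cinner_self: "cinner x x = complex_of_real ((norm x)\<^sup>2)"
  for x :: "'a :: complex_hilbert_space"
proof (rule complex_eqI)
  have "cinner x x = cnj (cinner x x)" by (rule cinner_commute)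
  then show "Im (cinner x x) = Im (complex_of_real ((norm x)\<^sup>2))"
    by (simp add: complex_eq_iff)
qed (simp add: inner_eq_Re_cinner[symmetric] power2_norm_eq_inner)

text \<open>Multiplying \<open>x\<close> by a unit phase makes the inner product real and
  nonnegative, which reduces the claim to the real Cauchy-Schwarz inequality.\<close>

lemma cmod_cinner_le: "cmod (cinner x y) \<le> norm x * norm y"
  for x y :: "'a :: complex_hilbert_space"
proof (cases "cinner x y = 0")
  case False
  define a where "a = cnj (cinner x y) / cmod (cinner x y)"
  have "cmod a = 1" using False by (simp add: a_def norm_divide)
  have "cinner (a *\<^sub>C x) y = cmod (cinner x y)"
    using False complex_norm_square[of "cinner x y"]
    by (simp add: cinner_scaleC_left a_def power2_eq_square field_simps)
  then have "cmod (cinner x y) = inner (a *\<^sub>C x) y"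
    by (simp add: inner_eq_Re_cinner)
  also have "\<dots> \<le> norm (a *\<^sub>C x) * norm y" by (rule norm_cauchy_schwarz)
  finally show ?thesis using \<open>cmod a = 1\<close> by (simp add: norm_scaleC)
qed simp

lemma rank_one_projection:
  fixes q :: "'a :: complex_hilbert_space"
  assumes "norm q = 1"
  obtains R where "selfadj R" "R * R = R" "\<And>x. bop_apply R x = cinner x q *\<^sub>C q"
    "\<And>x. inner (bop_apply R x) x = (cmod (cinner x q))\<^sup>2"
proof -
  have "\<exists>R. \<forall>x. bop_apply R x = cinner x q *\<^sub>C q"
  proof (rule bop_exists)
    show "norm (cinner x q *\<^sub>C q) \<le> 1 * norm x" for x
      using cmod_cinner_le[of x q] assms by (simp add: norm_scaleC)
  qed (simp_all add: cinner_add_left scaleC_add_left cinner_scaleC_left scaleC_scaleC)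
  then obtain R where R: "\<And>x. bop_apply R x = cinner x q *\<^sub>C q" by blast
  have Rxy: "inner (bop_apply R x) y = Re (cinner x q * cnj (cinner y q))" for x y
    by (metis R inner_eq_Re_cinner cinner_scaleC_left cinner_commute)
  have "selfadj R"
    unfolding selfadj_def inner_commute[of _ "bop_apply R _"] Rxy by simp
  moreover have "R * R = R"
    by (rule bop_eqI) (simp add: R cinner_scaleC_left cinner_self assms)
  moreover have "inner (bop_apply R x) x = (cmod (cinner x q))\<^sup>2" for x
    unfolding Rxy using complex_norm_square[of "cinner x q"] by (metis Re_complex_of_real)
  ultimately show ?thesis using R that by blast
qed

text \<open>The spectrum has at most the two points \<alpha> and \<open>\<alpha> + \<beta>\<close>,
  so \<open>f\<close> may be replaced by its linear interpolant there.\<close>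

lemma cfc_scalar_plus_projection:
  assumes "selfadj R" "R * R = R" "\<beta> \<noteq> 0"
  shows "cfc f (\<alpha> *\<^sub>R 1 + \<beta> *\<^sub>R R) = f \<alpha> *\<^sub>R 1 + (f (\<alpha> + \<beta>) - f \<alpha>) *\<^sub>R R"
proof -
  define T where "T = \<alpha> *\<^sub>R 1 + \<beta> *\<^sub>R R"
  have T: "selfadj T" using assms(1) by (simp add: T_def)
  have spec: "t = \<alpha> \<or> t = \<alpha> + \<beta>" if "t \<in> rspec T" for t
  proof (rule ccontr)
    assume *: "\<not> (t = \<alpha> \<or> t = \<alpha> + \<beta>)"
    define c where "c = (t - \<alpha>) * (t - \<alpha> - \<beta>)"
    have "c \<noteq> 0" using * by (simp add: c_def)
    \<comment> \<open>With \<open>u = t - \<alpha>\<close>, idempotence of \<open>R\<close> turns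
      \<open>(\<beta> R - u) (\<beta> R + u - \<beta>)\<close> into the scalar
      \<open>- u (u - \<beta>)\<close>.\<close>
    define D where "D = \<beta> *\<^sub>R R + (t - \<alpha> - \<beta>) *\<^sub>R 1"
    have "T - t *\<^sub>R 1 = \<beta> *\<^sub>R R + (\<alpha> - t) *\<^sub>R 1"
      by (simp add: T_def algebra_simps)
    moreover have "(\<beta> *\<^sub>R R + (\<alpha> - t) *\<^sub>R 1) * D = (- c) *\<^sub>R 1"
      "D * (\<beta> *\<^sub>R R + (\<alpha> - t) *\<^sub>R 1) = (- c) *\<^sub>R 1"
      by (simp_all add: D_def c_def algebra_simps assms(2) scaleR_2[symmetric])
    ultimately have "(T - t *\<^sub>R 1) * ((- 1 / c) *\<^sub>R D) = 1" "((- 1 / c) *\<^sub>R D) * (T - t *\<^sub>R 1) = 1"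
      using \<open>c \<noteq> 0\<close> by simp_all
    then have "invertible_op (T - t *\<^sub>R 1)" unfolding invertible_op_def by blast
    with that show False by (simp add: rspec_iff)
  qed
  define k where "k = (f (\<alpha> + \<beta>) - f \<alpha>) / \<beta>"
  have "cfc f T = cfc (poly [:f \<alpha> - \<alpha> * k, k:]) T"
  proof (rule cfc_cong)
    fix t assume "t \<in> rspec T"
    with spec[OF this] show "f t = poly [:f \<alpha> - \<alpha> * k, k:] t"
      using assms(3) by (auto simp: k_def field_simps)
  qed
  also have "\<dots> = (f \<alpha> - \<alpha> * k) *\<^sub>R 1 + k *\<^sub>R T"
    using cfc_poly[OF T] by simp
  also have "\<dots> = f \<alpha> *\<^sub>R 1 + (k * \<beta>) *\<^sub>R R"
    by (simp add: T_def algebra_simps)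
  also have "k * \<beta> = f (\<alpha> + \<beta>) - f \<alpha>"
    using assms(3) by (simp add: k_def)
  finally show ?thesis by (simp add: T_def)
qed

text \<open>At \<open>s = 0\<close> the inequality holds with the slack \<open>D = m + p - k\<close>
  in the coefficient of \<open>b\<^sup>2\<close>. This slack absorbs the cross term of a tilt, and
  \<open>p\<close> absorbs the new \<open>a\<^sup>2\<close> term.\<close>

lemma tilted_projection_bound:
  fixes p k m :: real
  assumes "0 < p" "0 \<le> k" "k < m + p"
  obtains s c where "0 < s" "0 \<le> c" "s\<^sup>2 + c\<^sup>2 = 1"
    "\<And>a b. 0 \<le> a \<Longrightarrow> 0 \<le> b \<Longrightarrow> k * (s * a + c * b)\<^sup>2 \<le> p * (a\<^sup>2 + b\<^sup>2) + m * b\<^sup>2"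
proof -
  define D where "D = m + p - k"
  have "0 < D" using assms by (simp add: D_def)
  \<comment> \<open>The coefficient of \<open>s\<^sup>2 a\<^sup>2\<close> once the cross term is
    split by Young's inequality.\<close>
  define K where "K = k + k\<^sup>2 / D"
  have "0 \<le> K" using assms(2) \<open>0 < D\<close> by (simp add: K_def)
  \<comment> \<open>Chosen for \<open>K * s\<^sup>2 \<le> p\<close> and \<open>s \<le> 1\<close>;
    the 1 in \<open>K + 1\<close> covers \<open>K = 0\<close>.\<close>
  define s where "s = sqrt (min 1 (p / (K + 1)))"
  define c where "c = sqrt (1 - s\<^sup>2)"
  have s2: "s\<^sup>2 = min 1 (p / (K + 1))"
    using assms(1) \<open>0 \<le> K\<close> by (simp add: s_def)
  have "0 < s" using assms(1) \<open>0 \<le> K\<close> by (simp add: s_def)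
  have c2: "c\<^sup>2 = 1 - s\<^sup>2" "0 \<le> c" using s2 by (simp_all add: c_def)
  have Ks: "K * s\<^sup>2 \<le> p"
  proof -
    have "s\<^sup>2 \<le> p / (K + 1)" by (simp add: s2)
    then have "(K + 1) * s\<^sup>2 \<le> p" using \<open>0 \<le> K\<close> by (simp add: field_simps)
    moreover have "K * s\<^sup>2 \<le> (K + 1) * s\<^sup>2" by (simp add: mult_right_mono)
    ultimately show ?thesis by linarith
  qed
  have main: "k * (s * a + c * b)\<^sup>2 \<le> p * (a\<^sup>2 + b\<^sup>2) + m * b\<^sup>2" if "0 \<le> a" "0 \<le> b" for a b
  proof -
    have "c \<le> 1" using c2 power2_le_imp_le[of c 1] by simp
    then have cb: "c * b \<le> b" using that c2(2) by (simp add: mult_left_le_one_le)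
    have "k * (s * a + c * b)\<^sup>2 \<le> k * (s * a + b)\<^sup>2"
      using cb c2(2) that \<open>0 < s\<close> assms(2) by (intro mult_left_mono power_mono) auto
    also have "\<dots> = k * s\<^sup>2 * a\<^sup>2 + 2 * (k * s * a) * b + k * b\<^sup>2"
      by (simp add: power2_eq_square algebra_simps)
    also have "2 * (k * s * a) * b \<le> (k * s * a)\<^sup>2 / D + D * b\<^sup>2"
    proof -
      have "0 \<le> (k * s * a - D * b)\<^sup>2 / D" using \<open>0 < D\<close> by simp
      also have "\<dots> = (k * s * a)\<^sup>2 / D - 2 * (k * s * a) * b + D * b\<^sup>2"
        using \<open>0 < D\<close> by (simp add: power2_eq_square field_simps)
      finally show ?thesis by simp
    qed
    also have "k * s\<^sup>2 * a\<^sup>2 + ((k * s * a)\<^sup>2 / D + D * b\<^sup>2) + k * b\<^sup>2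
        = (K * s\<^sup>2) * a\<^sup>2 + (D + k) * b\<^sup>2"
      by (simp add: K_def power_mult_distrib algebra_simps)
    also have "\<dots> \<le> p * a\<^sup>2 + (D + k) * b\<^sup>2"
      using Ks by (intro add_right_mono mult_right_mono) auto
    also have "\<dots> = p * (a\<^sup>2 + b\<^sup>2) + m * b\<^sup>2"
      by (simp add: D_def algebra_simps)
    finally show ?thesis by simp
  qed
  show ?thesis using that[OF \<open>0 < s\<close> c2(2) _ main] c2(1) by simp
qed

text \<open>\<open>Q\<close> projects onto \<open>s w + c e\<close>. By Bessel's inequality,
  positivity reduces to the planar bound with the moduli of the two coordinates as \<open>a\<close>
  and \<open>b\<close>. While \<open>R\<close> vanishes at \<open>w\<close>, the form of
  \<open>Q\<close> there is positive.\<close>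

lemma tilted_projection:
  fixes w e :: "'a :: complex_hilbert_space"
  assumes orth: "norm w = 1" "norm e = 1" "cinner w e = 0"
    and "0 < p" "0 \<le> k" "k < m + p"
    and R: "selfadj R" "\<And>x. inner (bop_apply R x) x = (cmod (cinner x e))\<^sup>2"
  obtains s Q where "0 < s" "selfadj Q" "Q * Q = Q"
    "inner (bop_apply Q w) w = s\<^sup>2" "0 \<le> p *\<^sub>R 1 + m *\<^sub>R R - k *\<^sub>R Q"
    "\<And>x. 0 \<le> inner (bop_apply Q x) x"
proof -
  obtain s c where s: "0 < s" "0 \<le> c" "s\<^sup>2 + c\<^sup>2 = 1"
    "\<And>a b. 0 \<le> a \<Longrightarrow> 0 \<le> b \<Longrightarrow> k * (s * a + c * b)\<^sup>2 \<le> p * (a\<^sup>2 + b\<^sup>2) + m * b\<^sup>2"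
    using tilted_projection_bound[OF assms(4-6)] by metis
  have ew: "cinner e w = 0" using orth(3) cinner_commute[of e w] by simp
  define q where "q = complex_of_real s *\<^sub>C w + complex_of_real c *\<^sub>C e"
  have qs: "cinner x q = s * cinner x w + c * cinner x e" for x
    by (simp add: q_def cinner_add_right cinner_scaleC_right)
  have "cinner q q = complex_of_real (s\<^sup>2 + c\<^sup>2)"
    by (simp add: q_def cinner_add_right cinner_scaleC_right cinner_add_left cinner_scaleC_left
        cinner_self[of w] cinner_self[of e] orth ew power2_eq_square)
  then have "(norm q)\<^sup>2 = 1" using s(3) by (metis cinner_self of_real_eq_iff)
  then have "norm q = 1" by (simp add: power2_eq_1_iff) (smt (verit) norm_ge_zero)
  then obtain Q where Q: "selfadj Q" "Q * Q = Q"
    "\<And>x. inner (bop_apply Q x) x = (cmod (cinner x q))\<^sup>2"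
    by (rule rank_one_projection) blast
  have bessel: "(cmod (cinner x w))\<^sup>2 + (cmod (cinner x e))\<^sup>2 \<le> (norm x)\<^sup>2" for x
  proof -
    define u where "u = cinner x w *\<^sub>C w + cinner x e *\<^sub>C e"
    have "cinner u u = cinner x u"
      by (simp add: u_def cinner_add_right cinner_scaleC_right cinner_add_left cinner_scaleC_left
          cinner_self[of w] cinner_self[of e] orth ew)
    moreover have "cinner x u = complex_of_real ((cmod (cinner x w))\<^sup>2 + (cmod (cinner x e))\<^sup>2)"
      by (simp add: u_def cinner_add_right cinner_scaleC_right complex_norm_square mult.commute
          del: of_real_power)
    ultimately have "inner u u = (cmod (cinner x w))\<^sup>2 + (cmod (cinner x e))\<^sup>2"
      "inner x u = (cmod (cinner x w))\<^sup>2 + (cmod (cinner x e))\<^sup>2"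
      by (simp_all add: inner_eq_Re_cinner del: of_real_power of_real_add)
    moreover have "0 \<le> inner (x - u) (x - u)" by simp
    ultimately show ?thesis
      by (simp add: inner_simps inner_commute power2_norm_eq_inner)
  qed
  have "0 \<le> p *\<^sub>R 1 + m *\<^sub>R R - k *\<^sub>R Q"
    unfolding positive_op_iff
  proof (intro conjI allI)
    show "selfadj (p *\<^sub>R 1 + m *\<^sub>R R - k *\<^sub>R Q)" using R(1) Q(1) by simp
    fix x
    let ?a = "cmod (cinner x w)" and ?b = "cmod (cinner x e)"
    have "cmod (cinner x q) \<le> s * ?a + c * ?b"
      unfolding qs using norm_triangle_ineq[of "s * cinner x w" "c * cinner x e"] s(1,2)
      by (simp add: norm_mult)
    then have "k * (cmod (cinner x q))\<^sup>2 \<le> k * (s * ?a + c * ?b)\<^sup>2"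
      using assms(5) by (intro mult_left_mono power_mono) auto
    also have "\<dots> \<le> p * (?a\<^sup>2 + ?b\<^sup>2) + m * ?b\<^sup>2" by (rule s(4)) auto
    also have "\<dots> \<le> p * (norm x)\<^sup>2 + m * ?b\<^sup>2"
      using bessel[of x] \<open>0 < p\<close> by simp
    finally show "0 \<le> inner (bop_apply (p *\<^sub>R 1 + m *\<^sub>R R - k *\<^sub>R Q) x) x"
      by (simp add: inner_left_distrib inner_diff_left R(2) Q(3) power2_norm_eq_inner)
  qed
  moreover have "inner (bop_apply Q w) w = s\<^sup>2"
    using s(1) by (simp add: Q(3) qs cinner_self orth norm_mult)
  moreover have "0 \<le> inner (bop_apply Q x) x" for x by (simp add: Q(3))
  ultimately show ?thesis using that s(1) Q(1,2) by blast
qed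

lemma ell2_orthonormal_pair: "\<exists>w e :: ell2. norm w = 1 \<and> norm e = 1 \<and> cinner w e = 0"
proof -
  define u :: "nat \<Rightarrow> ell2" where "u k = Ell2 (\<lambda>n. if n = k then 1 else 0)" for k
  have nth: "ell2_nth (u k) = (\<lambda>n. if n = k then 1 else 0)" for k
  proof -
    have "summable (\<lambda>n. (cmod (if n = k then 1 else 0))\<^sup>2)"
      by (rule summable_finite[of "{k}"]) auto
    then show ?thesis by (simp add: u_def Ell2_inverse)
  qed
  have c: "cinner (u j) (u k) = (if j = k then 1 else 0)" for j k
  proof -
    have "cinner (u j) (u k) = (\<Sum>n\<in>{j}. ell2_nth (u j) n * cnj (ell2_nth (u k) n))"
      unfolding cinner_ell2.rep_eq by (rule suminf_finite) (auto simp: nth)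
    then show ?thesis by (simp add: nth)
  qed
  have "norm (u k) = 1" for k
    by (simp add: norm_eq_sqrt_inner inner_eq_Re_cinner c)
  then show ?thesis using c by (metis zero_neq_one)
qed

lemma operator_monotone_mono:
  assumes g: "operator_monotone g" and y: "0 \<le> y" "y \<le> z"
  shows "g y \<le> g z"
proof -
  obtain w :: ell2 where w: "norm w = 1" using ell2_orthonormal_pair by blast
  \<comment> \<open>A scalar operator is read as
    \<open>\<alpha> *\<^sub>R 1 + \<beta> *\<^sub>R R\<close> with the zero projection and
    \<open>\<beta> = 1\<close>.\<close>
  have scalar: "cfc g (y *\<^sub>R (1 :: ell2 bop)) = g y *\<^sub>R 1" for y
    using cfc_scalar_plus_projection[of "0 :: ell2 bop" 1 g y] by simp
  have "y *\<^sub>R (1 :: ell2 bop) \<le> z *\<^sub>R 1"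
    using scaleR_bop_nonneg[of "z - y" "1 :: ell2 bop"] y by (simp add: scaleR_diff_left)
  moreover have "0 \<le> y *\<^sub>R (1 :: ell2 bop)" using y(1) by (simp add: scaleR_bop_nonneg)
  ultimately have "g y *\<^sub>R (1 :: ell2 bop) \<le> g z *\<^sub>R 1"
    using g unfolding operator_monotone_def scalar[symmetric] by blast
  from bop_leD[OF this, of w] show ?thesis using w by (simp add: norm_eq_1)
qed

text \<open>If \<open>g a = g b\<close> with \<open>a < b\<close>, perturb the eigenvectors slightly: a rank-one projection tilted
  towards a unit vector \<open>w\<close> contributes its eigenvalue \<open>x\<close> to \<open>\<langle>g(\<cdot>)w, w\<rangle>\<close>, and the gap \<open>b - a\<close>
  leaves room to keep the two operators ordered.\<close>

lemma operator_monotone_eq_imp_const: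
  assumes g: "operator_monotone g" and ab: "0 \<le> a" "a < b" "g a = g b" and x: "0 \<le> x"
  shows "g x = g a"
proof -
  have gm: "cfc g A \<le> cfc g B" if "0 \<le> A" "A \<le> B" for A B :: "ell2 bop"
    using g that by (simp add: operator_monotone_def)
  obtain w e :: ell2 where we: "norm w = 1" "norm e = 1" "cinner w e = 0"
    using ell2_orthonormal_pair by blast
  obtain R where R: "selfadj R" "R * R = R" "\<And>x. bop_apply R x = cinner x e *\<^sub>C e"
    "\<And>x. inner (bop_apply R x) x = (cmod (cinner x e))\<^sup>2"
    using rank_one_projection[OF we(2)] by blast
  have ww: "inner w w = 1" using we(1) by (simp add: norm_eq_1)
  have Rw: "inner (bop_apply R w) w = 0" by (simp add: R(4) we(3))
  note mono = operator_monotone_mono[OF g]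
  have below: "g y = g a" if y: "0 < y" "y < a" for y
  proof -
    obtain s Q where Q: "0 < s" "selfadj Q" "Q * Q = Q" "inner (bop_apply Q w) w = s\<^sup>2"
      "0 \<le> (b - a) *\<^sub>R 1 + a *\<^sub>R R - (b - y) *\<^sub>R Q"
      by (rule tilted_projection[OF we _ _ _ R(1,4), of "b - a" "b - y" a]) (use ab y in auto)
    \<comment> \<open>\<open>A\<close> has the value 0 on \<open>e\<close> and \<open>a\<close> on
      its complement; \<open>B\<close> has \<open>y\<close> on the tilted vector and
      \<open>b\<close> elsewhere. The strict condition on the tilt, \<open>b - y < b\<close>, is
      where \<open>0 < y\<close> enters.\<close>
    define A where "A = a *\<^sub>R 1 + (- a) *\<^sub>R R"
    define B where "B = b *\<^sub>R 1 + (y - b) *\<^sub>R Q"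
    have "0 \<le> A"
      unfolding positive_op_iff
    proof (intro conjI allI)
      show "selfadj A" unfolding A_def using R(1) by (intro selfadj_intros)
      fix v
      have "(cmod (cinner v e))\<^sup>2 \<le> (norm v)\<^sup>2"
        using cmod_cinner_le[of v e] we(2) by (intro power_mono) auto
      then have "a * (cmod (cinner v e))\<^sup>2 \<le> a * (norm v)\<^sup>2"
        using ab(1) by (rule mult_left_mono)
      then show "0 \<le> inner (bop_apply A v) v"
        by (simp add: A_def inner_left_distrib inner_diff_left R(4) power2_norm_eq_inner)
    qed
    moreover have "A \<le> B"
      using Q(5) by (simp add: A_def B_def algebra_simps)
    ultimately have "cfc g A \<le> cfc g B" by (rule gm)
    moreover have "cfc g A = g a *\<^sub>R 1 + (g (a + (- a)) - g a) *\<^sub>R R"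
      unfolding A_def using y by (intro cfc_scalar_plus_projection R) auto
    moreover have "cfc g B = g b *\<^sub>R 1 + (g (b + (y - b)) - g b) *\<^sub>R Q"
      unfolding B_def using ab y by (intro cfc_scalar_plus_projection Q) auto
    ultimately have "g a \<le> g b + (g y - g b) * s\<^sup>2"
      using bop_leD[of "cfc g A" "cfc g B" w] by (simp add: inner_left_distrib ww Rw Q(4))
    then have "0 \<le> (g y - g a) * s\<^sup>2" using ab(3) by simp
    then have "g a \<le> g y" using Q(1) by (simp add: zero_le_mult_iff)
    with mono[of y a] y show ?thesis by simp
  qed
  have above: "g y = g a" if y: "b < y" for y
  proof -
    \<comment> \<open>The larger eigenvalue of \<open>B\<close>; any number above \<open>y\<close>
      gives the strict inequality that the tilt requires.\<close>
    define r where "r = y + 1"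
    obtain s Q where Q: "0 < s" "selfadj Q" "Q * Q = Q" "inner (bop_apply Q w) w = s\<^sup>2"
      "0 \<le> (b - a) *\<^sub>R 1 + (r - b) *\<^sub>R R - (y - a) *\<^sub>R Q" "\<And>x. 0 \<le> inner (bop_apply Q x) x"
      by (rule tilted_projection[OF we _ _ _ R(1,4), of "b - a" "y - a" "r - b"])
        (use ab y in \<open>auto simp: r_def\<close>)
    define A where "A = a *\<^sub>R 1 + (y - a) *\<^sub>R Q"
    define B where "B = b *\<^sub>R 1 + (r - b) *\<^sub>R R"
    have "0 \<le> Q" using Q(2,6) by (simp add: positive_op_iff)
    then have "0 \<le> A"
      using ab y unfolding A_def by (intro add_nonneg_nonneg scaleR_bop_nonneg) auto
    moreover have "A \<le> B"
      using Q(5) by (simp add: A_def B_def algebra_simps)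
    ultimately have "cfc g A \<le> cfc g B" by (rule gm)
    moreover have "cfc g A = g a *\<^sub>R 1 + (g (a + (y - a)) - g a) *\<^sub>R Q"
      unfolding A_def using ab y by (intro cfc_scalar_plus_projection Q) auto
    moreover have "cfc g B = g b *\<^sub>R 1 + (g (b + (r - b)) - g b) *\<^sub>R R"
      unfolding B_def using y by (intro cfc_scalar_plus_projection R) (auto simp: r_def)
    ultimately have "g a + (g y - g a) * s\<^sup>2 \<le> g b"
      using bop_leD[of "cfc g A" "cfc g B" w] by (simp add: inner_left_distrib ww Rw Q(4))
    then have "(g y - g a) * s\<^sup>2 \<le> 0" using ab(3) by simp
    then have "g y \<le> g a" using Q(1) by (simp add: mult_le_0_iff)
    with mono[of a y] ab y show ?thesis by simp
  qed
  consider "x = 0" "0 < a" | "x = 0" "a = 0" | "0 < x" "x < a" | "a \<le> x" "x \<le> b" | "b < x"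
    using x ab by linarith
  then show ?thesis
  proof cases
    case 1
    \<comment> \<open>The tilt argument covers only positive \<open>y\<close>, so the value at 0
      comes by continuity along points of (0,a).\<close>
    have "(\<lambda>n. a / 2 / real (Suc n)) \<longlonglongrightarrow> 0"
      by (rule LIMSEQ_Suc[OF lim_const_over_n])
    moreover have "continuous_on {0..} g" using g by (simp add: operator_monotone_def)
    ultimately have "(\<lambda>n. g (a / 2 / real (Suc n))) \<longlonglongrightarrow> g 0"
      using 1(2) by (intro continuous_on_tendsto_compose[of "{0..}" g]) (auto intro!: always_eventually)
    moreover have "g (a / 2 / real (Suc n)) = g a" for n
      using 1(2) by (intro below) (auto simp: field_simps intro: add_pos_nonneg)
    ultimately have "(\<lambda>n. g a) \<longlonglongrightarrow> g 0" by simp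
    then show ?thesis using 1(1) LIMSEQ_unique tendsto_const by blast
  next
    case 4
    then show ?thesis using mono[of a x] mono[of x b] ab by simp
  qed (use below above in auto)
qed

lemma operator_monotone_inj_on:
  assumes "operator_monotone g" "\<exists>x\<ge>0. g x \<noteq> g 0"
  shows "inj_on g {0..}"
proof (rule linorder_inj_onI')
  fix a b :: real assume "a \<in> {0..}" "b \<in> {0..}" "a < b"
  then show "g a \<noteq> g b"
    using operator_monotone_eq_imp_const[OF assms(1), of a b] assms(2)
    by (metis atLeast_iff order_refl)
qed


section \<open>Solving the operator equation\<close>

lemma strictly_positive_rspec:
  assumes "strictly_positive A" "t \<in> rspec A"
  shows "0 < t"
proof -
  have "0 \<notin> rspec A" "0 \<le> A" using assms(1) by (simp_all add: strictly_positive_def rspec_iff)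
  with rspec_nonneg[OF \<open>0 \<le> A\<close> assms(2)] assms(2) show ?thesis
    by (metis order_le_less)
qed

lemma strictly_positive_powr_op:
  assumes A: "strictly_positive A"
  shows "0 \<le> powr_op A r" "powr_op A r * powr_op A s = powr_op A (r + s)"
    "powr_op A 0 = 1" "powr_op A 1 = A"
proof -
  have sA: "selfadj A" using A by (simp add: strictly_positive_def positive_selfadj)
  have cont: "continuous_on (rspec A) (\<lambda>t. t powr r)" for r
    using strictly_positive_rspec[OF A] by (intro continuous_intros) auto
  show "0 \<le> powr_op A r"
    unfolding powr_op_def by (intro cfc_nonneg sA cont) simp
  show "powr_op A r * powr_op A s = powr_op A (r + s)"
    unfolding powr_op_def cfc_mult[OF sA cont cont, symmetric] by (simp add: powr_add)
  \<comment> \<open>Since \<open>0 powr 0 = 0\<close>, exponent 0 gives the constant 1 only because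
    the spectrum is strictly positive.\<close>
  have "powr_op A 0 = cfc (\<lambda>t. 1) A" "powr_op A 1 = cfc (\<lambda>t. t) A"
    unfolding powr_op_def using strictly_positive_rspec[OF A]
    by (auto intro!: cfc_cong) force+
  then show "powr_op A 0 = 1" "powr_op A 1 = A" using sA by simp_all
qed

lemma strictly_positive_sqrt:
  fixes A :: "'a :: complex_hilbert_space bop"
  assumes A: "strictly_positive A"
  defines "P \<equiv> powr_op A (1/2)" and "Q \<equiv> powr_op A (- 1/2)"
  shows "P * Q = 1" "Q * P = 1" "P * P = A" "0 \<le> P" "0 \<le> Q"
  using strictly_positive_powr_op[OF A] by (simp_all add: P_def Q_def)

text \<open>With \<open>P\<close> and \<open>Q\<close> the powers 1/2 and -1/2 of \<open>A\<close>,
  the arguments are \<open>P * 1 * P\<close> and \<open>P * (Q * X * Q) * P\<close>, and conjugation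
  by the invertible \<open>P\<close> passes through the connection.\<close>

lemma connection_eq_conj_cfc:
  assumes "connection \<tau>" "representing_function \<tau> g" "strictly_positive A" "0 \<le> X"
  shows "\<tau> A X = powr_op A (1/2) * cfc g (powr_op A (- 1/2) * X * powr_op A (- 1/2)) * powr_op A (1/2)"
proof -
  let ?P = "powr_op A (1/2)" and ?Q = "powr_op A (- 1/2)"
  note PQ = strictly_positive_sqrt[OF assms(3)]
  have Y: "0 \<le> ?Q * X * ?Q" by (intro conj_nonneg positive_selfadj PQ assms)
  have "invertible_op ?P" using PQ unfolding invertible_op_def by blast
  from connection_conj[OF assms(1) one_bop_nonneg Y PQ(4) this]
  have "?P * \<tau> 1 (?Q * X * ?Q) * ?P = \<tau> (?P * ?P) (?P * ?Q * X * (?Q * ?P))"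
    by (simp add: mult.assoc)
  then show ?thesis
    using PQ connection_one_eq_cfc[OF assms(1,2) Y] by simp
qed

text \<open>A constant \<open>g\<close> makes \<open>\<sigma> X A\<close> equal to
  \<open>g 0 *\<^sub>R A\<close> for strictly positive \<open>A\<close>; (M3) along
  \<open>A + 1 / (n + 1)\<close> extends this to all positive \<open>A\<close>, so \<sigma> would be
  the excluded connection.\<close>

lemma representing_function_not_const:
  assumes \<sigma>: "connection \<sigma>" "\<not> scalar_multiple_of_right_trivial \<sigma>"
    and rep: "representing_function (transpose_conn \<sigma>) g"
  shows "\<exists>x\<ge>0. g x \<noteq> g 0"
proof (rule ccontr)
  assume "\<not> ?thesis"
  then have const: "g x = g 0" if "0 \<le> x" for x using that by blast
  note conn = connection_transpose_conn[OF \<sigma>(1)]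
  have g0: "0 \<le> g 0" using representing_nonneg[OF rep] by simp
  have inv: "transpose_conn \<sigma> A X = g 0 *\<^sub>R A" if A: "strictly_positive A" and X: "0 \<le> X" for A X
  proof -
    let ?Y = "powr_op A (- 1/2) * X * powr_op A (- 1/2)"
    have Y: "0 \<le> ?Y"
      by (intro conj_nonneg positive_selfadj strictly_positive_sqrt(5) A X)
    have "cfc g ?Y = cfc (\<lambda>_. g 0) ?Y"
      by (rule cfc_cong) (rule const, rule rspec_nonneg[OF Y])
    then show ?thesis
      using connection_eq_conj_cfc[OF conn rep A X] strictly_positive_sqrt(3)[OF A]
        positive_selfadj[OF Y] by simp
  qed
  have "\<sigma> X A = g 0 *\<^sub>R A" if A: "0 \<le> A" and X: "0 \<le> X" for A X
  proof -
    let ?A = "\<lambda>n. A + (1 / real (Suc n)) *\<^sub>R 1"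
    have A0: "0 \<le> ?A n" for n using A by (simp add: scaleR_bop_nonneg)
    have "strictly_positive (?A n)" for n
      using A0 invertible_add_scaleR_one[OF A] by (simp add: strictly_positive_def)
    then have "transpose_conn \<sigma> (?A n) X = g 0 *\<^sub>R A + (1 / real (Suc n)) *\<^sub>R (g 0 *\<^sub>R 1)" for n
      using inv[OF _ X] by (simp add: scaleR_add_right mult.commute)
    moreover have "decreases_to (\<lambda>n. transpose_conn \<sigma> (?A n) X) (transpose_conn \<sigma> A X)"
      by (intro connection_decreasing[OF conn] A0 A X decreases_to_add_scaleR
          decreases_to_const one_bop_nonneg)
    ultimately have "decreases_to (\<lambda>n. g 0 *\<^sub>R A + (1 / real (Suc n)) *\<^sub>R (g 0 *\<^sub>R 1))
        (transpose_conn \<sigma> A X)"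
      by simp
    moreover have "decreases_to (\<lambda>n. g 0 *\<^sub>R A + (1 / real (Suc n)) *\<^sub>R (g 0 *\<^sub>R 1)) (g 0 *\<^sub>R A)"
      using g0 by (intro decreases_to_add_scaleR scaleR_bop_nonneg) simp_all
    ultimately have "transpose_conn \<sigma> A X = g 0 *\<^sub>R A" by (rule decreases_to_unique)
    then show ?thesis by (simp add: transpose_conn_def)
  qed
  then have "scalar_multiple_of_right_trivial \<sigma>"
    using g0 unfolding scalar_multiple_of_right_trivial_def by blast
  with \<sigma>(2) show False ..
qed

theorem theorem3p2:
  fixes \<sigma> :: "'h :: complex_hilbert_space bop \<Rightarrow> 'h bop \<Rightarrow> 'h bop"
    and g :: "real \<Rightarrow> real" and A B D :: "'h bop"
  assumes "connection \<sigma>"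
    and "\<not> scalar_multiple_of_right_trivial \<sigma>"
    and "representing_function (transpose_conn \<sigma>) g"
    and "strictly_positive A"
    and "0 \<le> B"
    and "D = powr_op A (-1/2) * B * powr_op A (-1/2)"
  shows "((\<exists>X\<ge>0. \<sigma> X A = B) \<longleftrightarrow> Sp D \<subseteq> complex_of_real ` g ` {0..}) \<and>
         (\<forall>X\<ge>0. \<sigma> X A = B \<longrightarrow>
            X = powr_op A (1/2) * cfc (inv_into {0..} g) D * powr_op A (1/2))"
proof -
  let ?P = "powr_op A (1/2)" and ?Q = "powr_op A (-1/2)" and ?h = "inv_into {0..} g"
  note PQ = strictly_positive_sqrt[OF assms(4)]
  note conn = connection_transpose_conn[OF assms(1)]
  have om: "operator_monotone g" using assms(3) by (simp add: representing_function_def)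
  have inj: "inj_on g {0..}"
    using operator_monotone_inj_on[OF om] representing_function_not_const[OF assms(1-3)] by blast
  have cont: "continuous_on {0..} g" by (rule representing_continuous[OF assms(3)])
  have cancel: "?Q * (?P * Z * ?P) * ?Q = Z" "?P * (?Q * Z * ?Q) * ?P = Z" for Z
    by (metis PQ(1,2) mult.assoc mult_1_left mult_1_right)+
  have D: "0 \<le> D" unfolding assms(6) by (intro conj_nonneg positive_selfadj PQ assms(5))
  have eq: "\<sigma> X A = B \<longleftrightarrow> cfc g (?Q * X * ?Q) = D" if "0 \<le> X" for X
    using connection_eq_conj_cfc[OF conn assms(3,4) that] cancel assms(6)
    by (metis transpose_conn_def)
  \<comment> \<open>Any solution yields the spectral inclusion and its own formula, so necessity and
    uniqueness come together.\<close>
  have sol: "Sp D \<subseteq> complex_of_real ` g ` {0..} \<and> X = ?P * cfc ?h D * ?P"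
    if X: "0 \<le> X" "\<sigma> X A = B" for X
  proof -
    define Y where "Y = ?Q * X * ?Q"
    have Y: "0 \<le> Y" unfolding Y_def by (intro conj_nonneg positive_selfadj PQ X)
    have sY: "selfadj Y" by (rule positive_selfadj[OF Y])
    have gY: "cfc g Y = D" using eq X by (simp add: Y_def)
    have cY: "continuous_on (rspec Y) g" by (rule continuous_on_rspec_positive[OF Y cont])
    have "rspec D \<subseteq> g ` rspec Y" using rspec_cfc[OF sY cY] gY by blast
    also have "\<dots> \<subseteq> g ` {0..}" by (intro image_mono rspec_positive_subset Y)
    finally have "Sp D \<subseteq> complex_of_real ` g ` {0..}"
      unfolding Sp_eq_rspec[OF positive_selfadj[OF D]] by (rule image_mono)
    moreover have "X = ?P * cfc ?h D * ?P"
    proof -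
      have hg: "?h (g t) = t" if "t \<in> rspec Y" for t
        using inj rspec_nonneg[OF Y that] by simp
      \<comment> \<open>The inverse of a continuous injection on a compact set is
        continuous.\<close>
      have "continuous_on (g ` rspec Y) ?h"
        using hg by (intro continuous_on_inv cY compact_rspec sY) blast
      from cfc_compose[OF sY cY this] have "cfc ?h D = cfc (\<lambda>t. ?h (g t)) Y"
        by (simp add: gY)
      also have "\<dots> = cfc (\<lambda>t. t) Y" by (rule cfc_cong) (rule hg)
      finally have "cfc ?h D = Y" using sY by simp
      then show ?thesis by (simp only: Y_def cancel)
    qed
    ultimately show ?thesis ..
  qed
  have "\<exists>X\<ge>0. \<sigma> X A = B" if sub: "Sp D \<subseteq> complex_of_real ` g ` {0..}"
  proof -
    have sD: "selfadj D" by (rule positive_selfadj[OF D])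
    have spec: "t \<in> g ` {0..}" if "t \<in> rspec D" for t
      using that sub unfolding Sp_eq_rspec[OF sD] by auto
    have h0: "0 \<le> ?h t" "g (?h t) = t" if "t \<in> rspec D" for t
      using inv_into_into[OF spec[OF that]] f_inv_into_f[OF spec[OF that]] by auto
    have hc: "continuous_on (rspec D) ?h"
    proof (cases "rspec D = {}")
      case False
      have mono: "g s \<le> g t" if "0 \<le> s" "s \<le> t" for s t
        using operator_monotone_mono[OF om that] .
      obtain M where M: "M \<in> rspec D" "\<And>t. t \<in> rspec D \<Longrightarrow> t \<le> M"
        using compact_attains_sup[OF compact_rspec[OF sD] False] by blast
      have "rspec D \<subseteq> g ` {0..?h M}"
      proof
        fix t assume t: "t \<in> rspec D"
        have "?h t \<le> ?h M"
        proof (rule ccontr)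
          assume "\<not> ?h t \<le> ?h M"
          then have "g (?h M) \<le> g (?h t)" using h0[OF M(1)] by (intro mono) auto
          then have "t = M" using M(2)[OF t] h0[OF t] h0[OF M(1)] by simp
          with \<open>\<not> ?h t \<le> ?h M\<close> show False by simp
        qed
        then show "t \<in> g ` {0..?h M}" using h0[OF t] by (metis atLeastAtMost_iff imageI)
      qed
      moreover have "continuous_on (g ` {0..?h M}) ?h"
        using inj by (intro continuous_on_inv continuous_on_subset[OF cont]) auto
      ultimately show ?thesis using continuous_on_subset by blast
    qed simp
    define Y where "Y = cfc ?h D"
    have Y: "0 \<le> Y" unfolding Y_def using h0 by (intro cfc_nonneg sD hc) auto
    have "cfc g Y = cfc (\<lambda>t. g (?h t)) D"
      unfolding Y_def
      by (rule cfc_compose[OF sD hc]) (use h0 in \<open>auto intro: continuous_on_subset[OF cont]\<close>)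
    also have "\<dots> = cfc (\<lambda>t. t) D" by (rule cfc_cong) (rule h0)
    finally have "cfc g Y = D" using sD by simp
    moreover have X: "0 \<le> ?P * Y * ?P" by (intro conj_nonneg positive_selfadj PQ Y)
    ultimately have "\<sigma> (?P * Y * ?P) A = B" using eq[OF X] unfolding cancel by blast
    with X show ?thesis by blast
  qed
  with sol show ?thesis by blast
qed

end
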